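(* Let $w\in L^1([-1,1])$, $w\ge 0$, with $\int_{-1}^1 w(x)\,dx=1$, and assume $w$ belongs to the Szeg\H{o} class, i.e. $\log(w_0)\in L^1(\rho)$, where $\rho(x)=1/(\pi\sqrt{1-x^2})$ and $w_0(x)=\pi\sqrt{1-x^2}\,w(x)$. Let $(p_n)_{n\ge0}$ be the orthonormal polynomials with respect to $w(x)\,dx$ on $[-1,1]$, let $f_n(x)=p_n(x)\sqrt{w_0(x)}$ and, for $M>0$, $\Delta_n(M)=\{x\in[-1,1]: |f_n(x)|\ge M\}$. Then for every $M>\sqrt{2}$, $$E_n(w)=S(\rho,w)+\log 2-1-\int_{\Delta_n(M)} p_n^2(x)\log^+(p_n^2(x))\,w(x)\,dx+o(1),\qquad n\to\infty,$$ where $E_n(w)=-\int_{-1}^1 p_n^2(x)\log(p_n^2(x))\,w(x)\,dx$ and $S(\rho,w)=\int_{-1}^1\log(w_0(x))\,\rho(x)\,dx$.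
   Context: Orthonormal polynomials: $p_n$ has degree $n$, positive leading coefficient, and $\int_{-1}^1 p_np_m w\,dx=\delta_{mn}$. $\log^+(x)=\max\{\log x,0\}$ for $x>0$. $S(\rho,w)$ is the mutual entropy $-\int\log\big(\rho/w\big)\rho\,dx$, which equals $\int \log(w_0)\rho\,dx$. *)

theory Defs
  imports "HOL-Analysis.Analysis" "HOL-Computational_Algebra.Polynomial"
begin

text \<open>Positive part of the logarithm; note Isabelle's ln 0 = 0, so log_plus 0 = 0.\<close>
definition log_plus :: "real \<Rightarrow> real" where
  "log_plus x = max (ln x) 0"

definition cheb_rho :: "real \<Rightarrow> real" where
  "cheb_rho x = 1 / (pi * sqrt (1 - x\<^sup>2))"

definition w_zero :: "(real \<Rightarrow> real) \<Rightarrow> real \<Rightarrow> real" where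
  "w_zero w x = pi * sqrt (1 - x\<^sup>2) * w x"

definition orthonormal_polys :: "(real \<Rightarrow> real) \<Rightarrow> (nat \<Rightarrow> real poly) \<Rightarrow> bool" where
  "orthonormal_polys w p \<longleftrightarrow>
     (\<forall>n. degree (p n) = n \<and> lead_coeff (p n) > 0) \<and>
     (\<forall>m n. (LINT x:{-1..1}|lborel. poly (p n) x * poly (p m) x * w x)
              = (if m = n then 1 else 0))"

definition entropy_E :: "(real \<Rightarrow> real) \<Rightarrow> real poly \<Rightarrow> real" where
  "entropy_E w q = - (LINT x:{-1..1}|lborel. (poly q x)\<^sup>2 * ln ((poly q x)\<^sup>2) * w x)"

definition mutual_entropy_S :: "(real \<Rightarrow> real) \<Rightarrow> real" where
  "mutual_entropy_S w = (LINT x:{-1..1}|lborel. ln (w_zero w x) * cheb_rho x)"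

definition Delta_set :: "(real \<Rightarrow> real) \<Rightarrow> real poly \<Rightarrow> real \<Rightarrow> real set" where
  "Delta_set w q M = {x \<in> {-1..1}. \<bar>poly q x * sqrt (w_zero w x)\<bar> \<ge> M}"

end

theory Submission
  imports Defs "HOL-Complex_Analysis.Complex_Analysis"
    "HOL-Computational_Algebra.Fundamental_Theorem_Algebra"
begin

text \<open>
  Put \<open>x = cos t\<close> and let \<open>v t = w\<^sub>0 (cos t)\<close>, \<open>z = e\<^sup>i\<^sup>t\<close>; then \<open>F\<^sub>n t = p\<^sub>n (cos t) sqrt (v t)\<close> has norm 1 in
  \<open>L\<^sup>2\<close> of the normalised arc measure on \<open>[0, pi]\<close>. Everything rests on the asymptotics
  \<open>F\<^sub>n - sqrt 2 Re (z\<^sup>n u) \<rightarrow> 0\<close> in \<open>L\<^sup>2\<close> for a fixed unimodular function \<open>u\<close>.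

  The Szego function is avoided. Minimise \<open>N h = \<integral> |h(z)|\<^sup>2 v\<close> over real polynomials with \<open>h(0) = 1\<close>.
  The infimum \<open>d\<close> is positive: \<open>N h \<ge> exp (\<integral> ln v)\<close> by Jensen's inequality and \<open>\<integral> ln |h(z)| \<ge> ln |h(0)|\<close>.
  A minimising sequence converges to some \<open>g\<close> that is orthogonal to \<open>z\<^sup>j h sqrt v\<close> for \<open>j \<ge> 1\<close>, hence to
  \<open>z\<^sup>j g\<close>; so all cosine coefficients of \<open>|g|\<^sup>2\<close> but the zeroth vanish and \<open>|g|\<^sup>2 = d\<close> almost everywhere.
  With \<open>u = cnj g / sqrt d\<close> the inner product of \<open>F\<^sub>n\<close> and \<open>sqrt 2 Re (z\<^sup>n u)\<close> is
  \<open>k\<^sub>n 2\<^sup>-\<^sup>n sqrt (2 d)\<close>, where \<open>k\<^sub>n\<close> is the leading coefficient of \<open>p\<^sub>n\<close>, and comparing \<open>p\<^sub>n\<close> with the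
  polynomial \<open>2 Re (z\<^sup>n cnj (h(z)))\<close> in \<open>cos t\<close> shows that this tends to 1.

  Off \<open>\<Delta>\<^sub>n(M)\<close> the integrand is \<open>F\<^sub>n\<^sup>2 ln F\<^sub>n\<^sup>2 - F\<^sub>n\<^sup>2 ln v\<close> with \<open>F\<^sub>n\<close> bounded, so \<open>F\<^sub>n\<close> may be replaced by
  \<open>sqrt 2 Re (z\<^sup>n u)\<close>, whose values are equidistributed like \<open>sqrt 2 cos t\<close>; on \<open>\<Delta>\<^sub>n(M)\<close>, whose measure tends
  to 0 since \<open>M > sqrt 2\<close>, only \<open>p\<^sub>n\<^sup>2 log\<^sup>- (p\<^sub>n\<^sup>2) w \<le> w\<close> is neglected.
\<close>

section \<open>The normalised arc measure and the substitution \<open>x = cos t\<close>\<close>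

text \<open>\<open>cos\<close> carries this probability measure to the arcsine law
  \<open>cheb_rho\<close>. It is a density on the whole line, so that integrands stay total Borel
  functions of \<open>t\<close>.\<close>

definition arc_measure :: "real measure" where
  "arc_measure = density lborel (\<lambda>t. ennreal (indicator {0..pi} t / pi))"

lemma sets_arc_measure [simp, measurable_cong]: "sets arc_measure = sets borel"
  by (simp add: arc_measure_def)

lemma space_arc_measure [simp]: "space arc_measure = UNIV"
  by (simp add: arc_measure_def)

lemma emeasure_arc_measure_UNIV: "emeasure arc_measure UNIV = 1"
proof -
  have "emeasure arc_measure UNIV = (\<integral>\<^sup>+t. ennreal (1 / pi) * indicator {0..pi} t \<partial>lborel)"
    unfolding arc_measure_def by (subst emeasure_density) (auto intro!: nn_integral_cong split: split_indicator)
  also have "\<dots> = ennreal (1 / pi) * ennreal pi"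
    by (subst nn_integral_cmult_indicator) auto
  also have "\<dots> = 1"
    by (simp add: ennreal_mult[symmetric])
  finally show ?thesis .
qed

global_interpretation arc: finite_measure arc_measure
  by standard (simp add: emeasure_arc_measure_UNIV)

lemma measure_arc_measure_UNIV [simp]: "measure arc_measure UNIV = 1"
  by (simp add: measure_def emeasure_arc_measure_UNIV)

lemma AE_arc_measure_iff: "(AE t in arc_measure. P t) \<longleftrightarrow> (AE t in lborel. t \<in> {0..pi} \<longrightarrow> P t)"
  unfolding arc_measure_def
  by (subst AE_density) (auto intro!: arg_cong[where f="\<lambda>P. AE t in lborel. P t"] simp: fun_eq_iff split: split_indicator)

lemma integrable_arc_measure_iff:
  fixes f :: "real \<Rightarrow> 'b::{banach, second_countable_topology}"
  assumes [measurable]: "f \<in> borel_measurable borel"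
  shows "integrable arc_measure f \<longleftrightarrow> set_integrable lborel {0..pi} f"
proof -
  have "integrable arc_measure f \<longleftrightarrow> integrable lborel (\<lambda>t. (indicator {0..pi} t / pi) *\<^sub>R f t)"
    unfolding arc_measure_def by (intro integrable_density) auto
  also have "\<dots> \<longleftrightarrow> integrable lborel (\<lambda>t. (1 / pi) *\<^sub>R (indicator {0..pi} t *\<^sub>R f t))"
    by simp
  also have "\<dots> \<longleftrightarrow> set_integrable lborel {0..pi} f"
    unfolding set_integrable_def real_scaleR_def[symmetric]
    using integrable_scaleR_right[of "1 / pi" lborel "\<lambda>t. indicator {0..pi} t *\<^sub>R f t"]
      integrable_scaleR_right[of pi lborel "\<lambda>t. (1 / pi) *\<^sub>R (indicator {0..pi} t *\<^sub>R f t)"] by auto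
  finally show ?thesis .
qed

lemma integral_arc_measure:
  fixes f :: "real \<Rightarrow> 'b::{banach, second_countable_topology}"
  assumes [measurable]: "f \<in> borel_measurable borel"
  shows "integral\<^sup>L arc_measure f = (1 / pi) *\<^sub>R (LINT t:{0..pi}|lborel. f t)"
proof -
  have "integral\<^sup>L arc_measure f = integral\<^sup>L lborel (\<lambda>t. (indicator {0..pi} t / pi) *\<^sub>R f t)"
    unfolding arc_measure_def by (intro integral_density) auto
  also have "\<dots> = integral\<^sup>L lborel (\<lambda>t. (1 / pi) *\<^sub>R (indicator {0..pi} t *\<^sub>R f t))"
    by simp
  also have "\<dots> = (1 / pi) *\<^sub>R (LINT t:{0..pi}|lborel. f t)"
    unfolding set_lebesgue_integral_def by (rule integral_scaleR_right)
  finally show ?thesis .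
qed

lemma integral_arc_measure_continuous:
  fixes f :: "real \<Rightarrow> 'b::euclidean_space"
  assumes "continuous_on UNIV f"
  shows "integral\<^sup>L arc_measure f = (1 / pi) *\<^sub>R integral {0..pi} f"
proof -
  have "set_integrable lborel {0..pi} f"
    by (rule borel_integrable_atLeastAtMost') (rule continuous_on_subset[OF assms], simp)
  then show ?thesis
    by (simp add: integral_arc_measure borel_measurable_continuous_onI[OF assms] set_borel_integral_eq_integral)
qed

lemma integrable_arc_measure_bounded:
  fixes f :: "real \<Rightarrow> 'b::{banach, second_countable_topology}"
  assumes "f \<in> borel_measurable borel" "\<And>t. norm (f t) \<le> C"
  shows "integrable arc_measure f"
  using assms by (intro arc.integrable_const_bound[where B=C]) auto

text \<open>The substitution is made on \<open>[-pi, 0]\<close>, where \<open>cos\<close> increases,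
  and then reflected to \<open>[0, pi]\<close>. The factor \<open>pi\<close> undoes the
  normalisation of \<open>arc_measure\<close>.\<close>

lemma integral_cos_substitution:
  fixes f :: "real \<Rightarrow> real"
  assumes f: "set_integrable lborel {-1..1} f"
  shows "integrable arc_measure (\<lambda>t. f (cos t) * (pi * \<bar>sin t\<bar>))"
    and "(LINT x:{-1..1}|lborel. f x) = integral\<^sup>L arc_measure (\<lambda>t. f (cos t) * (pi * \<bar>sin t\<bar>))"
proof -
  \<comment> \<open>\<open>f\<close> is known to be measurable only on \<open>[-1, 1]\<close>; the
    cut-off function is Borel everywhere and agrees with \<open>f\<close> at every
    \<open>cos t\<close>.\<close>
  define g where "g x = indicator {-1..1} x *\<^sub>R f x" for x
  have gm [measurable]: "g \<in> borel_measurable borel"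
    using borel_measurable_integrable[OF f[unfolded set_integrable_def]] by (simp add: g_def[abs_def])
  have gf: "g (cos t) = f (cos t)" for t
    by (simp add: g_def)
  have "set_integrable lborel {cos (-pi)..cos 0} f"
    using f by simp
  then have 1: "set_integrable lborel {-pi..0} (\<lambda>t. f (cos t) * (- sin t))"
    and "(LBINT x. f x * indicator {cos (-pi)..cos 0} x) = (LBINT t. f (cos t) * (- sin t) * indicator {-pi..0} t)"
    by (rule integral_substitution; (auto intro!: derivative_eq_intros continuous_intros)?; smt (verit) sin_ge_zero sin_minus)+
  then have 2: "(LINT x:{cos (-pi)..cos 0}|lborel. f x) = (LINT t:{-pi..0}|lborel. f (cos t) * (- sin t))"
    by (simp add: set_lebesgue_integral_def mult.commute)
  have 3: "indicator {-pi..0} (- t) *\<^sub>R (f (cos (- t)) * (- sin (- t)))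
      = indicator {0..pi} t *\<^sub>R (f (cos t) * \<bar>sin t\<bar>)" for t :: real
    using sin_ge_zero[of t] by (auto split: split_indicator)
  have i: "integrable lborel (\<lambda>t. indicator {-pi..0} (- t) *\<^sub>R (f (cos (- t)) * (- sin (- t))))"
    using lborel_integrable_real_affine[OF 1[unfolded set_integrable_def], of "-1" 0] by simp
  then have 4: "set_integrable lborel {0..pi} (\<lambda>t. f (cos t) * \<bar>sin t\<bar>)"
    unfolding 3 set_integrable_def .
  have 5: "(LINT t:{-pi..0}|lborel. f (cos t) * (- sin t)) = (LINT t:{0..pi}|lborel. f (cos t) * \<bar>sin t\<bar>)"
    unfolding set_lebesgue_integral_def
    by (subst lborel_integral_real_affine[where c="-1" and t=0])
       (auto intro!: Bochner_Integration.integral_cong simp: sin_ge_zero split: split_indicator)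
  have m: "(\<lambda>t. f (cos t) * (pi * \<bar>sin t\<bar>)) \<in> borel_measurable borel"
    unfolding gf[symmetric] by measurable
  have eq: "(\<lambda>t. f (cos t) * (pi * \<bar>sin t\<bar>)) = (\<lambda>t. pi * (f (cos t) * \<bar>sin t\<bar>))"
    by auto
  show "integrable arc_measure (\<lambda>t. f (cos t) * (pi * \<bar>sin t\<bar>))"
    unfolding integrable_arc_measure_iff[OF m] unfolding eq using 4 by (rule set_integrable_mult_right)
  show "(LINT x:{-1..1}|lborel. f x) = integral\<^sup>L arc_measure (\<lambda>t. f (cos t) * (pi * \<bar>sin t\<bar>))"
    unfolding integral_arc_measure[OF m] unfolding eq using 2 5 by simp
qed

section \<open>Density of cosine polynomials, Riemann--Lebesgue, uniqueness\<close>

lemma borel_measurable_poly [measurable]: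
  fixes q :: "'a :: real_normed_field poly"
  shows "poly q \<in> borel_measurable borel"
  by (intro borel_measurable_continuous_onI continuous_at_imp_continuous_on ballI poly_isCont)

lemma borel_measurable_cis [measurable]: "cis \<in> borel_measurable borel"
  by (intro borel_measurable_continuous_onI continuous_intros)

lemma borel_measurable_cnj [measurable]: "cnj \<in> borel_measurable borel"
  by (intro borel_measurable_continuous_onI continuous_intros)

lemma Weierstrass_poly_approximation:
  fixes f :: "real \<Rightarrow> real"
  assumes "continuous_on {a..b} f" "0 < e"
  shows "\<exists>q :: real poly. \<forall>x\<in>{a..b}. \<bar>f x - poly q x\<bar> < e"
proof -
  obtain g where g: "real_polynomial_function g" "\<And>x. x \<in> {a..b} \<Longrightarrow> \<bar>f x - g x\<bar> < e"
    using Stone_Weierstrass_real_polynomial_function[OF compact_Icc assms] by metis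
  then obtain c n where c: "g = (\<lambda>x. \<Sum>i\<le>n. c i * x ^ i)"
    by (auto simp: real_polynomial_function_iff_sum)
  have "poly (\<Sum>i\<le>n. monom (c i) i) x = g x" for x
    by (simp add: poly_sum poly_monom c)
  then show ?thesis
    using g(2) by metis
qed

text \<open>A measurable function is an almost everywhere limit of continuous ones. Clipping these
  at \<open>C\<close> and reading them as functions of \<open>x = cos t\<close> through
  \<open>arccos\<close> opens them to the Weierstrass theorem; the uniform bound serves dominated
  convergence later.\<close>

lemma bounded_measurable_AE_limit_cos_poly:
  fixes G :: "real \<Rightarrow> real"
  assumes G [measurable]: "G \<in> borel_measurable borel" and C: "\<And>t. \<bar>G t\<bar> \<le> C"
  shows "\<exists>q :: nat \<Rightarrow> real poly. (\<forall>k. \<forall>x\<in>{-1..1}. \<bar>poly (q k) x\<bar> \<le> C + 1) \<and>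
           (AE t in arc_measure. (\<lambda>k. poly (q k) (cos t)) \<longlonglongrightarrow> G t)"
proof -
  have C0: "0 \<le> C"
    using C[of 0] by linarith
  have "G measurable_on UNIV"
    by (intro lebesgue_measurable_imp_measurable_on) (auto simp: measurable_completion)
  then obtain N g where N: "negligible N" and g: "\<And>n. continuous_on UNIV (g n)"
    and lim: "\<And>t. t \<notin> N \<Longrightarrow> (\<lambda>n. g n t) \<longlonglongrightarrow> G t"
    unfolding measurable_on_def by auto
  define c where "c n t = max (- C) (min C (g n t))" for n t
  have "\<exists>q :: real poly. \<forall>x\<in>{-1..1}. \<bar>c n (arccos x) - poly q x\<bar> < 1 / real (Suc n)" for n
    unfolding c_def
    by (intro Weierstrass_poly_approximation continuous_intros continuous_on_compose2[OF g]) auto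
  then obtain q :: "nat \<Rightarrow> real poly"
    where q: "\<And>n x. x \<in> {-1..1} \<Longrightarrow> \<bar>c n (arccos x) - poly (q n) x\<bar> < 1 / real (Suc n)"
    by metis
  have "\<bar>poly (q k) x\<bar> \<le> C + 1" if "x \<in> {-1..1}" for k x
  proof -
    have "\<bar>c k (arccos x)\<bar> \<le> C" "1 / real (Suc k) \<le> 1"
      using C0 by (auto simp: c_def)
    then show ?thesis
      using q[OF that, of k] by linarith
  qed
  moreover have "(\<lambda>k. poly (q k) (cos t)) \<longlonglongrightarrow> G t" if "t \<notin> N" "t \<in> {0..pi}" for t
  proof -
    have "(\<lambda>n. c n t) \<longlonglongrightarrow> max (- C) (min C (G t))"
      unfolding c_def by (intro tendsto_intros lim that)
    then have 1: "(\<lambda>n. c n t) \<longlonglongrightarrow> G t"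
      using C[of t] by (simp add: max_def min_def abs_le_iff split: if_splits)
    have "(\<lambda>n. c n t - poly (q n) (cos t)) \<longlonglongrightarrow> 0"
    proof (rule Lim_null_comparison)
      show "\<forall>\<^sub>F n in sequentially. norm (c n t - poly (q n) (cos t)) \<le> 1 / real (Suc n)"
        using q[of "cos t"] that by (intro always_eventually) (auto simp: arccos_cos less_imp_le)
      show "(\<lambda>n. 1 / real (Suc n)) \<longlonglongrightarrow> 0"
        using LIMSEQ_inverse_real_of_nat by (simp add: inverse_eq_divide)
    qed
    from tendsto_diff[OF 1 this] show ?thesis
      by simp
  qed
  moreover have "AE t in lborel. t \<notin> N"
    using N unfolding negligible_iff_null_sets by (metis AE_not_in AE_completion_iff)
  ultimately show ?thesis
    unfolding AE_arc_measure_iff by (intro exI[of _ q]) auto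
qed

text \<open>Truncation at a height \<open>K\<close> reduces the claim to bounded functions, for
  which the preceding pointwise approximation also converges in the mean.\<close>

lemma cos_poly_dense_L1:
  fixes H :: "real \<Rightarrow> real"
  assumes H: "integrable arc_measure H" and e: "0 < e"
  shows "\<exists>q :: real poly. (\<integral>t. \<bar>H t - poly q (cos t)\<bar> \<partial>arc_measure) < e"
proof -
  have [measurable]: "H \<in> borel_measurable borel"
    using borel_measurable_integrable[OF H] by simp
  define T where "T K t = max (- real K) (min (real K) (H t))" for K t
  have "(\<lambda>K. \<integral>t. \<bar>H t - T K t\<bar> \<partial>arc_measure) \<longlonglongrightarrow> (\<integral>t. 0 \<partial>arc_measure)"
  proof (rule integral_dominated_convergence[where w="\<lambda>t. \<bar>H t\<bar>"])
    show "AE t in arc_measure. (\<lambda>K. \<bar>H t - T K t\<bar>) \<longlonglongrightarrow> 0"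
    proof (intro AE_I2 tendsto_eventually)
      fix t
      obtain k where k: "\<bar>H t\<bar> \<le> real k"
        using real_arch_simple by blast
      show "\<forall>\<^sub>F K in sequentially. \<bar>H t - T K t\<bar> = 0"
        using eventually_ge_at_top[of k] by eventually_elim (use k in \<open>auto simp: T_def\<close>)
    qed
    show "AE t in arc_measure. norm \<bar>H t - T K t\<bar> \<le> \<bar>H t\<bar>" for K
      by (intro AE_I2) (auto simp: T_def)
  qed (use H in \<open>auto simp: T_def\<close>)
  then have "\<forall>\<^sub>F K in sequentially. (\<integral>t. \<bar>H t - T K t\<bar> \<partial>arc_measure) < e / 2"
    using e by (intro order_tendstoD) auto
  then obtain K where K: "(\<integral>t. \<bar>H t - T K t\<bar> \<partial>arc_measure) < e / 2"
    by (auto simp: eventually_sequentially)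
  have Tm [measurable]: "T K \<in> borel_measurable borel"
    by (simp add: T_def[abs_def])
  have TK: "\<bar>T K t\<bar> \<le> real K" for t
    by (auto simp: T_def)
  obtain q :: "nat \<Rightarrow> real poly" where q: "\<And>k x. x \<in> {-1..1} \<Longrightarrow> \<bar>poly (q k) x\<bar> \<le> real K + 1"
      "AE t in arc_measure. (\<lambda>k. poly (q k) (cos t)) \<longlonglongrightarrow> T K t"
    using bounded_measurable_AE_limit_cos_poly[OF Tm TK] by blast
  have qb: "\<bar>poly (q k) (cos t)\<bar> \<le> real K + 1" for k t
    by (intro q) auto
  have "(\<lambda>k. \<integral>t. \<bar>T K t - poly (q k) (cos t)\<bar> \<partial>arc_measure) \<longlonglongrightarrow> (\<integral>t. 0 \<partial>arc_measure)"
  proof (rule integral_dominated_convergence[where w="\<lambda>t. 2 * real K + 1"])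
    show "AE t in arc_measure. (\<lambda>k. \<bar>T K t - poly (q k) (cos t)\<bar>) \<longlonglongrightarrow> 0"
      using q(2)
    proof eventually_elim
      fix t assume "(\<lambda>k. poly (q k) (cos t)) \<longlonglongrightarrow> T K t"
      then show "(\<lambda>k. \<bar>T K t - poly (q k) (cos t)\<bar>) \<longlonglongrightarrow> 0"
        using tendsto_rabs[OF tendsto_diff[OF tendsto_const[of "T K t"]]] by force
    qed
    show "AE t in arc_measure. norm \<bar>T K t - poly (q k) (cos t)\<bar> \<le> 2 * real K + 1" for k
      by (intro AE_I2) (use TK qb in \<open>smt (verit) real_norm_def\<close>)
  qed auto
  then have "\<forall>\<^sub>F k in sequentially. (\<integral>t. \<bar>T K t - poly (q k) (cos t)\<bar> \<partial>arc_measure) < e / 2"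
    using e by (intro order_tendstoD) auto
  then obtain k where k: "(\<integral>t. \<bar>T K t - poly (q k) (cos t)\<bar> \<partial>arc_measure) < e / 2"
    by (auto simp: eventually_sequentially)
  have iT: "integrable arc_measure (T K)"
    using TK by (intro integrable_arc_measure_bounded[where C="real K"]) auto
  have iq: "integrable arc_measure (\<lambda>t. poly (q k) (cos t))"
    using qb by (intro integrable_arc_measure_bounded[where C="real K + 1"]) auto
  have "(\<integral>t. \<bar>H t - poly (q k) (cos t)\<bar> \<partial>arc_measure)
      \<le> (\<integral>t. \<bar>H t - T K t\<bar> + \<bar>T K t - poly (q k) (cos t)\<bar> \<partial>arc_measure)"
    using H iT iq by (intro integral_mono) auto
  also have "\<dots> = (\<integral>t. \<bar>H t - T K t\<bar> \<partial>arc_measure) + (\<integral>t. \<bar>T K t - poly (q k) (cos t)\<bar> \<partial>arc_measure)"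
    using H iT iq by (intro Bochner_Integration.integral_add) auto
  finally show ?thesis
    using K k by (intro exI[of _ "q k"]) linarith
qed

lemma integrable_bounded_mult:
  fixes H :: "'a \<Rightarrow> 'b::{banach, second_countable_topology, real_normed_algebra}"
  assumes "integrable M H" "\<psi> \<in> borel_measurable M" "\<And>t. norm (\<psi> t) \<le> C"
  shows "integrable M (\<lambda>t. H t * \<psi> t)"
proof (rule Bochner_Integration.integrable_bound[where f="\<lambda>t. C * norm (H t)"])
  have "norm (H t * \<psi> t) \<le> norm (C * norm (H t))" for t
  proof -
    have "norm (H t * \<psi> t) \<le> norm (H t) * norm (\<psi> t)"
      by (rule norm_mult_ineq)
    also have "\<dots> \<le> norm (H t) * C"
      by (intro mult_left_mono assms) auto
    finally show ?thesis
      by (simp add: mult.commute)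
  qed
  then show "AE t in M. norm (H t * \<psi> t) \<le> norm (C * norm (H t))"
    by simp
qed (use assms in auto)

lemma poly_cos_bounded:
  fixes q :: "real poly"
  shows "\<exists>C. \<forall>t. \<bar>poly q (cos t)\<bar> \<le> C"
proof -
  have "compact (poly q ` {-1..1})"
    by (intro compact_continuous_image continuous_intros) auto
  then obtain C where "\<forall>y\<in>poly q ` {-1..1}. norm y \<le> C"
    using compact_imp_bounded bounded_iff by metis
  then show ?thesis
    by (intro exI[of _ C]) auto
qed

lemma integrable_poly_cos: "integrable arc_measure (\<lambda>t. poly q (cos t) :: real)"
proof -
  obtain C where "\<And>t. \<bar>poly q (cos t)\<bar> \<le> C"
    using poly_cos_bounded by metis
  then show ?thesis
    by (intro integrable_arc_measure_bounded[where C=C]) auto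
qed

lemma integrable_poly_cos_mult:
  fixes H :: "real \<Rightarrow> real"
  assumes "integrable arc_measure H"
  shows "integrable arc_measure (\<lambda>t. poly q (cos t) * H t)"
proof -
  obtain C where "\<And>t. \<bar>poly q (cos t)\<bar> \<le> C"
    using poly_cos_bounded by metis
  from integrable_bounded_mult[OF assms, of "\<lambda>t. poly q (cos t)" C] this show ?thesis
    by (simp add: mult.commute)
qed

section \<open>Riemann--Lebesgue lemma on the half circle\<close>

text \<open>Over a half circle the integral need not vanish for \<open>m > 0\<close>, but the
  explicit antiderivative bounds it by a multiple of \<open>1 / m\<close>.\<close>

lemma integral_cis_arc_measure_tendsto_0:
  "(\<lambda>m. \<integral>t. cis (real m * t) \<partial>arc_measure) \<longlonglongrightarrow> 0"
proof (rule Lim_null_comparison)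
  show "(\<lambda>m. 2 / pi * (1 / real m)) \<longlonglongrightarrow> 0"
    by (intro tendsto_mult_right_zero lim_1_over_n)
  have "norm (\<integral>t. cis (real m * t) \<partial>arc_measure) \<le> 2 / pi * (1 / real m)" if m: "m > 0" for m
  proof -
    have "((\<lambda>t. cis (real m * t)) has_integral
        (cis (real m * pi) / (\<i> * real m) - cis (real m * 0) / (\<i> * real m))) {0..pi}"
    proof (rule fundamental_theorem_of_calculus)
      show "((\<lambda>t. cis (real m * t) / (\<i> * real m)) has_vector_derivative cis (real m * t)) (at t within {0..pi})" for t
        unfolding cis_conv_exp using m
        by (auto intro!: derivative_eq_intros has_vector_derivative_real_field simp: field_simps)
    qed simp
    then have "(\<integral>t. cis (real m * t) \<partial>arc_measure) = (1 / pi) *\<^sub>R (cis (real m * pi) / (\<i> * real m) - 1 / (\<i> * real m))"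
      by (subst integral_arc_measure_continuous) (auto intro!: continuous_intros dest: integral_unique)
    moreover have "norm (cis (real m * pi) / (\<i> * real m) - 1 / (\<i> * real m)) \<le> 1 / real m + 1 / real m"
      by (rule order_trans[OF norm_triangle_ineq4]) (simp add: norm_divide norm_mult)
    ultimately show ?thesis
      by (simp add: pos_divide_le_eq)
  qed
  then show "\<forall>\<^sub>F m in sequentially. norm (\<integral>t. cis (real m * t) \<partial>arc_measure) \<le> 2 / pi * (1 / real m)"
    by (rule eventually_mono[OF eventually_gt_at_top[of 0]])
qed

text \<open>The recursion behind the inductions over polynomials in \<open>cos t\<close>: a factor
  \<open>cos t\<close> moves a frequency up and down by one and averages.\<close>

lemma cos_times_cis: "complex_of_real (cos t) * cis (real (Suc m) * t) = (cis (real (Suc (Suc m)) * t) + cis (real m * t)) / 2"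
proof -
  have "complex_of_real (cos t) = (cis t + cis (- t)) / 2"
    by (simp add: complex_eq_iff)
  then have "complex_of_real (cos t) * cis (real (Suc m) * t)
      = (cis t * cis (real (Suc m) * t) + cis (- t) * cis (real (Suc m) * t)) / 2"
    by (simp only: distrib_right times_divide_eq_left)
  also have "\<dots> = (cis (real (Suc (Suc m)) * t) + cis (real m * t)) / 2"
    unfolding cis_mult by (intro arg_cong2[where f="\<lambda>x y. (cis x + cis y) / 2"]) (simp_all add: algebra_simps)
  finally show ?thesis .
qed

lemma integral_poly_cos_cis_tendsto_0:
  fixes q :: "real poly"
  shows "(\<lambda>m. \<integral>t. complex_of_real (poly q (cos t)) * cis (real m * t) \<partial>arc_measure) \<longlonglongrightarrow> 0"
proof (induction q)
  case 0
  then show ?case by simp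
next
  case (pCons a q)
  define I where "I m = (\<integral>t. complex_of_real (poly q (cos t)) * cis (real m * t) \<partial>arc_measure)" for m
  have int: "integrable arc_measure (\<lambda>t. complex_of_real (poly q (cos t)) * cis (real m * t))" for m q
    by (intro integrable_bounded_mult[where C=1] integrable_of_real integrable_poly_cos) auto
  have intc: "integrable arc_measure (\<lambda>t. complex_of_real a * cis (real m * t))" for m
    using int[of "[:a:]" m] by simp
  \<comment> \<open>The frequency is \<open>Suc m\<close>, so that both neighbours
    \<open>Suc (Suc m)\<close> and \<open>m\<close> are natural numbers; the index is shifted back
    at the end.\<close>
  have "(\<integral>t. complex_of_real (poly (pCons a q) (cos t)) * cis (real (Suc m) * t) \<partial>arc_measure)
      = complex_of_real a * (\<integral>t. cis (real (Suc m) * t) \<partial>arc_measure) + (I (Suc (Suc m)) + I m) / 2" for m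
  proof -
    have "complex_of_real (poly (pCons a q) (cos t)) * cis (real (Suc m) * t)
        = complex_of_real a * cis (real (Suc m) * t)
          + (complex_of_real (poly q (cos t)) * cis (real (Suc (Suc m)) * t)
             + complex_of_real (poly q (cos t)) * cis (real m * t)) / 2" for t
    proof -
      have "complex_of_real (poly (pCons a q) (cos t)) * cis (real (Suc m) * t)
          = complex_of_real a * cis (real (Suc m) * t)
            + complex_of_real (poly q (cos t)) * (complex_of_real (cos t) * cis (real (Suc m) * t))"
        by (simp add: algebra_simps)
      then show ?thesis
        unfolding cos_times_cis by (simp only: times_divide_eq_right distrib_left)
    qed
    then show ?thesis
      using int intc by (simp add: I_def del: of_nat_Suc cis_mult)
  qed
  moreover have "(\<lambda>m. complex_of_real a * (\<integral>t. cis (real (Suc m) * t) \<partial>arc_measure) + (I (Suc (Suc m)) + I m) / 2)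
      \<longlonglongrightarrow> complex_of_real a * 0 + (0 + 0) / 2"
    using pCons.IH unfolding I_def[symmetric]
    by (intro tendsto_intros LIMSEQ_Suc integral_cis_arc_measure_tendsto_0 LIMSEQ_Suc[OF LIMSEQ_Suc]) auto
  ultimately show ?case
    by (subst filterlim_sequentially_Suc[symmetric]) simp
qed

text \<open>Since \<open>cis\<close> has modulus 1, approximating \<open>H\<close> in the mean by a
  polynomial in \<open>cos t\<close> changes the integral by an amount independent of
  \<open>m\<close>.\<close>

lemma Riemann_Lebesgue_real:
  fixes H :: "real \<Rightarrow> real"
  assumes H: "integrable arc_measure H"
  shows "(\<lambda>m. \<integral>t. complex_of_real (H t) * cis (real m * t) \<partial>arc_measure) \<longlonglongrightarrow> 0"
proof (rule LIMSEQ_I)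
  fix e :: real
  assume e: "0 < e"
  obtain q :: "real poly" where q: "(\<integral>t. \<bar>H t - poly q (cos t)\<bar> \<partial>arc_measure) < e / 2"
    using cos_poly_dense_L1[OF H, of "e / 2"] e by auto
  define I where "I m = (\<integral>t. complex_of_real (poly q (cos t)) * cis (real m * t) \<partial>arc_measure)" for m
  have "I \<longlonglongrightarrow> 0"
    unfolding I_def by (rule integral_poly_cos_cis_tendsto_0)
  then obtain m0 where m0: "\<And>m. m \<ge> m0 \<Longrightarrow> norm (I m) < e / 2"
    using e LIMSEQ_D[of I 0 "e / 2"] by auto
  have "norm ((\<integral>t. complex_of_real (H t) * cis (real m * t) \<partial>arc_measure) - 0) < e" if "m \<ge> m0" for m
  proof -
    have i1: "integrable arc_measure (\<lambda>t. complex_of_real (H t) * cis (real m * t))"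
      by (intro integrable_bounded_mult[where C=1] integrable_of_real H) auto
    have i2: "integrable arc_measure (\<lambda>t. complex_of_real (poly q (cos t)) * cis (real m * t))"
      by (intro integrable_bounded_mult[where C=1] integrable_of_real integrable_poly_cos) auto
    have "norm ((\<integral>t. complex_of_real (H t) * cis (real m * t) \<partial>arc_measure) - I m)
        = norm (\<integral>t. complex_of_real (H t) * cis (real m * t) - complex_of_real (poly q (cos t)) * cis (real m * t) \<partial>arc_measure)"
      unfolding I_def using i1 i2 by simp
    also have "\<dots> \<le> (\<integral>t. norm (complex_of_real (H t) * cis (real m * t) - complex_of_real (poly q (cos t)) * cis (real m * t)) \<partial>arc_measure)"
      by (rule integral_norm_bound)
    also have "\<dots> = (\<integral>t. \<bar>H t - poly q (cos t)\<bar> \<partial>arc_measure)"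
      by (simp add: left_diff_distrib[symmetric] norm_mult of_real_diff[symmetric] del: of_real_diff)
    finally show ?thesis
      using q m0[OF that] norm_triangle_ineq2[of "\<integral>t. complex_of_real (H t) * cis (real m * t) \<partial>arc_measure" "I m"] by simp
  qed
  then show "\<exists>no. \<forall>m\<ge>no. norm ((\<integral>t. complex_of_real (H t) * cis (real m * t) \<partial>arc_measure) - 0) < e"
    by blast
qed

lemma Riemann_Lebesgue:
  fixes H :: "real \<Rightarrow> complex"
  assumes H: "integrable arc_measure H"
  shows "(\<lambda>m. \<integral>t. H t * cis (real m * t) \<partial>arc_measure) \<longlonglongrightarrow> 0"
proof -
  have i: "integrable arc_measure (\<lambda>t. Re (H t))" "integrable arc_measure (\<lambda>t. Im (H t))"
    using H by auto
  have "(\<integral>t. H t * cis (real m * t) \<partial>arc_measure) = (\<integral>t. complex_of_real (Re (H t)) * cis (real m * t) \<partial>arc_measure)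
      + \<i> * (\<integral>t. complex_of_real (Im (H t)) * cis (real m * t) \<partial>arc_measure)" for m
  proof -
    have "integrable arc_measure (\<lambda>t. complex_of_real (Re (H t)) * cis (real m * t))"
      by (intro integrable_bounded_mult[where C=1] integrable_of_real i) auto
    moreover have "integrable arc_measure (\<lambda>t. complex_of_real (Im (H t)) * cis (real m * t))"
      by (intro integrable_bounded_mult[where C=1] integrable_of_real i) auto
    moreover have "H t * cis (real m * t) = complex_of_real (Re (H t)) * cis (real m * t)
        + \<i> * (complex_of_real (Im (H t)) * cis (real m * t))" for t
      by (subst complex_eq[of "H t"]) (simp add: algebra_simps)
    ultimately show ?thesis
      by simp
  qed
  then show ?thesis
    using tendsto_add[OF Riemann_Lebesgue_real[OF i(1)] tendsto_mult_right_zero[OF Riemann_Lebesgue_real[OF i(2)], of \<i>]]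
    by simp
qed

text \<open>\<open>F\<close> is orthogonal to all polynomials in \<open>cos t\<close>. Boundedly
  convergent polynomials approximating \<open>sgn (F t)\<close> then show that the integral of
  \<open>|F|\<close> is zero.\<close>

lemma Fourier_cosine_unique:
  fixes F :: "real \<Rightarrow> real"
  assumes F: "integrable arc_measure F"
    and zero: "\<And>j::nat. (\<integral>t. cos (real j * t) * F t \<partial>arc_measure) = 0"
  shows "AE t in arc_measure. F t = 0"
proof -
  have [measurable]: "F \<in> borel_measurable borel"
    using borel_measurable_integrable[OF F] by simp
  have int: "integrable arc_measure (\<lambda>t. poly q (cos t) * (cos (of_int j * t) * F t))" for q and j :: int
    using integrable_bounded_mult[OF F, of "\<lambda>t. cos (of_int j * t)" 1]
    by (intro integrable_poly_cos_mult) (simp add: mult.commute)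
  \<comment> \<open>The extra factor with an arbitrary integer frequency \<open>j\<close> makes the
    induction close, because its step leads to \<open>j + 1\<close> and \<open>j - 1\<close>; only
    \<open>j = 0\<close> is wanted.\<close>
  have poly0: "(\<integral>t. poly q (cos t) * (cos (of_int j * t) * F t) \<partial>arc_measure) = 0" for q :: "real poly" and j :: int
  proof (induction q arbitrary: j)
    case 0
    then show ?case by simp
  next
    case (pCons a q)
    have "(\<integral>t. cos (of_int j * t) * F t \<partial>arc_measure) = 0"
    proof (cases "j \<ge> 0")
      case True
      then show ?thesis using zero[of "nat j"] by simp
    next
      case False
      have "cos (real (nat (- j)) * t) = cos (of_int j * t)" for t
        using False by simp
      then show ?thesis using zero[of "nat (- j)"] by simp
    qed
    moreover have "poly (pCons a q) (cos t) * (cos (of_int j * t) * F t)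
        = a * (cos (of_int j * t) * F t) + (poly q (cos t) * (cos (of_int (j + 1) * t) * F t)
            + poly q (cos t) * (cos (of_int (j - 1) * t) * F t)) / 2" for t
    proof -
      have "cos t * cos (of_int j * t) = (cos (of_int (j + 1) * t) + cos (of_int (j - 1) * t)) / 2"
        by (subst mult.commute) (simp add: cos_times_cos ring_distribs)
      moreover have "poly (pCons a q) (cos t) * (cos (of_int j * t) * F t)
          = a * (cos (of_int j * t) * F t) + poly q (cos t) * F t * (cos t * cos (of_int j * t))"
        by (simp add: algebra_simps)
      ultimately show ?thesis
        by (simp only: times_divide_eq_right distrib_left mult_ac)
    qed
    ultimately show ?case
      using pCons.IH int[of 1 j] int[of q "j + 1"] int[of q "j - 1"]
      by (simp del: of_int_add of_int_diff poly_pCons)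
  qed
  obtain q :: "nat \<Rightarrow> real poly" where q: "\<And>k x. x \<in> {-1..1} \<Longrightarrow> \<bar>poly (q k) x\<bar> \<le> 1 + 1"
      "AE t in arc_measure. (\<lambda>k. poly (q k) (cos t)) \<longlonglongrightarrow> sgn (F t)"
    using bounded_measurable_AE_limit_cos_poly[of "\<lambda>t. sgn (F t)" 1] by (force simp: sgn_if)
  have "(\<lambda>k. \<integral>t. poly (q k) (cos t) * F t \<partial>arc_measure) \<longlonglongrightarrow> (\<integral>t. sgn (F t) * F t \<partial>arc_measure)"
  proof (rule integral_dominated_convergence[where w="\<lambda>t. 2 * \<bar>F t\<bar>"])
    show "AE t in arc_measure. (\<lambda>k. poly (q k) (cos t) * F t) \<longlonglongrightarrow> sgn (F t) * F t"
      using q(2) by eventually_elim (intro tendsto_intros)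
    show "AE t in arc_measure. norm (poly (q k) (cos t) * F t) \<le> 2 * \<bar>F t\<bar>" for k
      using q(1)[of "cos _" k] by (intro AE_I2) (auto simp: abs_mult intro!: mult_right_mono)
  qed (use F in auto)
  moreover have "(\<integral>t. poly (q k) (cos t) * F t \<partial>arc_measure) = 0" for k
    using poly0[of "q k" 0] by simp
  ultimately have "(\<integral>t. \<bar>F t\<bar> \<partial>arc_measure) = 0"
    by (simp add: LIMSEQ_const_iff sgn_mult_self_eq mult.commute[of "sgn _"] abs_sgn[symmetric])
  then show ?thesis
    using F by (subst (asm) integral_nonneg_eq_0_iff_AE) auto
qed

lemma integral_cos_multiple_arc_measure:
  "(\<integral>t. cos (real m * t) \<partial>arc_measure) = (if m = 0 then 1 else 0)"
proof (cases "m = 0")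
  case False
  have "((\<lambda>t. cos (real m * t)) has_integral (sin (real m * pi) / real m - sin (real m * 0) / real m)) {0..pi}"
    using False
    by (intro fundamental_theorem_of_calculus)
       (auto intro!: derivative_eq_intros simp: has_real_derivative_iff_has_vector_derivative[symmetric])
  from integral_unique[OF this] have "integral {0..pi} (\<lambda>t. cos (real m * t)) = 0"
    by (simp add: sin_npi)
  with False show ?thesis
    by (subst integral_arc_measure_continuous) (auto intro!: continuous_intros)
qed simp

section \<open>Equidistribution of unimodular powers\<close>

lemma Re_unimodular_times_Re_power:
  fixes z :: complex
  assumes "norm z = 1"
  shows "Re z * Re (z ^ Suc m) = (Re (z ^ Suc (Suc m)) + Re (z ^ m)) / 2"
proof -
  obtain a where a: "z = cis a"
    using complex_unimodular_polar[OF assms] by (metis cis.code)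
  have "cos a * cos (real (Suc m) * a) = (cos (real (Suc (Suc m)) * a) + cos (real m * a)) / 2"
    using cos_times_cis[of a m] by (simp add: complex_eq_iff del: of_nat_Suc)
  then show ?thesis
    unfolding a Complex.DeMoivre by simp
qed

text \<open>For \<open>m > 0\<close> the \<open>m\<close>-th power is \<open>u^m\<close> times
  \<open>cis\<close> of frequency \<open>n * m\<close>, so this is the Riemann--Lebesgue lemma for
  \<open>H * u^m\<close> along a subsequence.\<close>

lemma unimodular_powers_equidistributed_Re_power:
  fixes u :: "real \<Rightarrow> complex" and H :: "real \<Rightarrow> real"
  assumes u [measurable]: "u \<in> borel_measurable borel" and u1: "\<And>t. norm (u t) = 1"
    and H: "integrable arc_measure H"
  shows "(\<lambda>n. \<integral>t. H t * Re ((cis (real n * t) * u t) ^ m) \<partial>arc_measure)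
           \<longlonglongrightarrow> (\<integral>t. H t \<partial>arc_measure) * (\<integral>t. cos (real m * t) \<partial>arc_measure)"
proof (cases "m = 0")
  case False
  have i: "integrable arc_measure (\<lambda>t. complex_of_real (H t) * u t ^ m)"
    using H by (intro integrable_bounded_mult[where C=1]) (auto simp: norm_power u1)
  have "strict_mono (\<lambda>n. n * m)"
    using False by (intro strict_monoI) simp
  from LIMSEQ_subseq_LIMSEQ[OF Riemann_Lebesgue[OF i] this]
  have "(\<lambda>n. Re (\<integral>t. complex_of_real (H t) * u t ^ m * cis (real (n * m) * t) \<partial>arc_measure)) \<longlonglongrightarrow> Re 0"
    by (intro tendsto_Re) (simp add: o_def)
  moreover have "Re (\<integral>t. complex_of_real (H t) * u t ^ m * cis (real (n * m) * t) \<partial>arc_measure)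
      = (\<integral>t. H t * Re ((cis (real n * t) * u t) ^ m) \<partial>arc_measure)" for n
  proof -
    have "integrable arc_measure (\<lambda>t. complex_of_real (H t) * u t ^ m * cis (real (n * m) * t))"
      by (intro integrable_bounded_mult[where C=1] i) auto
    then have "Re (\<integral>t. complex_of_real (H t) * u t ^ m * cis (real (n * m) * t) \<partial>arc_measure)
      = (\<integral>t. Re (complex_of_real (H t) * u t ^ m * cis (real (n * m) * t)) \<partial>arc_measure)"
      by (rule integral_Re[symmetric])
    also have "\<dots> = (\<integral>t. H t * Re ((cis (real n * t) * u t) ^ m) \<partial>arc_measure)"
    proof (intro Bochner_Integration.integral_cong refl)
      fix t
      have "(cis (real n * t) * u t) ^ m = u t ^ m * cis (real (n * m) * t)"
        by (simp add: power_mult_distrib Complex.DeMoivre mult_ac)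
      then show "Re (complex_of_real (H t) * u t ^ m * cis (real (n * m) * t)) = H t * Re ((cis (real n * t) * u t) ^ m)"
        by (simp add: mult.assoc)
    qed
    finally show ?thesis .
  qed
  ultimately show ?thesis
    using False by (simp add: integral_cos_multiple_arc_measure)
qed (simp add: integral_cos_multiple_arc_measure)

text \<open>The factor \<open>Re ((cis (real n * t) * u t) ^ m)\<close> strengthens the induction on
  \<open>q\<close>: multiplying by the real part shifts \<open>m\<close> in both directions. The
  application takes \<open>m = 0\<close>.\<close>

lemma unimodular_powers_equidistributed_poly:
  fixes u :: "real \<Rightarrow> complex" and H :: "real \<Rightarrow> real" and q :: "real poly"
  assumes u [measurable]: "u \<in> borel_measurable borel" and u1: "\<And>t. norm (u t) = 1"
    and H: "integrable arc_measure H"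
  shows "(\<lambda>n. \<integral>t. H t * poly q (Re (cis (real n * t) * u t)) * Re ((cis (real n * t) * u t) ^ m) \<partial>arc_measure)
           \<longlonglongrightarrow> (\<integral>t. H t \<partial>arc_measure) * (\<integral>t. poly q (cos t) * cos (real m * t) \<partial>arc_measure)"
proof -
  define Z where "Z n t = cis (real n * t) * u t" for n :: nat and t
  have Z1: "norm (Z n t) = 1" for n t
    by (simp add: Z_def norm_mult u1)
  have [measurable]: "Z n \<in> borel_measurable borel" for n
    by (simp add: Z_def[abs_def])
  have Re1: "\<bar>Re (Z n t ^ m)\<bar> \<le> 1" for n t m
    using abs_Re_le_cmod[of "Z n t ^ m"] by (simp add: norm_power Z1)
  have cos_eq: "Re (Z n t) = cos (arccos (Re (Z n t)))" for n t
    using Re1[of n t 1] by (simp add: cos_arccos_abs)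
  have Hq: "integrable arc_measure (\<lambda>t. H t * poly q (Re (Z n t)) * Re (Z n t ^ m))" for q n m
  proof -
    obtain C where "\<And>t. \<bar>poly q (cos t)\<bar> \<le> C"
      using poly_cos_bounded by metis
    then have "\<bar>poly q (Re (Z n t))\<bar> \<le> C" for t
      using cos_eq by metis
    then show ?thesis
      by (intro integrable_bounded_mult[where C=1] integrable_bounded_mult[where C=C] H) (auto simp: Re1)
  qed
  have cq: "integrable arc_measure (\<lambda>t. poly q (cos t) * cos (real m * t))" for q m
    by (intro integrable_bounded_mult[where C=1] integrable_poly_cos) auto
  have "(\<lambda>n. \<integral>t. H t * poly q (Re (Z n t)) * Re (Z n t ^ m) \<partial>arc_measure)
           \<longlonglongrightarrow> (\<integral>t. H t \<partial>arc_measure) * (\<integral>t. poly q (cos t) * cos (real m * t) \<partial>arc_measure)"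
  proof (induction q arbitrary: m)
    case 0
    then show ?case by simp
  next
    case (pCons a q)
    define L where "L j = (\<integral>t. poly q (cos t) * cos (real j * t) \<partial>arc_measure)" for j
    define I where "I j n = (\<integral>t. H t * poly q (Re (Z n t)) * Re (Z n t ^ j) \<partial>arc_measure)" for j n
    have IH: "I j \<longlonglongrightarrow> (\<integral>t. H t \<partial>arc_measure) * L j" for j
      using pCons.IH by (simp add: I_def[abs_def] L_def)
    define h where "h = (\<integral>t. H t \<partial>arc_measure)"
    have base: "(\<lambda>n. \<integral>t. H t * Re (Z n t ^ j) \<partial>arc_measure) \<longlonglongrightarrow> h * (\<integral>t. cos (real j * t) \<partial>arc_measure)" for j
      unfolding Z_def h_def by (rule unimodular_powers_equidistributed_Re_power[OF assms])
    have H1: "integrable arc_measure (\<lambda>t. H t * Re (Z n t ^ j))" for n j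
      using Hq[of 1] by simp
    have c1: "integrable arc_measure (\<lambda>t. cos (real j * t))" for j
      using cq[of 1] by simp
    show ?case
    proof (cases m)
      \<comment> \<open>Without a downward neighbour, the factor is 1 and its product with
        \<open>Re (Z n t)\<close> is the case of exponent 1.\<close>
      case 0
      have "(\<integral>t. H t * poly (pCons a q) (Re (Z n t)) * Re (Z n t ^ m) \<partial>arc_measure)
          = a * (\<integral>t. H t * Re (Z n t ^ 0) \<partial>arc_measure) + I 1 n" for n
      proof -
        have "H t * poly (pCons a q) (Re (Z n t)) * Re (Z n t ^ m)
            = a * (H t * Re (Z n t ^ 0)) + H t * poly q (Re (Z n t)) * Re (Z n t ^ 1)" for t
          by (simp add: 0 algebra_simps)
        then show ?thesis
          unfolding I_def using H1[of n 0] Hq[of q n 1] by simp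
      qed
      moreover have "(\<integral>t. poly (pCons a q) (cos t) * cos (real m * t) \<partial>arc_measure) = a * (\<integral>t. cos (real 0 * t) \<partial>arc_measure) + L 1"
      proof -
        have "poly (pCons a q) (cos t) * cos (real m * t)
            = a * cos (real 0 * t) + poly q (cos t) * cos (real 1 * t)" for t
          by (simp add: 0 algebra_simps)
        then show ?thesis
          unfolding L_def using c1[of 0] cq[of q 1] by (simp del: of_nat_1)
      qed
      ultimately show ?thesis
        using tendsto_add[OF tendsto_mult[OF tendsto_const[of a] base[of 0]] IH[of 1]] unfolding h_def[symmetric]
        by (simp add: algebra_simps)
    next
      case (Suc k)
      have "(\<integral>t. H t * poly (pCons a q) (Re (Z n t)) * Re (Z n t ^ m) \<partial>arc_measure)
          = a * (\<integral>t. H t * Re (Z n t ^ Suc k) \<partial>arc_measure) + (I (Suc (Suc k)) n + I k n) / 2" for n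
      proof -
        have "H t * poly (pCons a q) (Re (Z n t)) * Re (Z n t ^ m)
            = a * (H t * Re (Z n t ^ Suc k)) + (H t * poly q (Re (Z n t)) * Re (Z n t ^ Suc (Suc k))
              + H t * poly q (Re (Z n t)) * Re (Z n t ^ k)) / 2" for t
        proof -
          have "H t * poly (pCons a q) (Re (Z n t)) * Re (Z n t ^ m)
            = a * (H t * Re (Z n t ^ Suc k)) + H t * poly q (Re (Z n t)) * (Re (Z n t) * Re (Z n t ^ Suc k))"
            by (simp add: Suc algebra_simps)
          then show ?thesis
            unfolding Re_unimodular_times_Re_power[OF Z1] by (simp only: times_divide_eq_right distrib_left)
        qed
        then show ?thesis
          unfolding I_def using H1[of n "Suc k"] Hq[of q n "Suc (Suc k)"] Hq[of q n k] by (simp del: power_Suc)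
      qed
      moreover have "(\<integral>t. poly (pCons a q) (cos t) * cos (real m * t) \<partial>arc_measure)
          = a * (\<integral>t. cos (real (Suc k) * t) \<partial>arc_measure) + (L (Suc (Suc k)) + L k) / 2"
      proof -
        have "poly (pCons a q) (cos t) * cos (real m * t)
            = a * cos (real (Suc k) * t) + (poly q (cos t) * cos (real (Suc (Suc k)) * t) + poly q (cos t) * cos (real k * t)) / 2" for t
        proof -
          have c: "cos t * cos (real (Suc k) * t) = (cos (real (Suc (Suc k)) * t) + cos (real k * t)) / 2"
            using cos_times_cis[of t k] by (simp add: complex_eq_iff del: of_nat_Suc)
          have "poly (pCons a q) (cos t) * cos (real m * t)
            = a * cos (real (Suc k) * t) + poly q (cos t) * (cos t * cos (real (Suc k) * t))"
            by (simp add: Suc algebra_simps)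
          then show ?thesis
            unfolding c by (simp only: times_divide_eq_right distrib_left)
        qed
        then show ?thesis
          unfolding L_def using c1[of "Suc k"] cq[of q "Suc (Suc k)"] cq[of q k] by (simp del: of_nat_Suc)
      qed
      moreover have "(\<lambda>n. a * (\<integral>t. H t * Re (Z n t ^ Suc k) \<partial>arc_measure) + (I (Suc (Suc k)) n + I k n) / 2)
          \<longlonglongrightarrow> a * (h * (\<integral>t. cos (real (Suc k) * t) \<partial>arc_measure)) + (h * L (Suc (Suc k)) + h * L k) / 2"
        by (intro tendsto_intros base IH[folded h_def]) simp
      ultimately show ?thesis
        unfolding h_def[symmetric] by (simp add: algebra_simps del: of_nat_Suc power_Suc)
    qed
  qed
  then show ?thesis
    by (simp add: Z_def)
qed

text \<open>In the limit the values of \<open>Re (cis (real n * t) * u t)\<close> are distributed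
  like \<open>cos t\<close> and independent of \<open>H\<close>. The passage from polynomials to
  continuous \<open>\<phi>\<close> is uniform approximation on \<open>[-1, 1]\<close>.\<close>

lemma unimodular_powers_equidistributed:
  fixes u :: "real \<Rightarrow> complex" and H \<phi> :: "real \<Rightarrow> real"
  assumes u [measurable]: "u \<in> borel_measurable borel" and u1: "\<And>t. norm (u t) = 1"
    and H: "integrable arc_measure H" and \<phi>: "continuous_on UNIV \<phi>"
  shows "(\<lambda>n. \<integral>t. H t * \<phi> (Re (cis (real n * t) * u t)) \<partial>arc_measure)
           \<longlonglongrightarrow> (\<integral>t. H t \<partial>arc_measure) * (\<integral>t. \<phi> (cos t) \<partial>arc_measure)"
proof (rule LIMSEQ_I)
  fix e :: real
  assume e: "0 < e"
  have [measurable]: "\<phi> \<in> borel_measurable borel"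
    by (intro borel_measurable_continuous_onI \<phi>)
  define Z where "Z n t = cis (real n * t) * u t" for n :: nat and t
  have Z1: "norm (Z n t) = 1" for n t
    by (simp add: Z_def norm_mult u1)
  have [measurable]: "Z n \<in> borel_measurable borel" for n
    by (simp add: Z_def[abs_def])
  have Re1: "Re (Z n t) \<in> {-1..1}" for n t
    using abs_Re_le_cmod[of "Z n t"] by (simp add: Z1 abs_le_iff)
  define A where "A = (\<integral>t. \<bar>H t\<bar> \<partial>arc_measure)"
  define h where "h = (\<integral>t. H t \<partial>arc_measure)"
  have A0: "A \<ge> 0"
    by (simp add: A_def)
  have hA: "\<bar>h\<bar> \<le> A"
    unfolding h_def A_def by (rule integral_abs_bound)
  \<comment> \<open>Replacing \<open>\<phi>\<close> by \<open>q\<close> costs at most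
    \<open>A * d < e / 3\<close> on either side, which leaves \<open>e / 3\<close> for the
    polynomial case; \<open>A + 1\<close> keeps the denominator positive.\<close>
  define d where "d = e / (3 * (A + 1))"
  have d: "0 < d" and dA: "A * d < e / 3"
    using e A0 by (auto simp: d_def field_simps)
  obtain q :: "real poly" where q: "\<And>x. x \<in> {-1..1} \<Longrightarrow> \<bar>\<phi> x - poly q x\<bar> < d"
    using Weierstrass_poly_approximation[OF continuous_on_subset[OF \<phi> subset_UNIV] d, of "-1" 1] by blast
  have "compact (\<phi> ` {-1..1})"
    by (intro compact_continuous_image continuous_on_subset[OF \<phi>]) auto
  then obtain C where "\<forall>y\<in>\<phi> ` {-1..1}. norm y \<le> C"
    using compact_imp_bounded bounded_iff by metis
  then have C: "\<bar>\<phi> x\<bar> \<le> C" if "x \<in> {-1..1}" for x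
    using that by auto
  have iq: "integrable arc_measure (\<lambda>t. H t * poly q (Re (Z n t)))" for n
  proof (intro integrable_bounded_mult[where C="C + d"] H)
    show "norm (poly q (Re (Z n t))) \<le> C + d" for t
      using C[OF Re1, of n t] q[OF Re1, of n t] by auto
  qed auto
  have i\<phi>: "integrable arc_measure (\<lambda>t. H t * \<phi> (Re (Z n t)))" for n
    by (intro integrable_bounded_mult[where C=C] H) (use C[OF Re1] in auto)
  have c\<phi>: "integrable arc_measure (\<lambda>t. \<phi> (cos t))"
    by (intro integrable_arc_measure_bounded[where C=C]) (auto intro!: C)
  define J where "J n = (\<integral>t. H t * poly q (Re (Z n t)) \<partial>arc_measure)" for n
  define j where "j = (\<integral>t. poly q (cos t) \<partial>arc_measure)"
  have "J \<longlonglongrightarrow> h * j"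
    using unimodular_powers_equidistributed_poly[OF assms(1-3), of q 0]
    by (simp add: J_def[abs_def] Z_def h_def j_def)
  then obtain n0 where n0: "\<And>n. n \<ge> n0 \<Longrightarrow> \<bar>J n - h * j\<bar> < e / 3"
    using e LIMSEQ_D[of J "h * j" "e / 3"] by auto
  have "\<bar>(\<integral>t. \<phi> (cos t) \<partial>arc_measure) - j\<bar> \<le> d"
  proof -
    have "\<bar>(\<integral>t. \<phi> (cos t) \<partial>arc_measure) - j\<bar> = \<bar>\<integral>t. \<phi> (cos t) - poly q (cos t) \<partial>arc_measure\<bar>"
      unfolding j_def using c\<phi> integrable_poly_cos by simp
    also have "\<dots> \<le> (\<integral>t. \<bar>\<phi> (cos t) - poly q (cos t)\<bar> \<partial>arc_measure)"
      by (rule integral_abs_bound)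
    also have "\<dots> \<le> (\<integral>t. d \<partial>arc_measure)"
      using c\<phi> integrable_poly_cos by (intro integral_mono) (auto intro!: less_imp_le q)
    finally show ?thesis by simp
  qed
  then have 1: "\<bar>h * (\<integral>t. \<phi> (cos t) \<partial>arc_measure) - h * j\<bar> < e / 3"
    using mult_mono[OF hA, of "\<bar>(\<integral>t. \<phi> (cos t) \<partial>arc_measure) - j\<bar>" d] A0 dA
    by (simp add: abs_mult[symmetric] right_diff_distrib)
  have 2: "\<bar>(\<integral>t. H t * \<phi> (Re (Z n t)) \<partial>arc_measure) - J n\<bar> < e / 3" for n
  proof -
    have "\<bar>(\<integral>t. H t * \<phi> (Re (Z n t)) \<partial>arc_measure) - J n\<bar> = \<bar>\<integral>t. H t * \<phi> (Re (Z n t)) - H t * poly q (Re (Z n t)) \<partial>arc_measure\<bar>"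
      unfolding J_def using i\<phi> iq by simp
    also have "\<dots> \<le> (\<integral>t. \<bar>H t * \<phi> (Re (Z n t)) - H t * poly q (Re (Z n t))\<bar> \<partial>arc_measure)"
      by (rule integral_abs_bound)
    also have "\<dots> \<le> (\<integral>t. \<bar>H t\<bar> * d \<partial>arc_measure)"
    proof (intro integral_mono)
      show "\<bar>H t * \<phi> (Re (Z n t)) - H t * poly q (Re (Z n t))\<bar> \<le> \<bar>H t\<bar> * d" for t
        using q[OF Re1, of n t] by (auto simp: right_diff_distrib[symmetric] abs_mult intro!: mult_left_mono)
    qed (use i\<phi> iq H in auto)
    also have "\<dots> = A * d"
      by (simp add: A_def)
    finally show ?thesis using dA by simp
  qed
  have "\<bar>(\<integral>t. H t * \<phi> (Re (Z n t)) \<partial>arc_measure) - h * (\<integral>t. \<phi> (cos t) \<partial>arc_measure)\<bar> < e" if "n \<ge> n0" for n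
    using 1 2[of n] n0[OF that] by linarith
  then show "\<exists>no. \<forall>n\<ge>no. norm ((\<integral>t. H t * \<phi> (Re (cis (real n * t) * u t)) \<partial>arc_measure) -
      (\<integral>t. H t \<partial>arc_measure) * (\<integral>t. \<phi> (cos t) \<partial>arc_measure)) < e"
    unfolding Z_def h_def by auto
qed

section \<open>Circle means of logarithms\<close>

lemma integrable_arc_measure_continuous:
  fixes f :: "real \<Rightarrow> 'b::euclidean_space"
  assumes "continuous_on UNIV f"
  shows "integrable arc_measure f"
  using assms borel_integrable_atLeastAtMost'[OF continuous_on_subset[OF assms], of 0 pi]
  by (simp add: integrable_arc_measure_iff borel_measurable_continuous_onI)

lemma holomorphic_circle_mean:
  fixes f :: "complex \<Rightarrow> complex"
  assumes f: "f holomorphic_on cball 0 1"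
  shows "((\<lambda>t. f (cis t)) has_integral 2 * pi * f 0) {0..2 * pi}"
proof -
  have "((\<lambda>u. f u / (u - 0)) has_contour_integral (2 * pi * \<i> * f 0)) (circlepath 0 1)"
    using Cauchy_integral_circlepath_simple[OF f, of 0] by simp
  then have "((\<lambda>x. (2 * pi * \<i>) * f (cis (2 * pi * x))) has_integral (2 * pi * \<i>) * f 0) {0..1}"
    unfolding has_contour_integral_def
    by (rule has_integral_eq[rotated]) (simp add: vector_derivative_circlepath01, simp add: circlepath cis_conv_exp mult_ac)
  then have "((\<lambda>x. inverse (2 * pi * \<i>) * ((2 * pi * \<i>) * f (cis (2 * pi * x)))) has_integral inverse (2 * pi * \<i>) * ((2 * pi * \<i>) * f 0)) {0..1}"
    by (rule has_integral_mult_right)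
  then have "((\<lambda>x. f (cis (2 * pi * x))) has_integral f 0) (cbox 0 1)"
    by (simp add: field_simps)
  from has_integral_affinity'[OF this, of "1 / (2 * pi)" 0] show ?thesis
    by (simp add: scaleR_conv_of_real)
qed

lemma continuous_on_holomorphic_cis:
  fixes f :: "complex \<Rightarrow> complex"
  assumes f: "f holomorphic_on cball 0 1"
  shows "continuous_on UNIV (\<lambda>t. f (cis (c * t)))"
  by (rule continuous_on_compose2[OF holomorphic_on_imp_continuous_on[OF f]]) (auto intro!: continuous_intros)

text \<open>While \<open>t\<close> runs over the half circle, \<open>cis (2 * t)\<close> runs once
  around the whole circle.\<close>

lemma integral_holomorphic_cis_double:
  fixes f :: "complex \<Rightarrow> complex"
  assumes f: "f holomorphic_on cball 0 1"
  shows "(\<integral>t. f (cis (2 * t)) \<partial>arc_measure) = f 0"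
proof -
  have "((\<lambda>t. f (cis t)) has_integral 2 * pi * f 0) (cbox 0 (2 * pi))"
    using holomorphic_circle_mean[OF f] by simp
  from has_integral_affinity'[OF this, of 2 0] have "integral {0..pi} (\<lambda>t. f (cis (2 * t))) = pi * f 0"
    by (intro integral_unique) (simp add: scaleR_conv_of_real)
  then show ?thesis
    by (simp add: integral_arc_measure_continuous[OF continuous_on_holomorphic_cis[OF f]] scaleR_conv_of_real)
qed

text \<open>The points \<open>cis t\<close> and \<open>cis (- t)\<close> together cover the circle;
  \<open>2 * pi - t\<close> identifies the lower arc with the reflected upper one.\<close>

lemma integral_holomorphic_cis_symmetric:
  fixes f :: "complex \<Rightarrow> complex"
  assumes f: "f holomorphic_on cball 0 1"
  shows "(\<integral>t. f (cis t) + f (cis (- t)) \<partial>arc_measure) = 2 * f 0"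
proof -
  have c: "continuous_on UNIV (\<lambda>t. f (cis t))" "continuous_on UNIV (\<lambda>t. f (cis (- t)))"
    using continuous_on_holomorphic_cis[OF f, of 1] continuous_on_holomorphic_cis[OF f, of "-1"] by auto
  have "((\<lambda>t. f (cis t)) has_integral integral {pi..2*pi} (\<lambda>t. f (cis t))) (cbox pi (2 * pi))"
    unfolding cbox_interval by (intro integrable_integral integrable_continuous_real continuous_on_subset[OF c(1)]) auto
  from has_integral_affinity[OF this, of "-1" "2 * pi"]
  have "((\<lambda>t. f (cis (2 * pi - t))) has_integral integral {pi..2*pi} (\<lambda>t. f (cis t))) ((\<lambda>x. 2 * pi - x) ` {pi..2 * pi})"
    by simp
  moreover have "(\<lambda>x. 2 * pi - x) ` {pi..2 * pi} = {0..pi}"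
    by simp
  moreover have "cis (2 * pi - t) = cis (- t)" for t
    by (simp add: complex_eq_iff cos_diff sin_diff)
  ultimately have 1: "integral {pi..2*pi} (\<lambda>t. f (cis t)) = integral {0..pi} (\<lambda>t. f (cis (- t)))"
    by (auto dest: integral_unique)
  have "integral {0..pi} (\<lambda>t. f (cis t)) + integral {pi..2*pi} (\<lambda>t. f (cis t)) = integral {0..2*pi} (\<lambda>t. f (cis t))"
    by (intro Henstock_Kurzweil_Integration.integral_combine integrable_continuous_real continuous_on_subset[OF c(1)]) auto
  also have "\<dots> = 2 * pi * f 0"
    using holomorphic_circle_mean[OF f] by (rule integral_unique)
  finally have 2: "integral {0..pi} (\<lambda>t. f (cis t)) + integral {0..pi} (\<lambda>t. f (cis (- t))) = 2 * pi * f 0"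
    by (simp add: 1)
  have "(\<integral>t. f (cis t) + f (cis (- t)) \<partial>arc_measure) = (\<integral>t. f (cis t) \<partial>arc_measure) + (\<integral>t. f (cis (- t)) \<partial>arc_measure)"
    by (intro Bochner_Integration.integral_add integrable_arc_measure_continuous c)
  also have "\<dots> = (1 / pi) *\<^sub>R (integral {0..pi} (\<lambda>t. f (cis t)) + integral {0..pi} (\<lambda>t. f (cis (- t))))"
    by (simp add: integral_arc_measure_continuous c scaleR_add_right)
  also have "\<dots> = 2 * f 0"
    by (simp add: 2 scaleR_conv_of_real)
  finally show ?thesis .
qed

lemma one_minus_mult_notin_nonpos_Reals:
  fixes b z :: complex
  assumes "norm b < 1" "norm z \<le> 1"
  shows "1 - b * z \<notin> \<real>\<^sub>\<le>\<^sub>0"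
proof -
  have "norm (b * z) < 1"
    using assms by (metis norm_mult mult_left_le norm_ge_zero order.strict_trans1 mult.commute)
  then have "Re (b * z) < 1"
    using complex_Re_le_cmod[of "b * z"] by linarith
  then show ?thesis
    by (auto simp: complex_nonpos_Reals_iff)
qed

text \<open>\<open>Ln (1 - b * z)\<close> is holomorphic on the closed disc, because
  \<open>1 - b * z\<close> stays off the negative half axis, and it vanishes at the centre.\<close>

lemma integral_ln_norm_one_minus:
  assumes b: "norm (b :: complex) < 1"
  shows "(\<integral>t. ln ((norm (1 - b * cis t))\<^sup>2) + ln ((norm (1 - b * cis (- t)))\<^sup>2) \<partial>arc_measure) = 0"
proof -
  define f where "f z = Ln (1 - b * z)" for z
  have f: "f holomorphic_on cball 0 1"
    unfolding f_def using one_minus_mult_notin_nonpos_Reals[OF b] by (intro holomorphic_intros) auto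
  have *: "ln ((norm (1 - b * cis t))\<^sup>2) = 2 * Re (f (cis t))" for t
  proof -
    have "1 - b * cis t \<noteq> 0"
      using one_minus_mult_notin_nonpos_Reals[OF b, of "cis t"] by (metis nonpos_Reals_zero_I norm_cis order_refl)
    then show ?thesis
      by (simp add: f_def ln_realpow Re_Ln)
  qed
  have c: "continuous_on UNIV (\<lambda>t. f (cis t) + f (cis (- t)))"
    using continuous_on_holomorphic_cis[OF f, of 1] continuous_on_holomorphic_cis[OF f, of "-1"]
    by (intro continuous_intros) auto
  have "(\<integral>t. ln ((norm (1 - b * cis t))\<^sup>2) + ln ((norm (1 - b * cis (- t)))\<^sup>2) \<partial>arc_measure)
      = (\<integral>t. 2 * Re (f (cis t) + f (cis (- t))) \<partial>arc_measure)"
    unfolding * by (simp add: distrib_left)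
  also have "\<dots> = 2 * Re (\<integral>t. f (cis t) + f (cis (- t)) \<partial>arc_measure)"
    using integral_Re[OF integrable_arc_measure_continuous[OF c]] by (simp del: plus_complex.sel)
  also have "\<dots> = 0"
    unfolding integral_holomorphic_cis_symmetric[OF f] by (simp add: f_def)
  finally show ?thesis .
qed

text \<open>Adding \<open>e > 0\<close> makes the squared modulus a multiple \<open>c \<ge> 1\<close> of the squared modulus of a factor whose
  zero lies off the closed disc, so the mean value property applies without log singularities.\<close>
lemma integral_ln_regularised_factor_nonneg:
  fixes b :: complex
  assumes e: "e > 0"
  shows "(\<integral>t. ln ((norm (1 - b * cis t))\<^sup>2 + e) + ln ((norm (1 - b * cis (- t)))\<^sup>2 + e) \<partial>arc_measure) \<ge> 0"
proof -
  define B where "B = norm b"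
  define m where "m = max 1 B"
  have m: "m \<ge> 1" "m \<ge> B" "B \<ge> 0"
    by (auto simp: m_def B_def)
  \<comment> \<open>On the circle \<open>|1 - b z|^2 + e\<close> and
    \<open>c |1 - (b/c) z|^2\<close> have the same linear term, so they agree once
    \<open>c + B^2 / c = 1 + B^2 + e\<close>. Looking for \<open>c\<close> to the right of
    \<open>m\<close> yields both \<open>c >= 1\<close> and \<open>c >= B\<close>.\<close>
  have "m + B\<^sup>2 / m \<le> 1 + B\<^sup>2"
  proof (cases "B \<le> 1")
    case False
    then have "m + B\<^sup>2 / m = 2 * B"
      by (simp add: m_def max_def power2_eq_square)
    then show ?thesis
      using sum_squares_bound[of 1 B] by simp
  qed (simp add: m_def max_def)
  moreover have "1 + B\<^sup>2 + e \<le> (1 + B\<^sup>2 + e) + B\<^sup>2 / (1 + B\<^sup>2 + e)"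
    using e by simp
  moreover have "m \<le> 1 + B\<^sup>2 + e"
    using e m sum_squares_bound[of 1 B] by (auto simp: m_def)
  moreover have "continuous_on {m..1 + B\<^sup>2 + e} (\<lambda>c. c + B\<^sup>2 / c)"
    using m by (intro continuous_intros) auto
  ultimately obtain c where c: "m \<le> c" "c + B\<^sup>2 / c = 1 + B\<^sup>2 + e"
    using IVT'[of "\<lambda>c. c + B\<^sup>2 / c" m "1 + B\<^sup>2 + e" "1 + B\<^sup>2 + e"] e by auto
  have c1: "c \<ge> 1"
    using c m by simp
  \<comment> \<open>Equality would give \<open>(1 - B)^2 + e = 0\<close>.\<close>
  have "B < c"
  proof (rule ccontr)
    assume "\<not> B < c"
    then have "B = c" using c m by simp
    then have "2 * B = 1 + B\<^sup>2 + e"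
      using c c1 by (simp add: power2_eq_square)
    then show False
      using sum_squares_bound[of 1 B] e by simp
  qed
  define b' where "b' = b / complex_of_real c"
  have b': "norm b' < 1"
    using \<open>B < c\<close> c1 by (simp add: b'_def norm_divide B_def)
  have sq: "(norm (1 - x * cis t))\<^sup>2 = 1 + (norm x)\<^sup>2 - 2 * Re (x * cis t)" for x :: complex and t
  proof -
    have "(norm (1 - y))\<^sup>2 = 1 + (norm y)\<^sup>2 - 2 * Re y" for y :: complex
      unfolding cmod_power2 by (simp add: power2_eq_square algebra_simps)
    from this[of "x * cis t"] show ?thesis
      by (simp add: norm_mult)
  qed
  have eq: "(norm (1 - b * cis t))\<^sup>2 + e = c * (norm (1 - b' * cis t))\<^sup>2" for t
  proof -
    have "c * (norm b')\<^sup>2 = B\<^sup>2 / c"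
      using c1 by (simp add: b'_def norm_divide B_def power2_eq_square)
    moreover have "c * Re (b' * cis t) = Re (b * cis t)"
      using c1 by (simp add: b'_def Re_divide_of_real Im_divide_of_real field_simps)
    ultimately show ?thesis
      unfolding sq using c(2) by (simp add: B_def algebra_simps)
  qed
  have pos: "norm (1 - b' * cis t) > 0" for t
    using one_minus_mult_notin_nonpos_Reals[OF b', of "cis t"] by auto
  have ln_eq: "ln ((norm (1 - b * cis t))\<^sup>2 + e) = ln c + ln ((norm (1 - b' * cis t))\<^sup>2)" for t
    unfolding eq using pos[of t] c1 by (intro ln_mult_pos) auto
  have cont: "continuous_on UNIV (\<lambda>t. ln ((norm (1 - b' * cis t))\<^sup>2) + ln ((norm (1 - b' * cis (- t)))\<^sup>2))"
    using pos by (intro continuous_intros) (auto simp: less_imp_neq[symmetric])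
  have "(\<integral>t. ln ((norm (1 - b * cis t))\<^sup>2 + e) + ln ((norm (1 - b * cis (- t)))\<^sup>2 + e) \<partial>arc_measure)
      = (\<integral>t. 2 * ln c + (ln ((norm (1 - b' * cis t))\<^sup>2) + ln ((norm (1 - b' * cis (- t)))\<^sup>2)) \<partial>arc_measure)"
    unfolding ln_eq by (simp add: algebra_simps)
  also have "\<dots> = 2 * ln c"
    using integral_ln_norm_one_minus[OF b'] integrable_arc_measure_continuous[OF cont] by simp
  finally show ?thesis
    using c1 by simp
qed

section \<open>Szego's lower bound\<close>

definition complex_eval :: "real poly \<Rightarrow> complex \<Rightarrow> complex" where
  "complex_eval h z = poly (map_poly complex_of_real h) z"

lemma complex_eval_0 [simp]: "complex_eval 0 z = 0"
  by (simp add: complex_eval_def)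

lemma complex_eval_pCons [simp]: "complex_eval (pCons a h) z = complex_of_real a + z * complex_eval h z"
  by (simp add: complex_eval_def map_poly_pCons)

lemma complex_eval_1 [simp]: "complex_eval 1 z = 1"
  by (simp add: one_pCons)

lemma complex_eval_add [simp]: "complex_eval (h + k) z = complex_eval h z + complex_eval k z"
  by (induction h k rule: poly_induct2) (simp_all add: algebra_simps)

lemma complex_eval_smult [simp]: "complex_eval (smult c h) z = complex_of_real c * complex_eval h z"
  by (induction h) (simp_all add: algebra_simps)

lemma complex_eval_diff [simp]: "complex_eval (h - k) z = complex_eval h z - complex_eval k z"
  using complex_eval_add[of "h - k" k z] by (simp del: complex_eval_add)

lemma complex_eval_mult [simp]: "complex_eval (h * k) z = complex_eval h z * complex_eval k z"
  by (induction h) (simp_all add: algebra_simps)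

lemma complex_eval_power [simp]: "complex_eval (h ^ n) z = complex_eval h z ^ n"
  by (induction n) simp_all

lemma complex_eval_sum [simp]: "complex_eval (\<Sum>i\<in>A. h i) z = (\<Sum>i\<in>A. complex_eval (h i) z)"
  by (induction A rule: infinite_finite_induct) simp_all

lemma complex_eval_monom [simp]: "complex_eval (monom a n) z = complex_of_real a * z ^ n"
  by (simp add: complex_eval_def map_poly_monom poly_monom)

lemma complex_eval_altdef: "complex_eval h z = (\<Sum>i\<le>degree h. complex_of_real (coeff h i) * z ^ i)"
  by (subst poly_as_sum_of_monoms[symmetric, of h]) (simp only: complex_eval_sum complex_eval_monom)

lemma complex_eval_at_0: "complex_eval h 0 = complex_of_real (coeff h 0)"
  by (cases h) simp

lemma cnj_complex_eval: "cnj (complex_eval h z) = complex_eval h (cnj z)"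
  by (induction h) simp_all

lemma continuous_on_complex_eval [continuous_intros]:
  assumes "continuous_on S f"
  shows "continuous_on S (\<lambda>x. complex_eval h (f x))"
  unfolding complex_eval_def using assms by (intro continuous_intros)

lemma borel_measurable_complex_eval [measurable]: "complex_eval h \<in> borel_measurable borel"
  by (intro borel_measurable_continuous_onI continuous_intros)

lemma complex_eval_cis_bounded: "\<exists>C. \<forall>t. norm (complex_eval h (cis t)) \<le> C"
proof -
  have "compact (complex_eval h ` sphere 0 1)"
    by (intro compact_continuous_image continuous_intros) auto
  then obtain C where "\<forall>y\<in>complex_eval h ` sphere 0 1. norm y \<le> C"
    using compact_imp_bounded bounded_iff by metis
  then show ?thesis
    by (intro exI[of _ C]) auto
qed

text \<open>By the fundamental theorem of algebra. The value 1 at the origin excludes the root 0, so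
  each \<open>b\<close> can be the inverse of a root, and it also absorbs the leading
  coefficient.\<close>

lemma complex_eval_factorization:
  assumes "coeff h 0 = 1"
  shows "\<exists>bs. \<forall>z. complex_eval h z = (\<Prod>b\<leftarrow>bs. 1 - b * z)"
proof -
  define p where "p = map_poly complex_of_real h"
  have p0: "poly p 0 = 1"
    using complex_eval_at_0[of h] assms by (simp add: complex_eval_def p_def)
  then have "p \<noteq> 0" by auto
  then obtain A where A: "p = smult (lead_coeff p) (\<Prod>x\<in>#A. [:-x, 1:])"
    using alg_closed_imp_factorization by blast
  obtain as where as: "mset as = A"
    using ex_mset by blast
  have ev: "poly p z = lead_coeff p * (\<Prod>a\<leftarrow>as. z - a)" for z
  proof -
    have "poly p z = lead_coeff p * (\<Prod>x\<in>#A. z - x)"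
      by (subst A) (simp add: poly_prod_mset image_mset.compositionality o_def)
    then show ?thesis
      by (simp add: as[symmetric] prod_mset_prod_list[symmetric])
  qed
  have "a \<noteq> 0" if "a \<in> set as" for a
  proof
    assume "a = 0"
    then have "(\<Prod>a\<leftarrow>as. 0 - a) = 0"
      using that by (auto simp: prod_list_zero_iff)
    then show False
      using ev[of 0] p0 by simp
  qed
  then have prod_eq: "(\<Prod>a\<leftarrow>as. z - a) = (\<Prod>a\<leftarrow>as. 0 - a) * (\<Prod>b\<leftarrow>map inverse as. 1 - b * z)" for z
  proof (induction as)
    case (Cons a as)
    then have a: "z - a = (0 - a) * (1 - inverse a * z)"
      by (simp add: algebra_simps)
    have IH: "(\<Prod>a\<leftarrow>as. z - a) = (\<Prod>a\<leftarrow>as. 0 - a) * (\<Prod>b\<leftarrow>map inverse as. 1 - b * z)"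
      using Cons by simp
    show ?case
      unfolding list.map prod_list.Cons IH a by (simp only: mult_ac)
  qed simp
  have "complex_eval h z = (\<Prod>b\<leftarrow>map inverse as. 1 - b * z)" for z
  proof -
    have "poly p z = (lead_coeff p * (\<Prod>a\<leftarrow>as. 0 - a)) * (\<Prod>b\<leftarrow>map inverse as. 1 - b * z)"
      by (subst ev, subst prod_eq) (simp only: mult.assoc)
    also have "lead_coeff p * (\<Prod>a\<leftarrow>as. 0 - a) = 1"
      using ev[of 0] p0 by simp
    finally show ?thesis
      by (simp add: complex_eval_def p_def)
  qed
  then show ?thesis by blast
qed

text \<open>The geometric mean over \<open>t\<close> and \<open>- t\<close> compensates for the fact that a single factor of a real
  polynomial, unlike the whole product, is not even in \<open>t\<close>.\<close>
definition regularised_factor :: "real \<Rightarrow> complex \<Rightarrow> real \<Rightarrow> real" where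
  "regularised_factor e b t = sqrt (((norm (1 - b * cis t))\<^sup>2 + e) * ((norm (1 - b * cis (- t)))\<^sup>2 + e))"

lemma regularised_factor_pos: "e > 0 \<Longrightarrow> regularised_factor e b t > 0"
  unfolding regularised_factor_def by (intro real_sqrt_gt_zero mult_pos_pos add_nonneg_pos) auto

lemma continuous_on_regularised_factor: "continuous_on UNIV (\<lambda>t. regularised_factor e b t)"
  unfolding regularised_factor_def by (intro continuous_intros)

lemma regularised_factor_mono: "0 \<le> e \<Longrightarrow> e \<le> e' \<Longrightarrow> regularised_factor e b t \<le> regularised_factor e' b t"
  unfolding regularised_factor_def by (intro real_sqrt_le_mono mult_mono) auto

lemma regularised_factor_nonneg: "0 \<le> e \<Longrightarrow> 0 \<le> regularised_factor e b t"
  unfolding regularised_factor_def by auto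

text \<open>The logarithm of the product is a sum, each term of which is half the integrand of
  \<open>integral_ln_regularised_factor_nonneg\<close>.\<close>

lemma integral_ln_regularised_prod_nonneg:
  assumes e: "e > 0"
  shows "0 \<le> (\<integral>t. ln (\<Prod>b\<leftarrow>bs. regularised_factor e b t) \<partial>arc_measure)"
proof -
  have cont: "continuous_on UNIV (\<lambda>t. ln (regularised_factor e b t))" for b
    using regularised_factor_pos[OF e] by (intro continuous_intros continuous_on_regularised_factor) (auto simp: less_imp_neq[symmetric])
  have one: "0 \<le> (\<integral>t. ln (regularised_factor e b t) \<partial>arc_measure)" for b
  proof -
    have p: "0 < (norm (1 - b * cis t))\<^sup>2 + e" for t
      using e by (intro add_nonneg_pos) auto
    have "ln (regularised_factor e b t)
        = (ln ((norm (1 - b * cis t))\<^sup>2 + e) + ln ((norm (1 - b * cis (- t)))\<^sup>2 + e)) / 2" for t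
      using p[of t] p[of "- t"] by (simp add: regularised_factor_def ln_sqrt ln_mult_pos)
    then have "(\<integral>t. ln (regularised_factor e b t) \<partial>arc_measure)
        = (\<integral>t. (ln ((norm (1 - b * cis t))\<^sup>2 + e) + ln ((norm (1 - b * cis (- t)))\<^sup>2 + e)) / 2 \<partial>arc_measure)"
      by (simp only:)
    then show ?thesis
      using integral_ln_regularised_factor_nonneg[OF e, of b] by simp
  qed
  \<comment> \<open>Integrability is carried through the induction because additivity of the
    integral requires it.\<close>
  have "integrable arc_measure (\<lambda>t. ln (\<Prod>b\<leftarrow>bs. regularised_factor e b t)) \<and>
     0 \<le> (\<integral>t. ln (\<Prod>b\<leftarrow>bs. regularised_factor e b t) \<partial>arc_measure)"
  proof (induction bs)
    case (Cons b bs)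
    have "(\<Prod>b\<leftarrow>bs. regularised_factor e b t) > 0" for t
      using regularised_factor_pos[OF e] by (induction bs) auto
    then have "ln (\<Prod>b\<leftarrow>b # bs. regularised_factor e b t)
        = ln (regularised_factor e b t) + ln (\<Prod>b\<leftarrow>bs. regularised_factor e b t)" for t
      using regularised_factor_pos[OF e, of b t] by (simp add: ln_mult_pos)
    with Cons one[of b] integrable_arc_measure_continuous[OF cont[of b]] show ?case
      by simp
  qed simp
  then show ?thesis by simp
qed

section \<open>Jensen's inequality and the bound for polynomials\<close>

text \<open>Jensen's inequality for \<open>exp\<close>: integrate the tangent line at the mean
  \<open>m\<close> of \<open>ln f\<close>. The measure has total mass 1, so the linear term drops
  out.\<close>

lemma exp_integral_ln_le:
  fixes f :: "real \<Rightarrow> real"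
  assumes f: "integrable arc_measure f" and lf: "integrable arc_measure (\<lambda>t. ln (f t))"
    and pos: "AE t in arc_measure. f t > 0"
  shows "exp (\<integral>t. ln (f t) \<partial>arc_measure) \<le> (\<integral>t. f t \<partial>arc_measure)"
proof -
  define m where "m = (\<integral>t. ln (f t) \<partial>arc_measure)"
  have "AE t in arc_measure. exp m * (1 + (ln (f t) - m)) \<le> f t"
    using pos
  proof eventually_elim
    case (elim t)
    have "exp m * (1 + (ln (f t) - m)) \<le> exp m * exp (ln (f t) - m)"
      by (intro mult_left_mono exp_ge_add_one_self) auto
    also have "\<dots> = f t"
      using elim by (simp add: exp_add[symmetric])
    finally show ?case .
  qed
  then have "(\<integral>t. exp m * (1 + (ln (f t) - m)) \<partial>arc_measure) \<le> (\<integral>t. f t \<partial>arc_measure)"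
    using f lf by (intro integral_mono_AE) auto
  moreover have "(\<integral>t. exp m * (1 + (ln (f t) - m)) \<partial>arc_measure) = exp m"
    using lf by (simp add: m_def)
  ultimately show ?thesis
    by (simp add: m_def)
qed

text \<open>For \<open>e > 0\<close> the product \<open>W e\<close> of regularised factors has a
  nonnegative logarithmic mean, so Jensen's inequality for \<open>W e * v\<close> gives the bound
  with \<open>W e\<close> in place of \<open>|h|^2\<close>. Then \<open>e\<close> tends to
  0.\<close>

lemma Szego_lower_bound:
  fixes v :: "real \<Rightarrow> real"
  assumes v: "integrable arc_measure v" and lv: "integrable arc_measure (\<lambda>t. ln (v t))"
    and pos: "AE t in arc_measure. v t > 0" and h: "coeff h 0 = 1"
  shows "exp (\<integral>t. ln (v t) \<partial>arc_measure) \<le> (\<integral>t. (norm (complex_eval h (cis t)))\<^sup>2 * v t \<partial>arc_measure)"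
proof -
  obtain bs where bs: "\<And>z. complex_eval h z = (\<Prod>b\<leftarrow>bs. 1 - b * z)"
    using complex_eval_factorization[OF h] by blast
  define W where "W e t = (\<Prod>b\<leftarrow>bs. regularised_factor e b t)" for e t
  have W0: "W 0 t = (norm (complex_eval h (cis t)))\<^sup>2" for t
  proof -
    have "regularised_factor 0 b t = norm (1 - b * cis t) * norm (1 - b * cis (- t))" for b
      by (simp add: regularised_factor_def real_sqrt_mult)
    then have "W 0 t = norm (complex_eval h (cis t)) * norm (complex_eval h (cis (- t)))"
      unfolding W_def bs by (induction bs) (simp_all add: norm_mult mult_ac)
    \<comment> \<open>\<open>h\<close> has real coefficients, so the mean over \<open>t\<close> and
      \<open>- t\<close> collapses to \<open>|h|^2\<close> for the full product.\<close>
    moreover have "norm (complex_eval h (cis (- t))) = norm (complex_eval h (cis t))"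
      using cnj_complex_eval[of h "cis t"] by (metis cis_cnj complex_mod_cnj)
    ultimately show ?thesis
      by (simp add: power2_eq_square)
  qed
  have contW: "continuous_on UNIV (\<lambda>t. W e t)" for e
    unfolding W_def by (induction bs) (auto intro!: continuous_intros continuous_on_regularised_factor)
  have contWe: "continuous_on {0..} (\<lambda>e. W e t)" for t
    unfolding W_def regularised_factor_def by (induction bs) (auto intro!: continuous_intros)
  have Wpos: "W e t > 0" if "e > 0" for e t
    unfolding W_def using regularised_factor_pos[OF that] by (induction bs) auto
  have Wnn: "W e t \<ge> 0" if "e \<ge> 0" for e t
    unfolding W_def using regularised_factor_nonneg[OF that] by (induction bs) auto
  have Wmono: "W e t \<le> W e' t" if "0 \<le> e" "e \<le> e'" for e e' t
    unfolding W_def using regularised_factor_nonneg[OF that(1)] regularised_factor_nonneg[of e'] that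
    by (induction bs) (auto intro!: mult_mono regularised_factor_mono prod_list_nonneg)
  have Wb: "\<exists>C. \<forall>t. norm (W e t) \<le> C" for e
  proof -
    have "compact ((\<lambda>t. W e t) ` {0..2*pi})"
      by (intro compact_continuous_image continuous_on_subset[OF contW]) auto
    then obtain C where C: "\<forall>y\<in>(\<lambda>t. W e t) ` {0..2*pi}. norm y \<le> C"
      using compact_imp_bounded bounded_iff by metis
    have "norm (W e t) \<le> C" for t
    proof -
      obtain s where s: "0 \<le> s" "s < 2 * pi" "cis t = cis s"
        using complex_unimodular_polar[of "cis t"] by (metis cis.code norm_cis)
      then have "cis (- t) = cis (- s)"
        by (metis cis_cnj)
      then have "W e t = W e s"
        using s by (simp add: W_def regularised_factor_def)
      then show ?thesis
        using C s by auto
    qed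
    then show ?thesis by blast
  qed
  have [measurable]: "W e \<in> borel_measurable borel" for e
    using borel_measurable_continuous_onI[OF contW[of e]] by simp
  have Wv: "integrable arc_measure (\<lambda>t. W e t * v t)" for e
  proof -
    obtain C where "\<And>t. norm (W e t) \<le> C"
      using Wb by blast
    then show ?thesis
      using integrable_bounded_mult[OF v, of "W e" C] by (simp add: mult.commute)
  qed
  have low: "exp (\<integral>t. ln (v t) \<partial>arc_measure) \<le> (\<integral>t. W e t * v t \<partial>arc_measure)" if e: "e > 0" for e
  proof -
    have lW: "integrable arc_measure (\<lambda>t. ln (W e t))"
      by (intro integrable_arc_measure_continuous continuous_intros contW) (use Wpos[OF e] in \<open>auto simp: less_imp_neq[symmetric]\<close>)
    have ae: "AE t in arc_measure. ln (W e t) + ln (v t) = ln (W e t * v t)"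
      using pos by eventually_elim (use Wpos[OF e] in \<open>simp add: ln_mult_pos\<close>)
    have [measurable]: "v \<in> borel_measurable borel"
      using borel_measurable_integrable[OF v] by simp
    have "integrable arc_measure (\<lambda>t. ln (W e t) + ln (v t))"
      using lW lv by simp
    then have i: "integrable arc_measure (\<lambda>t. ln (W e t * v t))"
      by (rule integrable_cong_AE_imp) (use ae in auto)
    have "(\<integral>t. ln (v t) \<partial>arc_measure) \<le> (\<integral>t. ln (W e t) \<partial>arc_measure) + (\<integral>t. ln (v t) \<partial>arc_measure)"
      using integral_ln_regularised_prod_nonneg[OF e, of bs] by (simp add: W_def)
    also have "\<dots> = (\<integral>t. ln (W e t) + ln (v t) \<partial>arc_measure)"
      using lW lv by simp
    also have "\<dots> = (\<integral>t. ln (W e t * v t) \<partial>arc_measure)"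
      by (intro integral_cong_AE ae) auto
    finally have "exp (\<integral>t. ln (v t) \<partial>arc_measure) \<le> exp (\<integral>t. ln (W e t * v t) \<partial>arc_measure)"
      by simp
    also have "\<dots> \<le> (\<integral>t. W e t * v t \<partial>arc_measure)"
    proof (rule exp_integral_ln_le[OF Wv i])
      show "AE t in arc_measure. 0 < W e t * v t"
        using pos by eventually_elim (use Wpos[OF e] in simp)
    qed
    finally show ?thesis .
  qed
  have [measurable]: "v \<in> borel_measurable borel"
    using borel_measurable_integrable[OF v] by simp
  \<comment> \<open>\<open>W e\<close> increases with \<open>e\<close>, so the case
    \<open>e = 1\<close> dominates the sequence.\<close>
  have "(\<lambda>n. \<integral>t. W (1 / real (Suc n)) t * v t \<partial>arc_measure) \<longlonglongrightarrow> (\<integral>t. W 0 t * v t \<partial>arc_measure)"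
  proof (rule integral_dominated_convergence[where w="\<lambda>t. \<bar>W 1 t * v t\<bar>"])
    have "(\<lambda>n. W (1 / real (Suc n)) t) \<longlonglongrightarrow> W 0 t" for t
      by (rule continuous_on_tendsto_compose[OF contWe])
         (use LIMSEQ_inverse_real_of_nat in \<open>auto simp: inverse_eq_divide\<close>)
    then show "AE t in arc_measure. (\<lambda>n. W (1 / real (Suc n)) t * v t) \<longlonglongrightarrow> W 0 t * v t"
      by (intro AE_I2 tendsto_mult tendsto_const)
    show "AE t in arc_measure. norm (W (1 / real (Suc n)) t * v t) \<le> \<bar>W 1 t * v t\<bar>" for n
      using Wmono[of "1 / real (Suc n)" 1] Wnn[of "1 / real (Suc n)"] Wnn[of 1]
      by (intro AE_I2) (auto simp: abs_mult intro!: mult_right_mono)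
  qed (use Wv in auto)
  then have "exp (\<integral>t. ln (v t) \<partial>arc_measure) \<le> (\<integral>t. W 0 t * v t \<partial>arc_measure)"
    by (rule LIMSEQ_le_const) (use low in auto)
  then show ?thesis
    by (simp add: W0)
qed

section \<open>The extremal function\<close>

text \<open>The majorant \<open>A\<close> comes from Cauchy--Schwarz with weights \<open>2\<^sup>k\<close>; it lets every later limit along the
  minimising sequence be taken by dominated convergence.\<close>
lemma L2_fast_Cauchy_dominated_limit:
  fixes g :: "nat \<Rightarrow> 'a \<Rightarrow> complex"
  assumes gm [measurable]: "\<And>k. g k \<in> borel_measurable M"
    and g2: "\<And>k. integrable M (\<lambda>t. (norm (g k t))\<^sup>2)"
    and d2: "\<And>k. integrable M (\<lambda>t. (norm (g (Suc k) t - g k t))\<^sup>2)"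
    and fast: "\<And>k. (\<integral>t. (norm (g (Suc k) t - g k t))\<^sup>2 \<partial>M) \<le> (1/4) ^ k"
  shows "\<exists>G A. G \<in> borel_measurable M \<and> integrable M A \<and>
           (AE t in M. (\<lambda>k. g k t) \<longlonglongrightarrow> G t \<and> (\<forall>k. (norm (g k t))\<^sup>2 \<le> A t))"
proof -
  \<comment> \<open>The squared increments have integrals at most \<open>(1/4) ^ k\<close>; the
    weight \<open>2 ^ k\<close> leaves \<open>(1/2) ^ k\<close>, which is still summable.\<close>
  define D where "D k t = 2 ^ k * (norm (g (Suc k) t - g k t))\<^sup>2" for k t
  have D0: "D k t \<ge> 0" for k t
    by (simp add: D_def)
  have [measurable]: "D k \<in> borel_measurable M" for k
    by (simp add: D_def[abs_def])
  have Di: "integrable M (D k)" for k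
    unfolding D_def by (intro integrable_mult_right d2)
  have DI: "(\<integral>t. D k t \<partial>M) \<le> (1/2) ^ k" for k
  proof -
    have "(\<integral>t. D k t \<partial>M) \<le> 2 ^ k * (1/4) ^ k"
      unfolding D_def using fast[of k] by simp
    also have "\<dots> = (1/2) ^ k"
      by (simp add: power_mult_distrib[symmetric])
    finally show ?thesis .
  qed
  have sI: "summable (\<lambda>k. \<integral>t. D k t \<partial>M)"
    by (rule summable_comparison_test'[of "\<lambda>k. (1/2) ^ k"]) (auto simp: DI D0)
  have "(\<integral>\<^sup>+t. (\<Sum>k. ennreal (D k t)) \<partial>M) = (\<Sum>k. \<integral>\<^sup>+t. ennreal (D k t) \<partial>M)"
    by (rule nn_integral_suminf) auto
  also have "\<dots> = (\<Sum>k. ennreal (\<integral>t. D k t \<partial>M))"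
    using Di D0 by (simp add: nn_integral_eq_integral)
  also have "\<dots> = ennreal (\<Sum>k. \<integral>t. D k t \<partial>M)"
    using sI D0 by (intro suminf_ennreal2) auto
  finally have "(\<integral>\<^sup>+t. (\<Sum>k. ennreal (D k t)) \<partial>M) \<noteq> \<infinity>"
    by simp
  then have "AE t in M. (\<Sum>k. ennreal (D k t)) \<noteq> \<infinity>"
    by (intro nn_integral_noteq_infinite) auto
  then have sD: "AE t in M. summable (\<lambda>k. D k t)"
    by eventually_elim (use D0 in \<open>auto intro!: summable_suminf_not_top\<close>)
  define A where "A t = 2 * (norm (g 0 t))\<^sup>2 + 4 * (\<Sum>k. D k t)" for t
  have "integrable M (\<lambda>t. \<Sum>k. D k t)"
    using sD sI D0 Di by (intro integrable_suminf) auto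
  then have Ai: "integrable M A"
    unfolding A_def by (intro Bochner_Integration.integrable_add integrable_mult_right g2)
  have "AE t in M. (\<lambda>k. g k t) \<longlonglongrightarrow> lim (\<lambda>k. g k t) \<and> (\<forall>k. (norm (g k t))\<^sup>2 \<le> A t)"
    using sD
  proof eventually_elim
    case (elim t)
    define d where "d k = g (Suc k) t - g k t" for k
    have tel: "g k t = g 0 t + (\<Sum>j<k. d j)" for k
      by (simp add: d_def sum_lessThan_telescope[of "\<lambda>k. g k t"])
    have d_le: "norm (d k) \<le> (1/2) ^ k + D k t" for k
    proof -
      \<comment> \<open>The arithmetic-geometric mean inequality with weight \<open>2 ^ k\<close>
        turns summability of the weighted squares into absolute summability of the
        increments.\<close>
      have "2 * norm (d k) \<le> (1/2) ^ k + 2 ^ k * (norm (d k))\<^sup>2"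
      proof -
        have "0 \<le> (1/2) ^ k * (1 - 2 ^ k * norm (d k))\<^sup>2"
          by simp
        also have "\<dots> = (1/2) ^ k - 2 * norm (d k) + 2 ^ k * (norm (d k))\<^sup>2"
          by (simp add: power2_diff power_mult_distrib power_one_over field_simps power2_eq_square)
        finally show ?thesis by simp
      qed
      moreover have "0 \<le> (1/2::real) ^ k" by simp
      ultimately show ?thesis
        using D0[of k t] unfolding D_def d_def[symmetric] by linarith
    qed
    have "summable (\<lambda>k. (1/2) ^ k + D k t)"
      by (intro summable_add elim) auto
    then have "summable d"
      by (rule summable_comparison_test'[where N=0]) (rule d_le)
    then have "(\<lambda>k. g 0 t + (\<Sum>j<k. d j)) \<longlonglongrightarrow> g 0 t + suminf d"
      by (intro tendsto_intros summable_LIMSEQ)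
    then have "convergent (\<lambda>k. g k t)"
      by (simp only: tel[symmetric] convergentI)
    moreover have "(norm (g k t))\<^sup>2 \<le> A t" for k
    proof -
      have "(norm (\<Sum>j<k. d j))\<^sup>2 \<le> (\<Sum>j<k. norm (d j))\<^sup>2"
        by (intro power_mono norm_sum) auto
      also have "\<dots> = (\<Sum>j<k. sqrt ((1/2) ^ j) * (sqrt (2 ^ j) * norm (d j)))\<^sup>2"
        by (simp add: mult.assoc[symmetric] real_sqrt_mult[symmetric] power_mult_distrib[symmetric])
      also have "\<dots> \<le> (\<Sum>j<k. (sqrt ((1/2) ^ j))\<^sup>2) * (\<Sum>j<k. (sqrt (2 ^ j) * norm (d j))\<^sup>2)"
        by (rule Cauchy_Schwarz_ineq_sum)
      also have "\<dots> = (\<Sum>j<k. (1/2) ^ j) * (\<Sum>j<k. D j t)"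
        by (simp add: power_mult_distrib D_def d_def)
      also have "\<dots> \<le> 2 * (\<Sum>k. D k t)"
      proof (intro mult_mono)
        have "(\<Sum>j<k. (1/2) ^ j) \<le> (\<Sum>j. (1/2::real) ^ j)"
          by (intro sum_le_suminf) auto
        then show "(\<Sum>j<k. (1/2) ^ j) \<le> (2::real)"
          by (simp add: suminf_geometric)
        show "(\<Sum>j<k. D j t) \<le> (\<Sum>k. D k t)"
          using D0 elim by (intro sum_le_suminf) auto
      qed (auto intro!: sum_nonneg D0)
      finally have 1: "(norm (\<Sum>j<k. d j))\<^sup>2 \<le> 2 * (\<Sum>k. D k t)" .
      have "(norm (g k t))\<^sup>2 \<le> (norm (g 0 t) + norm (\<Sum>j<k. d j))\<^sup>2"
        unfolding tel[of k] by (intro power_mono norm_triangle_ineq) auto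
      also have "\<dots> \<le> 2 * (norm (g 0 t))\<^sup>2 + 2 * (norm (\<Sum>j<k. d j))\<^sup>2"
        using sum_squares_bound[of "norm (g 0 t)" "norm (\<Sum>j<k. d j)"] by (simp add: power2_sum)
      finally show ?thesis
        using 1 by (simp add: A_def)
    qed
    ultimately show ?case
      by (simp add: convergent_LIMSEQ_iff)
  qed
  moreover have "(\<lambda>t. lim (\<lambda>k. g k t)) \<in> borel_measurable M"
    by (rule borel_measurable_lim_metric) auto
  ultimately show ?thesis
    using Ai by (intro exI[of _ "\<lambda>t. lim (\<lambda>k. g k t)"] exI[of _ A]) auto
qed

section \<open>The weighted minimum problem\<close>

text \<open>\<open>v\<close> stands for \<open>w_zero w\<close> along \<open>cos\<close>, and
  integrability of \<open>ln v\<close> is the Szego condition. Nonnegativity is demanded at every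
  point, so that squaring \<open>sqrt (v t)\<close> needs no exceptional set.\<close>

locale Szego_weight =
  fixes v :: "real \<Rightarrow> real"
  assumes v_int: "integrable arc_measure v"
    and ln_v_int: "integrable arc_measure (\<lambda>t. ln (v t))"
    and v_pos: "AE t in arc_measure. v t > 0"
    and v_nonneg: "\<And>t. v t \<ge> 0"
begin

lemma v_measurable [measurable]: "v \<in> borel_measurable borel"
  using borel_measurable_integrable[OF v_int] by simp

text \<open>Absorbing \<open>sqrt v\<close> places the polynomials in the unweighted
  \<open>L2\<close> space, where the limit of a minimising sequence is taken.\<close>

definition wfun :: "real poly \<Rightarrow> real \<Rightarrow> complex" where
  "wfun h t = complex_eval h (cis t) * complex_of_real (sqrt (v t))"

definition wnorm2 :: "real poly \<Rightarrow> real" where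
  "wnorm2 h = (\<integral>t. (norm (wfun h t))\<^sup>2 \<partial>arc_measure)"

lemma wfun_measurable [measurable]: "wfun h \<in> borel_measurable borel"
  unfolding wfun_def[abs_def] by measurable

lemma norm_wfun_sq: "(norm (wfun h t))\<^sup>2 = (norm (complex_eval h (cis t)))\<^sup>2 * v t"
  using v_nonneg[of t] by (simp add: wfun_def norm_mult power_mult_distrib)

lemma wfun_sq_integrable: "integrable arc_measure (\<lambda>t. (norm (wfun h t))\<^sup>2)"
proof -
  obtain C where C: "\<And>t. norm (complex_eval h (cis t)) \<le> C"
    using complex_eval_cis_bounded by metis
  have "integrable arc_measure (\<lambda>t. v t * (norm (complex_eval h (cis t)))\<^sup>2)"
    using C by (intro integrable_bounded_mult[where C="C\<^sup>2"] v_int) (auto intro!: power_mono)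
  then show ?thesis
    by (simp add: norm_wfun_sq mult.commute)
qed

lemma wfun_add: "wfun (h + k) t = wfun h t + wfun k t"
  and wfun_diff: "wfun (h - k) t = wfun h t - wfun k t"
  and wfun_smult: "wfun (smult c h) t = complex_of_real c * wfun h t"
  by (simp_all add: wfun_def algebra_simps)

lemma wnorm2_nonneg: "wnorm2 h \<ge> 0"
  by (simp add: wnorm2_def)

lemma integrable_Re_mult_cnj:
  fixes a b :: "real \<Rightarrow> complex"
  assumes [measurable]: "a \<in> borel_measurable borel" "b \<in> borel_measurable borel"
    and "integrable arc_measure (\<lambda>t. (norm (a t))\<^sup>2)" "integrable arc_measure (\<lambda>t. (norm (b t))\<^sup>2)"
  shows "integrable arc_measure (\<lambda>t. Re (a t * cnj (b t)))"
proof (rule Bochner_Integration.integrable_bound[where f="\<lambda>t. (norm (a t))\<^sup>2 + (norm (b t))\<^sup>2"])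
  have "\<bar>Re (x * cnj y)\<bar> \<le> (norm x)\<^sup>2 + (norm y)\<^sup>2" for x y :: complex
    using abs_Re_le_cmod[of "x * cnj y"] sum_squares_bound[of "norm x" "norm y"]
      mult_nonneg_nonneg[of "norm x" "norm y"] by (simp add: norm_mult)
  then show "AE t in arc_measure. norm (Re (a t * cnj (b t))) \<le> norm ((norm (a t))\<^sup>2 + (norm (b t))\<^sup>2)"
    by simp
qed (use assms in auto)

text \<open>Serves twice: \<open>s = 1\<close> and \<open>s = -1\<close> give the parallelogram law,
  and general \<open>s\<close> gives the variation that proves orthogonality.\<close>

lemma wnorm2_add_smult:
  "wnorm2 (h + smult s r) = wnorm2 h + 2 * s * (\<integral>t. Re (wfun r t * cnj (wfun h t)) \<partial>arc_measure) + s\<^sup>2 * wnorm2 r"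
proof -
  have "(norm (x + complex_of_real s * y))\<^sup>2 = (norm x)\<^sup>2 + 2 * s * Re (y * cnj x) + s\<^sup>2 * (norm y)\<^sup>2" for x y :: complex
    unfolding cmod_power2 by (simp add: power2_eq_square algebra_simps)
  then have "(norm (wfun (h + smult s r) t))\<^sup>2
      = (norm (wfun h t))\<^sup>2 + 2 * s * Re (wfun r t * cnj (wfun h t)) + s\<^sup>2 * (norm (wfun r t))\<^sup>2" for t
    by (simp only: wfun_add wfun_smult)
  moreover have "integrable arc_measure (\<lambda>t. Re (wfun r t * cnj (wfun h t)))"
    by (intro integrable_Re_mult_cnj wfun_sq_integrable) auto
  ultimately show ?thesis
    using wfun_sq_integrable unfolding wnorm2_def by (simp del: times_complex.sel)
qed

text \<open>The squared distance, in the weighted mean square, of the constant 1 from the real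
  polynomials that vanish at 0.\<close>

definition wdist2 :: real where
  "wdist2 = Inf (wnorm2 ` {h. coeff h 0 = 1})"

lemma wnorm2_lower: "coeff h 0 = 1 \<Longrightarrow> exp (\<integral>t. ln (v t) \<partial>arc_measure) \<le> wnorm2 h"
  using Szego_lower_bound[OF v_int ln_v_int v_pos] by (simp add: wnorm2_def norm_wfun_sq)

lemma wdist2_le: "coeff h 0 = 1 \<Longrightarrow> wdist2 \<le> wnorm2 h"
  unfolding wdist2_def by (intro cInf_lower bdd_belowI[where m=0]) (auto simp: wnorm2_nonneg)

text \<open>The geometric mean of \<open>v\<close> is positive and bounds every admissible
  \<open>wnorm2 h\<close> from below.\<close>

lemma wdist2_pos: "wdist2 > 0"
proof -
  have "exp (\<integral>t. ln (v t) \<partial>arc_measure) \<le> wdist2"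
    unfolding wdist2_def using wnorm2_lower by (intro cInf_greatest) (auto intro: exI[of _ 1])
  then show ?thesis
    using exp_gt_zero less_le_trans by blast
qed

lemma wdist2_approx:
  assumes "e > 0"
  shows "\<exists>h. coeff h 0 = 1 \<and> wnorm2 h < wdist2 + e"
proof -
  have "\<exists>y\<in>wnorm2 ` {h. coeff h 0 = 1}. y < wdist2 + e"
    unfolding wdist2_def using assms
    by (intro cInf_lessD) (auto intro: exI[of _ 1])
  then show ?thesis by blast
qed

text \<open>Parallelogram law: the midpoint of two admissible polynomials is admissible, so
  near-minimisers are close to each other.\<close>

lemma wnorm2_diff_le:
  assumes "coeff h 0 = 1" "coeff k 0 = 1"
  shows "wnorm2 (h - k) \<le> 2 * (wnorm2 h - wdist2) + 2 * (wnorm2 k - wdist2)"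
proof -
  have "wnorm2 (h + k) = 4 * wnorm2 (smult (1/2) (h + k))"
    by (simp add: wnorm2_def wfun_smult norm_mult power_mult_distrib power2_eq_square del: smult_add_right)
  moreover have "wdist2 \<le> wnorm2 (smult (1/2) (h + k))"
    using assms by (intro wdist2_le) simp
  moreover have "wnorm2 (h - k) + wnorm2 (h + k) = 2 * wnorm2 h + 2 * wnorm2 k"
    using wnorm2_add_smult[of h 1 k] wnorm2_add_smult[of h "-1" k] by simp
  ultimately show ?thesis by simp
qed

text \<open>\<open>g\<close> is the pointwise limit of a fast minimising sequence. Its orthogonality
  relations with shifted polynomials become, in the limit, the vanishing of the nonconstant cosine
  coefficients of \<open>|g|^2\<close>.\<close>

lemma extremal_function:
  "\<exists>g. g \<in> borel_measurable borel \<and> (AE t in arc_measure. (norm (g t))\<^sup>2 = wdist2) \<and>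
     (\<forall>r. (\<integral>t. Re (wfun r t * cnj (g t)) \<partial>arc_measure) = coeff r 0 * wdist2)"
proof -
  \<comment> \<open>With these tolerances \<open>wnorm2_diff_le\<close> bounds consecutive
    differences by \<open>5/8 * (1/4) ^ k\<close>, within the rate that
    \<open>L2_fast_Cauchy_dominated_limit\<close> requires.\<close>
  have "\<exists>h. coeff h 0 = 1 \<and> wnorm2 h < wdist2 + (1/4) ^ k / 4" for k
    by (intro wdist2_approx) simp
  then obtain hs where hs0: "\<And>k. coeff (hs k) 0 = 1" and hs: "\<And>k::nat. wnorm2 (hs k) < wdist2 + (1/4) ^ k / 4"
    by metis
  have hs_lim: "(\<lambda>k. wnorm2 (hs k)) \<longlonglongrightarrow> wdist2"
  proof (rule tendsto_sandwich[where f="\<lambda>_. wdist2" and h="\<lambda>k. wdist2 + (1/4) ^ k / 4"])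
    show "(\<lambda>k. wdist2 + (1/4) ^ k / 4) \<longlonglongrightarrow> wdist2"
      using tendsto_add[OF tendsto_const tendsto_divide[OF LIMSEQ_realpow_zero[of "1/4"] tendsto_const[of 4]], of wdist2] by simp
    show "\<forall>\<^sub>F k in sequentially. wnorm2 (hs k) \<le> wdist2 + (1/4) ^ k / 4"
      using hs by (intro always_eventually allI less_imp_le)
    show "\<forall>\<^sub>F k in sequentially. wdist2 \<le> wnorm2 (hs k)"
      using hs0 by (intro always_eventually allI wdist2_le)
  qed simp
  have "\<exists>G A. G \<in> borel_measurable arc_measure \<and> integrable arc_measure A \<and>
      (AE t in arc_measure. (\<lambda>k. wfun (hs k) t) \<longlonglongrightarrow> G t \<and> (\<forall>k. (norm (wfun (hs k) t))\<^sup>2 \<le> A t))"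
  proof (rule L2_fast_Cauchy_dominated_limit)
    fix k
    show "(\<integral>t. (norm (wfun (hs (Suc k)) t - wfun (hs k) t))\<^sup>2 \<partial>arc_measure) \<le> (1/4) ^ k"
    proof -
      have "(\<integral>t. (norm (wfun (hs (Suc k)) t - wfun (hs k) t))\<^sup>2 \<partial>arc_measure) = wnorm2 (hs (Suc k) - hs k)"
        by (simp add: wnorm2_def wfun_diff)
      also have "\<dots> \<le> 2 * (wnorm2 (hs (Suc k)) - wdist2) + 2 * (wnorm2 (hs k) - wdist2)"
        by (intro wnorm2_diff_le hs0)
      finally have 1: "(\<integral>t. (norm (wfun (hs (Suc k)) t - wfun (hs k) t))\<^sup>2 \<partial>arc_measure)
          \<le> 2 * (wnorm2 (hs (Suc k)) - wdist2) + 2 * (wnorm2 (hs k) - wdist2)" .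
      have 2: "wnorm2 (hs (Suc k)) < wdist2 + (1/4) ^ k / 16"
        using hs[of "Suc k"] by simp
      have "\<lbrakk>I \<le> 2 * (n' - d) + 2 * (n - d); n < d + x / 4; n' < d + x / 16; 0 \<le> x\<rbrakk> \<Longrightarrow> I \<le> x"
        for I n n' d x :: real
        by argo
      from this[OF 1 hs 2] show ?thesis
        by simp
    qed
    show "integrable arc_measure (\<lambda>t. (norm (wfun (hs (Suc k)) t - wfun (hs k) t))\<^sup>2)"
      unfolding wfun_diff[symmetric] by (rule wfun_sq_integrable)
  qed (auto intro: wfun_sq_integrable)
  then obtain g A where g: "g \<in> borel_measurable arc_measure" and Ai: "integrable arc_measure A"
    and gA: "AE t in arc_measure. (\<lambda>k. wfun (hs k) t) \<longlonglongrightarrow> g t \<and> (\<forall>k. (norm (wfun (hs k) t))\<^sup>2 \<le> A t)"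
    by blast
  have [measurable]: "g \<in> borel_measurable borel"
    using g by simp
  have gA': "AE t in arc_measure. (norm (g t))\<^sup>2 \<le> A t"
    using gA
  proof eventually_elim
    case (elim t)
    then have "(\<lambda>k. (norm (wfun (hs k) t))\<^sup>2) \<longlonglongrightarrow> (norm (g t))\<^sup>2"
      by (intro tendsto_intros) auto
    then show ?case
      by (rule LIMSEQ_le_const2) (use elim in auto)
  qed
  have gi: "integrable arc_measure (\<lambda>t. (norm (g t))\<^sup>2)"
    using gA' by (intro Bochner_Integration.integrable_bound[OF Ai]) auto
  have [measurable]: "A \<in> borel_measurable borel"
    using borel_measurable_integrable[OF Ai] by simp
  have bound: "\<bar>Re (x * cnj y)\<bar> \<le> (norm x)\<^sup>2 + (norm y)\<^sup>2" for x y :: complex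
    using abs_Re_le_cmod[of "x * cnj y"] sum_squares_bound[of "norm x" "norm y"]
      mult_nonneg_nonneg[of "norm x" "norm y"] by (simp add: norm_mult)
  have inner_lim: "(\<lambda>k. \<integral>t. Re (a t * cnj (wfun (hs k) t)) \<partial>arc_measure) \<longlonglongrightarrow> (\<integral>t. Re (a t * cnj (g t)) \<partial>arc_measure)"
    if [measurable]: "a \<in> borel_measurable borel" and a: "integrable arc_measure (\<lambda>t. (norm (a t))\<^sup>2)" for a
  proof (rule integral_dominated_convergence[where w="\<lambda>t. (norm (a t))\<^sup>2 + A t"])
    show "AE t in arc_measure. (\<lambda>k. Re (a t * cnj (wfun (hs k) t))) \<longlonglongrightarrow> Re (a t * cnj (g t))"
      using gA by eventually_elim (auto intro!: tendsto_intros simp del: times_complex.sel)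
    show "AE t in arc_measure. norm (Re (a t * cnj (wfun (hs k) t))) \<le> (norm (a t))\<^sup>2 + A t" for k
      using gA by eventually_elim (use bound in \<open>smt (verit) real_norm_def\<close>)
  qed (use a Ai in auto)
  have ortho: "(\<integral>t. Re (wfun r t * cnj (g t)) \<partial>arc_measure) = 0" if r: "coeff r 0 = 0" for r
  proof -
    define b where "b = (\<integral>t. Re (wfun r t * cnj (g t)) \<partial>arc_measure)"
    \<comment> \<open>Adding a multiple of \<open>r\<close> keeps the constant coefficient 1, so the
      perturbed sequence cannot fall below the infimum.\<close>
    have nonneg: "0 \<le> 2 * s * b + s\<^sup>2 * wnorm2 r" for s
    proof -
      have "(\<lambda>k. wnorm2 (hs k) + 2 * s * (\<integral>t. Re (wfun r t * cnj (wfun (hs k) t)) \<partial>arc_measure) + s\<^sup>2 * wnorm2 r)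
          \<longlonglongrightarrow> wdist2 + 2 * s * b + s\<^sup>2 * wnorm2 r"
        unfolding b_def by (intro tendsto_intros hs_lim inner_lim wfun_sq_integrable) auto
      moreover have "wdist2 \<le> wnorm2 (hs k) + 2 * s * (\<integral>t. Re (wfun r t * cnj (wfun (hs k) t)) \<partial>arc_measure) + s\<^sup>2 * wnorm2 r" for k
        unfolding wnorm2_add_smult[symmetric] using r hs0 by (intro wdist2_le) simp
      ultimately have "wdist2 \<le> wdist2 + 2 * s * b + s\<^sup>2 * wnorm2 r"
        by (intro LIMSEQ_le_const) auto
      then show ?thesis by simp
    qed
    \<comment> \<open>The choice \<open>s = - b / n\<close> would minimise the quadratic with
      \<open>n\<close> in place of \<open>wnorm2 r\<close>; adding 1 allows the division even when
      \<open>wnorm2 r = 0\<close>.\<close>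
    define n where "n = wnorm2 r + 1"
    have n: "n > 0" "wnorm2 r < n"
      using wnorm2_nonneg[of r] by (auto simp: n_def)
    have "0 \<le> 2 * (- b / n) * b + (- b / n)\<^sup>2 * n"
      using order_trans[OF nonneg[of "- b / n"] add_left_mono[OF mult_left_mono[OF less_imp_le[OF n(2)]]]] by simp
    also have "\<dots> = - (b\<^sup>2 / n)"
      using n by (simp add: power2_eq_square field_simps)
    finally have "b\<^sup>2 / n \<le> 0" by simp
    then have "b = 0"
      using n by (simp add: divide_le_0_iff)
    then show ?thesis by (simp add: b_def)
  qed
  have int_wg: "integrable arc_measure (\<lambda>t. Re (wfun r t * cnj (g t)))" for r
    by (intro integrable_Re_mult_cnj wfun_sq_integrable gi) auto
  \<comment> \<open>Any \<open>r\<close> differs from \<open>coeff r 0\<close> by a polynomial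
    vanishing at 0, so the inner products with \<open>g\<close> depend on this one constant. It is
    identified with \<open>wdist2\<close> through the cosine coefficient
    \<open>j = 0\<close>.\<close>
  define c where "c = (\<integral>t. Re (wfun 1 t * cnj (g t)) \<partial>arc_measure)"
  have inner_g: "(\<integral>t. Re (wfun r t * cnj (g t)) \<partial>arc_measure) = coeff r 0 * c" for r
  proof -
    define k where "k = r - smult (coeff r 0) 1"
    have "(\<integral>t. Re (wfun k t * cnj (g t)) \<partial>arc_measure) = 0"
      by (intro ortho) (simp add: k_def)
    moreover have "Re (wfun k t * cnj (g t))
        = Re (wfun r t * cnj (g t)) - coeff r 0 * Re (wfun 1 t * cnj (g t))" for t
      unfolding k_def wfun_diff wfun_smult by (simp add: algebra_simps)
    ultimately show ?thesis
      using int_wg[of r] int_wg[of 1] by (simp add: c_def del: times_complex.sel)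
  qed
  have norm_g: "(\<lambda>k. \<integral>t. Re (cis (real j * t) * wfun (hs k) t * cnj (g t)) \<partial>arc_measure)
      \<longlonglongrightarrow> (\<integral>t. cos (real j * t) * (norm (g t))\<^sup>2 \<partial>arc_measure)" for j :: nat
  proof (rule integral_dominated_convergence[where w="\<lambda>t. 2 * A t"])
    show "AE t in arc_measure. (\<lambda>k. Re (cis (real j * t) * wfun (hs k) t * cnj (g t))) \<longlonglongrightarrow> cos (real j * t) * (norm (g t))\<^sup>2"
      using gA
    proof eventually_elim
      case (elim t)
      then have "(\<lambda>k. Re (cis (real j * t) * wfun (hs k) t * cnj (g t))) \<longlonglongrightarrow> Re (cis (real j * t) * g t * cnj (g t))"
        by (intro tendsto_intros) auto
      also have "cis (real j * t) * g t * cnj (g t) = complex_of_real ((norm (g t))\<^sup>2) * cis (real j * t)"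
        unfolding complex_norm_square by (simp only: mult_ac)
      finally show ?case
        by (simp add: mult.commute)
    qed
    show "AE t in arc_measure. norm (Re (cis (real j * t) * wfun (hs k) t * cnj (g t))) \<le> 2 * A t" for k
      using gA gA'
    proof eventually_elim
      case (elim t)
      have "(norm (wfun (hs k) t))\<^sup>2 \<le> A t"
        using elim by blast
      then show ?case
        using bound[of "cis (real j * t) * wfun (hs k) t" "g t"] elim(2) by (simp add: norm_mult del: times_complex.sel)
    qed
  qed (use Ai in auto)
  \<comment> \<open>Multiplication by \<open>cis (real j * t)\<close> is multiplication of the
    polynomial by \<open>monom 1 j\<close>, which kills the constant coefficient unless
    \<open>j = 0\<close>.\<close>
  have shift: "(\<integral>t. Re (cis (real j * t) * wfun (hs k) t * cnj (g t)) \<partial>arc_measure) = (if j = 0 then c else 0)" for j k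
  proof -
    have "wfun (monom 1 j * hs k) t = cis (real j * t) * wfun (hs k) t" for t
      by (simp add: wfun_def Complex.DeMoivre mult_ac)
    then show ?thesis
      using inner_g[of "monom 1 j * hs k"] hs0[of k] by (simp add: coeff_mult del: times_complex.sel)
  qed
  have fourier: "(\<integral>t. cos (real j * t) * (norm (g t))\<^sup>2 \<partial>arc_measure) = (if j = 0 then c else 0)" for j :: nat
    using LIMSEQ_unique[OF norm_g[of j], unfolded shift, OF tendsto_const] by simp
  have "(\<lambda>k. wnorm2 (hs k)) \<longlonglongrightarrow> (\<integral>t. (norm (g t))\<^sup>2 \<partial>arc_measure)"
    unfolding wnorm2_def
  proof (rule integral_dominated_convergence[where w=A])
    show "AE t in arc_measure. (\<lambda>k. (norm (wfun (hs k) t))\<^sup>2) \<longlonglongrightarrow> (norm (g t))\<^sup>2"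
      using gA by eventually_elim (auto intro!: tendsto_intros)
    show "AE t in arc_measure. norm ((norm (wfun (hs k) t))\<^sup>2) \<le> A t" for k
      using gA by eventually_elim auto
  qed (use Ai in auto)
  then have "(\<integral>t. (norm (g t))\<^sup>2 \<partial>arc_measure) = wdist2"
    using hs_lim LIMSEQ_unique by blast
  then have c: "c = wdist2"
    using fourier[of 0] by simp
  have "AE t in arc_measure. (norm (g t))\<^sup>2 - wdist2 = 0"
  proof (rule Fourier_cosine_unique)
    show "integrable arc_measure (\<lambda>t. (norm (g t))\<^sup>2 - wdist2)"
      using gi by simp
    fix j :: nat
    have i: "integrable arc_measure (\<lambda>t. cos (real j * t) * (norm (g t))\<^sup>2)"
      using integrable_bounded_mult[OF gi, of "\<lambda>t. cos (real j * t)" 1] by (simp add: mult.commute)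
    have "integrable arc_measure (\<lambda>t. cos (real j * t))"
      by (intro integrable_arc_measure_bounded[where C=1]) auto
    then show "(\<integral>t. cos (real j * t) * ((norm (g t))\<^sup>2 - wdist2) \<partial>arc_measure) = 0"
      using i by (simp add: right_diff_distrib fourier c integral_cos_multiple_arc_measure)
  qed
  then have "AE t in arc_measure. (norm (g t))\<^sup>2 = wdist2"
    by eventually_elim simp
  then show ?thesis
    using inner_g by (intro exI[of _ g]) (simp add: c)
qed

end

section \<open>Entropy of the arcsine law\<close>

text \<open>Apply \<open>ln y <= y\<close> to \<open>y = 1 / sqrt x\<close>. The bound yields
  continuity of \<open>x * ln x\<close> at 0.\<close>

lemma abs_xlnx_le_sqrt:
  assumes "0 \<le> x" "x \<le> 1"
  shows "\<bar>x * ln x\<bar> \<le> 2 * sqrt (x::real)"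
proof (cases "x = 0")
  case False
  then have x: "0 < sqrt x"
    using assms by simp
  have "ln (inverse (sqrt x)) \<le> inverse (sqrt x)"
    using x by (intro ln_bound) auto
  then have "- ln x \<le> 2 * inverse (sqrt x)"
    using assms False by (simp add: ln_inverse ln_sqrt)
  then have "x * (- ln x) \<le> x * (2 * inverse (sqrt x))"
    using assms by (intro mult_left_mono)
  also have "\<dots> = 2 * sqrt x"
    using x real_sqrt_mult_self[of x] assms by (simp add: field_simps)
  finally show ?thesis
    using assms False by (simp add: abs_mult)
qed simp

text \<open>The convention \<open>ln 0 = 0\<close> gives the function the value 0 at 0, which is
  also its limit there.\<close>

lemma continuous_on_xlnx: "continuous_on {0..} (\<lambda>x::real. x * ln x)"
  unfolding continuous_on_def
proof
  fix x :: real
  assume x: "x \<in> {0..}"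
  show "((\<lambda>x. x * ln x) \<longlongrightarrow> x * ln x) (at x within {0..})"
  proof (cases "x = 0")
    case True
    have "((\<lambda>x. x * ln x) \<longlongrightarrow> 0) (at (0::real) within {0..})"
    proof (rule Lim_null_comparison[where g="\<lambda>x. 2 * sqrt x"])
      show "((\<lambda>x. 2 * sqrt x) \<longlongrightarrow> 0) (at (0::real) within {0..})"
        by (auto intro!: tendsto_eq_intros)
      show "\<forall>\<^sub>F x in at 0 within {0..}. norm (x * ln x) \<le> 2 * sqrt (x::real)"
        unfolding eventually_at by (intro exI[of _ 1]) (auto intro!: abs_xlnx_le_sqrt)
    qed
    then show ?thesis by (simp add: True)
  next
    case False
    then show ?thesis
      using x by (intro tendsto_intros) auto
  qed
qed

lemma continuous_on_entropy_fun:
  assumes "c \<ge> 0"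
  shows "continuous_on UNIV (\<lambda>x::real. c * x\<^sup>2 * ln (c * x\<^sup>2))"
  by (rule continuous_on_compose2[OF continuous_on_xlnx, where f="\<lambda>x. c * x\<^sup>2"])
     (use assms in \<open>auto intro!: continuous_intros\<close>)

text \<open>With \<open>f z = Ln (1 + r z)\<close> the logarithm is \<open>2 Re f\<close>, and on
  the circle \<open>|1 + r z|^2 = 1 + r^2 + r z + r / z\<close>. As \<open>f 0 = 0\<close>, the term
  \<open>f z / z\<close> has a removable singularity, so the integrand is twice the real part of a
  holomorphic \<open>k\<close> with \<open>k 0 = r^2\<close>.\<close>

lemma integral_entropy_inside_disc:
  fixes r :: real
  assumes r: "0 \<le> r" "r < 1"
  shows "(\<integral>t. (norm (1 + r * cis (2 * t)))\<^sup>2 * ln ((norm (1 + r * cis (2 * t)))\<^sup>2) \<partial>arc_measure) = 2 * r\<^sup>2"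
proof -
  define b where "b = - complex_of_real r"
  have b: "norm b < 1"
    using r by (simp add: b_def)
  define f where "f z = Ln (1 - b * z)" for z
  have f: "f holomorphic_on cball 0 1"
    unfolding f_def using one_minus_mult_notin_nonpos_Reals[OF b] by (intro holomorphic_intros) auto
  have f0: "f 0 = 0"
    by (simp add: f_def)
  have df: "deriv f 0 = of_real r"
    unfolding f_def by (rule DERIV_imp_deriv) (auto intro!: derivative_eq_intros simp: b_def)
  define g where "g z = (if z = 0 then deriv f 0 else (f z - f 0) / (z - 0))" for z
  have g: "g holomorphic_on cball 0 1"
    unfolding g_def by (rule pole_lemma[OF f]) simp
  define k where "k z = (1 + (of_real r)\<^sup>2 + of_real r * z) * f z + of_real r * g z" for z
  have k: "k holomorphic_on cball 0 1"
    unfolding k_def by (intro holomorphic_intros f g)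
  have k0: "k 0 = (of_real r)\<^sup>2"
    by (simp add: k_def f0 g_def df power2_eq_square)
  have pt: "(norm (1 + r * cis s))\<^sup>2 * ln ((norm (1 + r * cis s))\<^sup>2) = 2 * Re (k (cis s))" for s
  proof -
    have nz: "1 - b * cis s \<noteq> 0"
      using one_minus_mult_notin_nonpos_Reals[OF b, of "cis s"] by (metis nonpos_Reals_zero_I norm_cis order_refl)
    have "ln ((norm (1 + r * cis s))\<^sup>2) = 2 * Re (f (cis s))"
      using nz by (simp add: f_def ln_realpow Re_Ln b_def)
    moreover have "k (cis s) = complex_of_real ((norm (1 + r * cis s))\<^sup>2) * f (cis s)"
    proof -
      have "g (cis s) = cis (- s) * f (cis s)"
        by (simp add: g_def f0 cis_divide[symmetric] divide_inverse mult.commute flip: cis_inverse)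
      then have "k (cis s) = (1 + (of_real r)\<^sup>2 + of_real r * cis s + of_real r * cis (- s)) * f (cis s)"
        by (simp add: k_def algebra_simps)
      also have "1 + (of_real r)\<^sup>2 + of_real r * cis s + of_real r * cis (- s) = complex_of_real ((norm (1 + r * cis s))\<^sup>2)"
        unfolding complex_norm_square by (simp add: cis_cnj algebra_simps power2_eq_square cis_mult)
      finally show ?thesis .
    qed
    ultimately show ?thesis
      by (simp del: of_real_power)
  qed
  have c: "integrable arc_measure (\<lambda>t. k (cis (2 * t)))"
    by (intro integrable_arc_measure_continuous continuous_on_holomorphic_cis k)
  have "(\<integral>t. (norm (1 + r * cis (2 * t)))\<^sup>2 * ln ((norm (1 + r * cis (2 * t)))\<^sup>2) \<partial>arc_measure)
      = 2 * Re (\<integral>t. k (cis (2 * t)) \<partial>arc_measure)"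
    unfolding pt using integral_Re[OF c] by simp
  also have "\<dots> = 2 * r\<^sup>2"
    unfolding integral_holomorphic_cis_double[OF k] k0 by (simp flip: of_real_power)
  finally show ?thesis .
qed

lemma integral_double_cos_sq: "(\<integral>t. 2 * (cos t)\<^sup>2 \<partial>arc_measure) = 1"
proof -
  have "2 * (cos t)\<^sup>2 = 1 + cos (real 2 * t)" for t
    by (simp add: cos_double_cos)
  moreover have "integrable arc_measure (\<lambda>t. cos (real 2 * t))"
    by (intro integrable_arc_measure_bounded[where C=1]) auto
  ultimately show ?thesis
    using integral_cos_multiple_arc_measure[of 2] by simp
qed

text \<open>Let \<open>r\<close> tend to 1 in the preceding lemma. Since
  \<open>|1 + cis (2 * t)|^2 = 4 (cos t)^2\<close>, splitting off one factor 2 gives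
  \<open>2 = 2 I + 2 ln 2\<close> for the integral \<open>I\<close> sought.\<close>

lemma integral_entropy_cos: "(\<integral>t. 2 * (cos t)\<^sup>2 * ln (2 * (cos t)\<^sup>2) \<partial>arc_measure) = 1 - ln 2"
proof -
  define \<psi> where "\<psi> x = x * ln x" for x :: real
  define X where "X r t = (norm (1 + complex_of_real r * cis (2 * t)))\<^sup>2" for r t
  define \<rho> where "\<rho> n = 1 - 1 / real (Suc n)" for n
  have \<rho>: "0 \<le> \<rho> n" "\<rho> n < 1" for n
    by (auto simp: \<rho>_def)
  have \<rho>_lim: "\<rho> \<longlonglongrightarrow> 1"
    unfolding \<rho>_def using tendsto_diff[OF tendsto_const LIMSEQ_inverse_real_of_nat, of 1] by (simp add: inverse_eq_divide)
  have X: "0 \<le> X r t" "X r t \<le> 4" if "0 \<le> r" "r \<le> 1" for r t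
  proof -
    have "norm (1 + complex_of_real r * cis (2 * t)) \<le> 1 + r"
      using norm_triangle_ineq[of 1 "complex_of_real r * cis (2 * t)"] that by (simp add: norm_mult)
    then have "norm (1 + complex_of_real r * cis (2 * t)) \<le> 2"
      using that by simp
    then have "X r t \<le> 2\<^sup>2"
      unfolding X_def by (intro power_mono) auto
    then show "X r t \<le> 4" by simp
  qed (simp add: X_def)
  have cX: "continuous_on UNIV (\<lambda>t. X r t)" for r
    unfolding X_def by (intro continuous_intros)
  have c\<psi>: "continuous_on UNIV (\<lambda>t. \<psi> (X r t))" for r
    unfolding \<psi>_def by (rule continuous_on_compose2[OF continuous_on_xlnx cX]) (auto simp: X_def)
  have [measurable]: "(\<lambda>t. \<psi> (X r t)) \<in> borel_measurable borel" for r
    by (intro borel_measurable_continuous_onI c\<psi>)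
  have "compact (\<psi> ` {0..4})"
    unfolding \<psi>_def by (intro compact_continuous_image continuous_on_subset[OF continuous_on_xlnx]) auto
  then obtain C where "\<forall>y\<in>\<psi> ` {0..4}. norm y \<le> C"
    using compact_imp_bounded bounded_iff by metis
  then have C: "\<bar>\<psi> (X r t)\<bar> \<le> C" if "0 \<le> r" "r \<le> 1" for r t
    using X[OF that] by auto
  have "(\<lambda>n. \<integral>t. \<psi> (X (\<rho> n) t) \<partial>arc_measure) \<longlonglongrightarrow> (\<integral>t. \<psi> (X 1 t) \<partial>arc_measure)"
  proof (rule integral_dominated_convergence[where w="\<lambda>t. C"])
    show "AE t in arc_measure. (\<lambda>n. \<psi> (X (\<rho> n) t)) \<longlonglongrightarrow> \<psi> (X 1 t)"
    proof (intro AE_I2)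
      fix t
      have "(\<lambda>n. X (\<rho> n) t) \<longlonglongrightarrow> X 1 t"
        unfolding X_def by (intro tendsto_intros tendsto_of_real \<rho>_lim)
      then show "(\<lambda>n. \<psi> (X (\<rho> n) t)) \<longlonglongrightarrow> \<psi> (X 1 t)"
        unfolding \<psi>_def by (rule continuous_on_tendsto_compose[OF continuous_on_xlnx]) (auto simp: X_def)
    qed
    show "AE t in arc_measure. norm (\<psi> (X (\<rho> n) t)) \<le> C" for n
      using C \<rho>[of n] by (intro AE_I2) auto
  qed auto
  then have "(\<lambda>n. 2 * (\<rho> n)\<^sup>2) \<longlonglongrightarrow> (\<integral>t. \<psi> (X 1 t) \<partial>arc_measure)"
    unfolding \<psi>_def X_def by (simp only: integral_entropy_inside_disc[OF \<rho>])
  moreover have "(\<lambda>n. 2 * (\<rho> n)\<^sup>2) \<longlonglongrightarrow> 2 * 1\<^sup>2"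
    by (intro tendsto_intros \<rho>_lim)
  ultimately have "(\<integral>t. \<psi> (X 1 t) \<partial>arc_measure) = 2"
    using LIMSEQ_unique by fastforce
  moreover have "\<psi> (X 1 t) = 2 * (2 * (cos t)\<^sup>2 * ln (2 * (cos t)\<^sup>2)) + 2 * ln 2 * (2 * (cos t)\<^sup>2)" for t
  proof -
    have "X 1 t = 4 * (cos t)\<^sup>2"
    proof -
      have "X 1 t = 1 + 2 * cos (2 * t) + ((sin (2 * t))\<^sup>2 + (cos (2 * t))\<^sup>2)"
        unfolding X_def cmod_power2 by (simp add: power2_eq_square algebra_simps)
      then have "X 1 t = 2 + 2 * cos (2 * t)"
        by (simp only: sin_cos_squared_add)
      then show ?thesis
        by (simp add: cos_double_cos)
    qed
    then have X1: "X 1 t = 2 * (2 * (cos t)\<^sup>2)" by simp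
    show ?thesis
    proof (cases "cos t = 0")
      case False
      then have "ln (2 * (2 * (cos t)\<^sup>2)) = ln 2 + ln (2 * (cos t)\<^sup>2)"
        by (intro ln_mult_pos) auto
      then show ?thesis
        unfolding \<psi>_def X1 by (simp add: algebra_simps)
    qed (simp add: \<psi>_def X1)
  qed
  moreover have "integrable arc_measure (\<lambda>t. 2 * (cos t)\<^sup>2 * ln (2 * (cos t)\<^sup>2))"
    by (intro integrable_arc_measure_continuous continuous_on_compose2[OF continuous_on_entropy_fun[of 2], where f=cos])
       (auto intro!: continuous_intros)
  moreover have "integrable arc_measure (\<lambda>t. 2 * (cos t)\<^sup>2)"
    by (intro integrable_arc_measure_continuous continuous_intros)
  ultimately have "2 = 2 * (\<integral>t. 2 * (cos t)\<^sup>2 * ln (2 * (cos t)\<^sup>2) \<partial>arc_measure) + 2 * ln 2 * (\<integral>t. 2 * (cos t)\<^sup>2 \<partial>arc_measure)"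
    by (metis (no_types, lifting) Bochner_Integration.integral_add Bochner_Integration.integral_cong integrable_mult_right integral_mult_right_zero)
  then show ?thesis
    unfolding integral_double_cos_sq by simp
qed

section \<open>Mean square asymptotics of orthonormal polynomials\<close>

fun Chebyshev_T :: "nat \<Rightarrow> real poly" where
  "Chebyshev_T 0 = 1"
| "Chebyshev_T (Suc 0) = [:0, 1:]"
| "Chebyshev_T (Suc (Suc n)) = [:0, 2:] * Chebyshev_T (Suc n) - Chebyshev_T n"

lemma poly_Chebyshev_T_cos: "poly (Chebyshev_T n) (cos t) = cos (real n * t)"
proof (induction n rule: Chebyshev_T.induct)
  case (3 n)
  have "cos t * cos (real (Suc n) * t) = (cos (real (Suc (Suc n)) * t) + cos (real n * t)) / 2"
    using cos_times_cis[of t n] by (simp add: complex_eq_iff del: of_nat_Suc)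
  with 3 show ?case
    by (simp del: of_nat_Suc)
qed simp_all

lemma degree_Chebyshev_T_le: "degree (Chebyshev_T n) \<le> n"
proof (induction n rule: Chebyshev_T.induct)
  case (3 n)
  have "degree ([:0, 2:] * Chebyshev_T (Suc n)) \<le> degree [:0, 2::real:] + degree (Chebyshev_T (Suc n))"
    by (rule degree_mult_le)
  then show ?case
    using 3 by (auto intro!: degree_diff_le)
qed simp_all

lemma coeff_Chebyshev_T: "coeff (Chebyshev_T (Suc n)) (Suc n) = 2 ^ n"
proof (induction n)
  case (Suc n)
  have "coeff (Chebyshev_T n) (Suc (Suc n)) = 0"
    using degree_Chebyshev_T_le[of n] by (intro coeff_eq_0) simp
  with Suc show ?case
    by simp
qed simp

text \<open>The right-hand side expands into cosines of frequency \<open>n - i\<close>, all positive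
  because \<open>n > degree h\<close>. Only \<open>i = 0\<close> reaches degree \<open>n\<close>,
  contributing \<open>2 * 2^(n-1)\<close>. This supplies the trial polynomial for the leading
  coefficient problem.\<close>

lemma exists_poly_Re_cis_mult_cnj:
  assumes h0: "coeff h 0 = 1" and n: "n > degree h"
  shows "\<exists>q. degree q \<le> n \<and> coeff q n = 2 ^ n \<and>
           (\<forall>t. poly q (cos t) = 2 * Re (cis (real n * t) * cnj (complex_eval h (cis t))))"
proof -
  define q where "q = (\<Sum>i\<le>degree h. smult (2 * coeff h i) (Chebyshev_T (n - i)))"
  have "degree q \<le> n"
    unfolding q_def
    by (intro degree_sum_le order_trans[OF degree_smult_le] order_trans[OF degree_Chebyshev_T_le]) auto
  moreover have "coeff q n = 2 ^ n"
  proof -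
    have "coeff q n = (\<Sum>i\<le>degree h. 2 * coeff h i * coeff (Chebyshev_T (n - i)) n)"
      by (simp add: q_def coeff_sum)
    also have "\<dots> = (\<Sum>i\<in>{0}. 2 * coeff h i * coeff (Chebyshev_T (n - i)) n)"
    proof (intro sum.mono_neutral_right ballI)
      fix i assume "i \<in> {..degree h} - {0}"
      then have "coeff (Chebyshev_T (n - i)) n = 0"
        using degree_Chebyshev_T_le[of "n - i"] n by (intro coeff_eq_0) auto
      then show "2 * coeff h i * coeff (Chebyshev_T (n - i)) n = 0" by simp
    qed auto
    also have "\<dots> = 2 ^ n"
      using n h0 coeff_Chebyshev_T[of "n - 1"] by (cases n) simp_all
    finally show ?thesis .
  qed
  moreover have "poly q (cos t) = 2 * Re (cis (real n * t) * cnj (complex_eval h (cis t)))" for t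
  proof -
    have "cis (real n * t) * cnj (cis t ^ i) = cis (real (n - i) * t)" if "i \<le> degree h" for i
      using that n by (simp add: Complex.DeMoivre cis_cnj cis_mult of_nat_diff algebra_simps)
    then have "cis (real n * t) * cnj (complex_eval h (cis t)) = (\<Sum>i\<le>degree h. complex_of_real (coeff h i) * cis (real (n - i) * t))"
      unfolding complex_eval_altdef by (simp add: sum_distrib_left mult.left_commute del: complex_cnj_power)
    then have "Re (cis (real n * t) * cnj (complex_eval h (cis t))) = (\<Sum>i\<le>degree h. coeff h i * cos (real (n - i) * t))"
      by (simp only: Re_sum) simp
    then show ?thesis
      by (simp add: q_def poly_sum poly_Chebyshev_T_cos sum_distrib_left mult.assoc del: times_complex.sel)
  qed
  ultimately show ?thesis by blast
qed

text \<open>On the circle \<open>z cos t = (1 + z^2) / 2\<close>, so \<open>z^n (cos t)^i\<close> is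
  \<open>z^(n-i) ((1 + z^2) / 2)^i\<close>. At the origin only \<open>i = n\<close> survives, with
  the factor \<open>1 / 2^n\<close>.\<close>

lemma exists_complex_eval_cis_mult_poly_cos:
  assumes "degree p \<le> n"
  shows "\<exists>R. coeff R 0 = coeff p n / 2 ^ n \<and>
           (\<forall>t. complex_eval R (cis t) = cis (real n * t) * complex_of_real (poly p (cos t)))"
proof -
  define R where "R = (\<Sum>i\<le>n. smult (coeff p i) (monom 1 (n - i) * [:1/2, 0, 1/2:] ^ i))"
  have "coeff R 0 = (\<Sum>i\<le>n. coeff p i * ((if n - i = 0 then 1 else 0) * (1/2) ^ i))"
    by (simp add: R_def coeff_sum coeff_mult_0 coeff_0_power)
  also have "\<dots> = (\<Sum>i\<in>{n}. coeff p i * ((if n - i = 0 then 1 else 0) * (1/2) ^ i))"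
    by (intro sum.mono_neutral_right) auto
  also have "\<dots> = coeff p n / 2 ^ n"
    by (simp add: power_one_over)
  finally have "coeff R 0 = coeff p n / 2 ^ n" .
  moreover have "complex_eval R (cis t) = cis (real n * t) * complex_of_real (poly p (cos t))" for t
  proof -
    have c: "complex_eval [:1/2, 0, 1/2:] (cis t) = cis t * complex_of_real (cos t)"
    proof -
      have "complex_of_real (cos t) = (cis t + cis (- t)) / 2"
        by (simp add: complex_eq_iff)
      then show ?thesis
        by (simp add: ring_distribs cis_mult add_divide_distrib)
    qed
    have "complex_eval R (cis t) = (\<Sum>i\<le>n. complex_of_real (coeff p i) * (cis t ^ (n - i) * (cis t * complex_of_real (cos t)) ^ i))"
      unfolding R_def by (simp only: complex_eval_sum complex_eval_smult complex_eval_mult complex_eval_power c complex_eval_monom) simp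
    also have "\<dots> = (\<Sum>i\<le>n. cis (real n * t) * complex_of_real (coeff p i * cos t ^ i))"
    proof (intro sum.cong refl)
      fix i assume "i \<in> {..n}"
      then have "cis t ^ (n - i) * cis t ^ i = cis t ^ n"
        by (simp add: power_add[symmetric])
      then have "cis t ^ (n - i) * cis t ^ i = cis (real n * t)"
        by (simp only: Complex.DeMoivre)
      then show "complex_of_real (coeff p i) * (cis t ^ (n - i) * (cis t * complex_of_real (cos t)) ^ i)
          = cis (real n * t) * complex_of_real (coeff p i * cos t ^ i)"
        by (simp add: power_mult_distrib mult_ac)
    qed
    also have "\<dots> = cis (real n * t) * complex_of_real (\<Sum>i\<le>n. coeff p i * cos t ^ i)"
      by (simp add: sum_distrib_left)
    also have "(\<Sum>i\<le>n. coeff p i * cos t ^ i) = poly (\<Sum>i\<le>n. monom (coeff p i) i) (cos t)"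
      by (simp add: poly_sum poly_monom)
    also have "(\<Sum>i\<le>n. monom (coeff p i) i) = p"
      by (rule poly_as_sum_of_monoms'[OF assms])
    finally show ?thesis .
  qed
  ultimately show ?thesis by blast
qed

context Szego_weight
begin

lemma extremal_unimodular:
  "\<exists>u. u \<in> borel_measurable borel \<and> (\<forall>t. norm (u t) = 1) \<and>
     (\<forall>r. (\<integral>t. Re (complex_eval r (cis t) * u t) * sqrt (v t) \<partial>arc_measure) = coeff r 0 * sqrt wdist2)"
proof -
  obtain g where [measurable]: "g \<in> borel_measurable borel" and g: "AE t in arc_measure. (norm (g t))\<^sup>2 = wdist2"
    and gr: "\<And>r. (\<integral>t. Re (wfun r t * cnj (g t)) \<partial>arc_measure) = coeff r 0 * wdist2"
    using extremal_function by blast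
  \<comment> \<open>The value 1 on the exceptional null set makes \<open>u\<close> unimodular at
    every point.\<close>
  define u where "u t = (if (norm (g t))\<^sup>2 = wdist2 then cnj (g t) / complex_of_real (sqrt wdist2) else 1)" for t
  have [measurable]: "u \<in> borel_measurable borel"
    unfolding u_def[abs_def] by measurable
  have "norm (u t) = 1" for t
  proof -
    have "norm (g t) = sqrt wdist2" if "(norm (g t))\<^sup>2 = wdist2"
      using that by (metis norm_ge_zero real_sqrt_abs abs_of_nonneg)
    then show ?thesis
      using wdist2_pos by (auto simp: u_def norm_divide)
  qed
  moreover have "(\<integral>t. Re (complex_eval r (cis t) * u t) * sqrt (v t) \<partial>arc_measure) = coeff r 0 * sqrt wdist2" for r
  proof -
    have "(\<integral>t. Re (complex_eval r (cis t) * u t) * sqrt (v t) \<partial>arc_measure)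
        = (\<integral>t. Re (wfun r t * cnj (g t)) / sqrt wdist2 \<partial>arc_measure)"
    proof (rule integral_cong_AE)
      show "AE t in arc_measure. Re (complex_eval r (cis t) * u t) * sqrt (v t) = Re (wfun r t * cnj (g t)) / sqrt wdist2"
        using g
      proof eventually_elim
        case (elim t)
        have "complex_eval r (cis t) * u t * complex_of_real (sqrt (v t)) = wfun r t * cnj (g t) / complex_of_real (sqrt wdist2)"
          using elim by (simp add: u_def wfun_def mult_ac)
        from arg_cong[OF this, of Re] show ?case
          by (simp del: times_complex.sel add: Re_divide_of_real) (simp add: algebra_simps)
      qed
    qed measurable
    also have "\<dots> = coeff r 0 * wdist2 / sqrt wdist2"
      by (simp add: gr del: times_complex.sel)
    also have "\<dots> = coeff r 0 * sqrt wdist2"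
      using wdist2_pos by (simp add: real_div_sqrt times_divide_eq_right[symmetric] del: times_divide_eq_right)
    finally show ?thesis .
  qed
  ultimately show ?thesis
    by (intro exI[of _ u]) auto
qed

lemma integrable_poly_cos_weight: "integrable arc_measure (\<lambda>t. poly a (cos t) * poly b (cos t) * v t)"
  using integrable_poly_cos_mult[OF v_int, of "a * b"] by simp

end

section \<open>Orthonormal polynomials and their leading coefficients\<close>

locale Szego_orthonormal = Szego_weight +
  fixes p :: "nat \<Rightarrow> real poly"
  assumes degree_p: "degree (p n) = n"
    and lead_coeff_p: "coeff (p n) n > 0"
    and orthonormal: "(\<integral>t. poly (p n) (cos t) * poly (p m) (cos t) * v t \<partial>arc_measure) = (if m = n then 1 else 0)"
begin

text \<open>Leading terms of \<open>r\<close> are removed one at a time with the \<open>p m\<close>.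
  The alternative \<open>r = 0\<close> matters for \<open>n = 0\<close>, where no degree is
  smaller.\<close>

lemma orthogonal_lower_degree:
  assumes "degree r < n \<or> r = 0"
  shows "(\<integral>t. poly (p n) (cos t) * poly r (cos t) * v t \<partial>arc_measure) = 0"
  using assms
proof (induction "degree r" arbitrary: r rule: less_induct)
  case less
  define m where "m = degree r"
  define c where "c = coeff r m / coeff (p m) m"
  define r' where "r' = r - smult c (p m)"
  show ?case
  proof (cases "r = 0")
    case False
    then have m: "m < n"
      using less.prems by (simp add: m_def)
    have "degree r' \<le> m"
      unfolding r'_def by (intro degree_diff_le order_trans[OF degree_smult_le]) (simp_all add: m_def degree_p)
    moreover have "coeff r' m = 0"
      using lead_coeff_p[of m] by (simp add: r'_def c_def)
    ultimately have "r' = 0 \<or> degree r' < m"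
      using eq_zero_or_degree_less by blast
    then have "(\<integral>t. poly (p n) (cos t) * poly r' (cos t) * v t \<partial>arc_measure) = 0"
    proof
      assume "degree r' < m"
      then show ?thesis
        using less.hyps[of r'] m by (simp add: m_def)
    qed simp
    moreover have "poly (p n) (cos t) * poly r' (cos t) * v t
        = poly (p n) (cos t) * poly r (cos t) * v t - c * (poly (p n) (cos t) * poly (p m) (cos t) * v t)" for t
      by (simp add: r'_def algebra_simps)
    ultimately show ?thesis
      using m orthonormal[of n m] integrable_poly_cos_weight by simp
  qed simp
qed

text \<open>Pythagoras: \<open>q\<close> is a multiple \<open>c\<close> of \<open>p n\<close> plus a
  remainder of lower degree, orthogonal to \<open>p n\<close>.\<close>

lemma lead_coeff_extremal:
  assumes q: "degree q \<le> n"
  shows "(coeff q n / coeff (p n) n)\<^sup>2 \<le> (\<integral>t. (poly q (cos t))\<^sup>2 * v t \<partial>arc_measure)"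
proof -
  define c where "c = coeff q n / coeff (p n) n"
  define r where "r = q - smult c (p n)"
  have "degree r \<le> n"
    unfolding r_def by (intro degree_diff_le order_trans[OF degree_smult_le] q) (simp add: degree_p)
  moreover have "coeff r n = 0"
    using lead_coeff_p[of n] by (simp add: r_def c_def)
  ultimately have "(\<integral>t. poly (p n) (cos t) * poly r (cos t) * v t \<partial>arc_measure) = 0"
    using eq_zero_or_degree_less by (intro orthogonal_lower_degree) blast
  moreover have "(poly q (cos t))\<^sup>2 * v t = c\<^sup>2 * (poly (p n) (cos t) * poly (p n) (cos t) * v t)
      + 2 * c * (poly (p n) (cos t) * poly r (cos t) * v t) + poly r (cos t) * poly r (cos t) * v t" for t
    by (simp add: r_def power2_eq_square algebra_simps)
  moreover have "0 \<le> (\<integral>t. poly r (cos t) * poly r (cos t) * v t \<partial>arc_measure)"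
    using v_nonneg by (intro integral_nonneg_AE) auto
  ultimately show ?thesis
    using orthonormal[of n n] integrable_poly_cos_weight by (simp add: c_def)
qed

text \<open>The constant coefficient of the polynomial in \<open>z = cis t\<close> that equals
  \<open>z^n * poly (p n) (cos t)\<close> on the circle.\<close>

definition lead_scaled :: "nat \<Rightarrow> real" where
  "lead_scaled n = coeff (p n) n / 2 ^ n"

lemma lead_scaled_pos: "lead_scaled n > 0"
  using lead_coeff_p by (simp add: lead_scaled_def)

text \<open>Compare \<open>p n\<close> with the trial polynomial built from a near-minimiser
  \<open>h\<close>. Its leading coefficient is \<open>2 ^ n\<close> and its squared norm
  \<open>a n\<close> tends to \<open>2 * wnorm2 h\<close>, the oscillating part disappearing by
  Riemann--Lebesgue.\<close>

lemma lead_scaled_lower: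
  assumes e: "e > 0"
  shows "\<forall>\<^sub>F n in sequentially. 1 / (lead_scaled n)\<^sup>2 < 2 * (wdist2 + e)"
proof -
  obtain h where h0: "coeff h 0 = 1" and h: "wnorm2 h < wdist2 + e"
    using wdist2_approx[OF e] by blast
  define c where "c t = cnj (complex_eval h (cis t))" for t
  have [measurable]: "c \<in> borel_measurable borel"
    unfolding c_def[abs_def] by measurable
  obtain C where C: "\<And>t. norm (complex_eval h (cis t)) \<le> C"
    using complex_eval_cis_bounded by metis
  have i: "integrable arc_measure (\<lambda>t. complex_of_real (v t) * (c t)\<^sup>2)"
    using C v_int by (intro integrable_bounded_mult[where C="C\<^sup>2"]) (auto simp: c_def norm_power intro!: power_mono)
  define a where "a n = (\<integral>t. (2 * Re (cis (real n * t) * c t))\<^sup>2 * v t \<partial>arc_measure)" for n :: nat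
  have a_eq: "a n = 2 * wnorm2 h + 2 * Re (\<integral>t. complex_of_real (v t) * (c t)\<^sup>2 * cis (real (n * 2) * t) \<partial>arc_measure)" for n
  proof -
    have "(2 * Re (cis (real n * t) * c t))\<^sup>2 * v t
        = 2 * (norm (wfun h t))\<^sup>2 + 2 * Re (complex_of_real (v t) * (c t)\<^sup>2 * cis (real (n * 2) * t))" for t
    proof -
      have *: "(2 * Re z)\<^sup>2 = 2 * (norm z)\<^sup>2 + 2 * Re (z\<^sup>2)" for z :: complex
        unfolding cmod_power2 by (simp add: power2_eq_square)
      have "(cis (real n * t) * c t)\<^sup>2 = (c t)\<^sup>2 * cis (real (n * 2) * t)"
        by (simp add: power_mult_distrib Complex.DeMoivre mult_ac)
      then have "(2 * Re (cis (real n * t) * c t))\<^sup>2 = 2 * (norm (c t))\<^sup>2 + 2 * Re ((c t)\<^sup>2 * cis (real (n * 2) * t))"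
        unfolding * by (simp add: norm_mult del: times_complex.sel)
      moreover have "Re (complex_of_real (v t) * (c t)\<^sup>2 * cis (real (n * 2) * t)) = v t * Re ((c t)\<^sup>2 * cis (real (n * 2) * t))"
        by (simp add: mult.assoc)
      ultimately show ?thesis
        unfolding norm_wfun_sq by (simp add: c_def algebra_simps del: times_complex.sel)
    qed
    moreover have i2: "integrable arc_measure (\<lambda>t. complex_of_real (v t) * (c t)\<^sup>2 * cis (real (n * 2) * t))"
      by (intro integrable_bounded_mult[where C=1] i) auto
    ultimately show ?thesis
      using wfun_sq_integrable[of h] integral_Re[OF i2] integrable_Re[OF i2]
      by (simp add: a_def wnorm2_def del: times_complex.sel)
  qed
  have "strict_mono (\<lambda>n::nat. n * 2)"
    by (intro strict_monoI) simp
  from LIMSEQ_subseq_LIMSEQ[OF Riemann_Lebesgue[OF i] this]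
  have "(\<lambda>n. 2 * wnorm2 h + 2 * Re (\<integral>t. complex_of_real (v t) * (c t)\<^sup>2 * cis (real (n * 2) * t) \<partial>arc_measure))
      \<longlonglongrightarrow> 2 * wnorm2 h + 2 * Re 0"
    unfolding o_def by (intro tendsto_intros)
  then have "a \<longlonglongrightarrow> 2 * wnorm2 h"
    unfolding a_eq[symmetric] by simp
  then have "\<forall>\<^sub>F n in sequentially. a n < 2 * (wdist2 + e)"
    using h by (intro order_tendstoD) auto
  moreover have "\<forall>\<^sub>F n in sequentially. degree h < n"
    by (rule eventually_gt_at_top)
  ultimately show ?thesis
  proof eventually_elim
    case (elim n)
    obtain q where q: "degree q \<le> n" "coeff q n = 2 ^ n"
      "\<And>t. poly q (cos t) = 2 * Re (cis (real n * t) * cnj (complex_eval h (cis t)))"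
      using exists_poly_Re_cis_mult_cnj[OF h0 elim(2)] by blast
    have "(1 / lead_scaled n)\<^sup>2 \<le> a n"
      using lead_coeff_extremal[OF q(1)] unfolding q(2,3) a_def c_def lead_scaled_def by simp
    with elim show ?case
      by (simp add: power_one_over)
  qed
qed

text \<open>Expanding the square gives \<open>1 + b n - 2 * y n\<close> with \<open>b n\<close>
  tending to 1. As this is nonnegative, a lower bound for \<open>y n\<close> close to 1
  suffices.\<close>

theorem L2_asymptotics:
  "\<exists>u. u \<in> borel_measurable borel \<and> (\<forall>t. norm (u t) = 1) \<and>
     (\<lambda>n. \<integral>t. (poly (p n) (cos t) * sqrt (v t) - sqrt 2 * Re (cis (real n * t) * u t))\<^sup>2 \<partial>arc_measure) \<longlonglongrightarrow> 0"
proof -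
  obtain u where [measurable]: "u \<in> borel_measurable borel" and u1: "\<And>t. norm (u t) = 1"
    and ur: "\<And>r. (\<integral>t. Re (complex_eval r (cis t) * u t) * sqrt (v t) \<partial>arc_measure) = coeff r 0 * sqrt wdist2"
    using extremal_unimodular by blast
  define Z where "Z n t = Re (cis (real n * t) * u t)" for n :: nat and t
  have [measurable]: "Z n \<in> borel_measurable borel" for n
    unfolding Z_def[abs_def] by measurable
  have Z1: "\<bar>Z n t\<bar> \<le> 1" for n t
    using abs_Re_le_cmod[of "cis (real n * t) * u t"] by (simp add: Z_def norm_mult u1 del: times_complex.sel)
  define b where "b n = (\<integral>t. 2 * (Z n t)\<^sup>2 \<partial>arc_measure)" for n
  define F where "F n t = poly (p n) (cos t) * sqrt (v t)" for n t
  have [measurable]: "F n \<in> borel_measurable borel" for n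
    unfolding F_def[abs_def] by measurable
  have Zi: "integrable arc_measure (\<lambda>t. 2 * (Z n t)\<^sup>2)" for n
    using Z1 by (intro integrable_arc_measure_bounded[where C=2]) (auto simp: abs_square_le_1)
  have F2: "(F n t)\<^sup>2 = poly (p n) (cos t) * poly (p n) (cos t) * v t" for n t
    using v_nonneg[of t] by (simp add: F_def power_mult_distrib power2_eq_square[of "poly _ _"])
  have Fi: "integrable arc_measure (\<lambda>t. (F n t)\<^sup>2)" for n
    unfolding F2 by (rule integrable_poly_cos_weight)
  have FZi: "integrable arc_measure (\<lambda>t. F n t * Z n t)" for n
  proof (rule Bochner_Integration.integrable_bound[where f="\<lambda>t. (F n t)\<^sup>2 + 2 * (Z n t)\<^sup>2"])
    have "\<bar>x * y\<bar> \<le> x\<^sup>2 + 2 * y\<^sup>2" for x y :: real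
      using sum_squares_bound[of "\<bar>x\<bar>" "\<bar>y\<bar>"] mult_nonneg_nonneg[of "\<bar>x\<bar>" "\<bar>y\<bar>"] zero_le_power2[of y]
      unfolding abs_mult power2_abs by argo
    then show "AE t in arc_measure. norm (F n t * Z n t) \<le> norm ((F n t)\<^sup>2 + 2 * (Z n t)\<^sup>2)"
      by simp
  qed (use Fi Zi in auto)
  have FZ: "(\<integral>t. F n t * Z n t \<partial>arc_measure) = lead_scaled n * sqrt wdist2" for n
  proof -
    obtain R where R: "coeff R 0 = coeff (p n) n / 2 ^ n"
      "\<And>t. complex_eval R (cis t) = cis (real n * t) * complex_of_real (poly (p n) (cos t))"
      using exists_complex_eval_cis_mult_poly_cos[of "p n" n] degree_p by auto
    have "F n t * Z n t = Re (complex_eval R (cis t) * u t) * sqrt (v t)" for t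
      unfolding R by (simp add: F_def Z_def algebra_simps)
    then have "(\<integral>t. F n t * Z n t \<partial>arc_measure) = (\<integral>t. Re (complex_eval R (cis t) * u t) * sqrt (v t) \<partial>arc_measure)"
      by (simp only:)
    then show ?thesis
      unfolding ur by (simp add: R(1) lead_scaled_def)
  qed
  define y where "y n = sqrt 2 * (lead_scaled n * sqrt wdist2)" for n
  have main: "(\<integral>t. (F n t - sqrt 2 * Z n t)\<^sup>2 \<partial>arc_measure) = 1 + b n - 2 * y n" for n
  proof -
    have "(F n t - sqrt 2 * Z n t)\<^sup>2 = (F n t)\<^sup>2 + 2 * (Z n t)\<^sup>2 - 2 * sqrt 2 * (F n t * Z n t)" for t
      by (simp add: power2_diff power_mult_distrib)
    moreover have "(\<integral>t. (F n t)\<^sup>2 \<partial>arc_measure) = 1"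
      unfolding F2 orthonormal by simp
    ultimately show ?thesis
      using Fi[of n] Zi[of n] FZi[of n] FZ[of n] by (simp add: b_def y_def)
  qed
  have b_lim: "b \<longlonglongrightarrow> 1"
  proof -
    have "(\<lambda>n. \<integral>t. 1 * (2 * (Re (cis (real n * t) * u t))\<^sup>2) \<partial>arc_measure)
        \<longlonglongrightarrow> (\<integral>t. 1 \<partial>arc_measure) * (\<integral>t. 2 * (cos t)\<^sup>2 \<partial>arc_measure)"
      by (rule unimodular_powers_equidistributed[where \<phi>="\<lambda>x. 2 * x\<^sup>2"]) (auto simp: u1 intro!: continuous_intros)
    moreover have "(\<integral>t. 1 \<partial>arc_measure) = (1::real)"
      by simp
    ultimately show ?thesis
      by (simp only: b_def[abs_def] Z_def mult_1 integral_double_cos_sq)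
  qed
  have y_lower: "\<forall>\<^sub>F n in sequentially. y n \<ge> 1 - \<eta>" if \<eta>: "0 < \<eta>" "\<eta> < 1" for \<eta>
  proof -
    have "\<forall>\<^sub>F n in sequentially. 1 / (lead_scaled n)\<^sup>2 < 2 * (wdist2 + \<eta> * wdist2)"
      using \<eta> wdist2_pos by (intro lead_scaled_lower) simp
    then show ?thesis
    proof eventually_elim
      case (elim n)
      have pos: "(lead_scaled n)\<^sup>2 > 0"
        using lead_scaled_pos[of n] by simp
      have y2: "(y n)\<^sup>2 = 2 * ((lead_scaled n)\<^sup>2 * wdist2)"
        using wdist2_pos by (simp add: y_def power_mult_distrib)
      have "1 < (y n)\<^sup>2 * (1 + \<eta>)"
        using elim pos unfolding y2 by (simp add: field_simps)
      \<comment> \<open>Multiplying by \<open>1 - \<eta>\<close> replaces division by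
        \<open>1 + \<eta>\<close>; the resulting bound \<open>1 - \<eta>\<close> dominates
        \<open>(1 - \<eta>)^2\<close>, and square roots can be compared.\<close>
      then have "1 * (1 - \<eta>) \<le> (y n)\<^sup>2 * (1 + \<eta>) * (1 - \<eta>)"
        using \<eta> by (intro mult_right_mono) auto
      also have "\<dots> = (y n)\<^sup>2 * (1 - \<eta>\<^sup>2)"
        by (simp add: power2_eq_square algebra_simps)
      also have "\<dots> \<le> (y n)\<^sup>2 * 1"
        by (intro mult_left_mono) auto
      finally have 1: "1 - \<eta> \<le> (y n)\<^sup>2" by simp
      have "(1 - \<eta>)\<^sup>2 \<le> 1 - \<eta>"
        using \<eta> by (simp add: power2_eq_square mult_left_le)
      with 1 have "(1 - \<eta>)\<^sup>2 \<le> (y n)\<^sup>2" by simp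
      moreover have "y n \<ge> 0"
        using lead_scaled_pos[of n] wdist2_pos by (simp add: y_def)
      ultimately show ?case
        by (rule power2_le_imp_le)
    qed
  qed
  have "(\<lambda>n. \<integral>t. (F n t - sqrt 2 * Z n t)\<^sup>2 \<partial>arc_measure) \<longlonglongrightarrow> 0"
  proof (rule order_tendstoI)
    fix a :: real assume "a < 0"
    then show "\<forall>\<^sub>F n in sequentially. a < (\<integral>t. (F n t - sqrt 2 * Z n t)\<^sup>2 \<partial>arc_measure)"
      by (intro always_eventually allI less_le_trans[OF _ Bochner_Integration.integral_nonneg]) auto
  next
    fix a :: real assume a: "0 < a"
    define \<eta> where "\<eta> = min (a / 4) (1 / 2)"
    have \<eta>: "0 < \<eta>" "\<eta> < 1" "2 * \<eta> \<le> a / 2"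
      using a by (auto simp: \<eta>_def)
    have "\<forall>\<^sub>F n in sequentially. b n < 1 + a / 2"
      using b_lim a by (intro order_tendstoD) auto
    with y_lower[OF \<eta>(1,2)]
    show "\<forall>\<^sub>F n in sequentially. (\<integral>t. (F n t - sqrt 2 * Z n t)\<^sup>2 \<partial>arc_measure) < a"
      unfolding main by eventually_elim (use \<eta> in auto)
  qed
  then show ?thesis
    using u1 by (intro exI[of _ u]) (simp add: F_def Z_def)
qed

end

section \<open>Entropy asymptotics on the arc\<close>

text \<open>Neither sequence need converge. As \<open>y\<close> is bounded by \<open>c\<close>, both
  eventually lie in \<open>[- c - 1, c + 1]\<close>, where \<open>\<phi>\<close> is uniformly
  continuous.\<close>

lemma continuous_compose_diff_tendsto_0:
  fixes \<phi> :: "real \<Rightarrow> real"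
  assumes \<phi>: "continuous_on UNIV \<phi>" and y: "\<And>k. \<bar>y k\<bar> \<le> c" and lim: "(\<lambda>k. x k - y k) \<longlonglongrightarrow> 0"
  shows "(\<lambda>k::nat. \<phi> (x k) - \<phi> (y k)) \<longlonglongrightarrow> 0"
proof (rule LIMSEQ_I)
  fix e :: real
  assume "0 < e"
  have "uniformly_continuous_on {- c - 1..c + 1} \<phi>"
    by (intro compact_uniformly_continuous continuous_on_subset[OF \<phi>]) auto
  then obtain d where d: "d > 0" "\<And>a b. a \<in> {- c - 1..c + 1} \<Longrightarrow> b \<in> {- c - 1..c + 1} \<Longrightarrow> dist b a < d \<Longrightarrow> dist (\<phi> b) (\<phi> a) < e"
    unfolding uniformly_continuous_on_def using \<open>0 < e\<close> by metis
  obtain k0 where k0: "\<And>k. k \<ge> k0 \<Longrightarrow> \<bar>x k - y k\<bar> < min d 1"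
    using LIMSEQ_D[OF lim, of "min d 1"] d by auto
  have "norm (\<phi> (x k) - \<phi> (y k) - 0) < e" if "k \<ge> k0" for k
    using d(2)[of "y k" "x k"] k0[OF that] y[of k] by (auto simp: dist_real_def abs_le_iff abs_less_iff)
  then show "\<exists>no. \<forall>k\<ge>no. norm (\<phi> (x k) - \<phi> (y k) - 0) < e"
    by blast
qed

text \<open>Needed because mean square convergence gives almost everywhere convergence only along
  subsequences. Otherwise the indices with \<open>|a n| >= e\<close>, enumerated, would form a
  subsequence without a null subsequence.\<close>

lemma tendsto_0_subseqI:
  fixes a :: "nat \<Rightarrow> real"
  assumes sub: "\<And>s. strict_mono s \<Longrightarrow> \<exists>r. strict_mono (r :: nat \<Rightarrow> nat) \<and> (\<lambda>n. a (s (r n))) \<longlonglongrightarrow> 0"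
  shows "a \<longlonglongrightarrow> 0"
proof (rule ccontr)
  assume "\<not> a \<longlonglongrightarrow> 0"
  then obtain e where e: "e > 0" "\<And>N. \<exists>n\<ge>N. \<bar>a n\<bar> \<ge> e"
    unfolding LIMSEQ_iff by (auto simp: not_less)
  then have inf: "infinite {n. \<bar>a n\<bar> \<ge> e}"
    unfolding infinite_nat_iff_unbounded_le by auto
  obtain r where r: "strict_mono r" "(\<lambda>n. a (enumerate {n. \<bar>a n\<bar> \<ge> e} (r n))) \<longlonglongrightarrow> 0"
    using sub[OF strict_mono_enumerate[OF inf]] by blast
  have "\<bar>a (enumerate {n. \<bar>a n\<bar> \<ge> e} (r n))\<bar> \<ge> e" for n
    using enumerate_in_set[OF inf, of "r n"] by simp
  moreover have "(\<lambda>n. \<bar>a (enumerate {n. \<bar>a n\<bar> \<ge> e} (r n))\<bar>) \<longlonglongrightarrow> \<bar>0\<bar>"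
    by (intro tendsto_rabs r)
  ultimately have "e \<le> \<bar>0\<bar>"
    by (intro LIMSEQ_le_const) auto
  with e show False by simp
qed

text \<open>The quantity is \<open>y\<close> times the negative part of \<open>ln y\<close>, and
  \<open>- ln y <= 1 / y - 1\<close> bounds it for \<open>0 < y < 1\<close>.\<close>

lemma log_plus_excess_bounds:
  assumes "0 \<le> y"
  shows "0 \<le> y * (log_plus y - ln y)" "y * (log_plus y - ln y) \<le> 1"
proof -
  show "0 \<le> y * (log_plus y - ln y)"
    using assms by (simp add: log_plus_def)
  show "y * (log_plus y - ln y) \<le> 1"
  proof (cases "y = 0 \<or> y \<ge> 1")
    case False
    then have y: "0 < y" "y < 1"
      using assms by auto
    have "- ln y \<le> 1 / y - 1"
      using ln_le_minus_one[of "1 / y"] y by (simp add: ln_div)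
    then have "y * (- ln y) \<le> y * (1 / y - 1)"
      using y by (intro mult_left_mono) auto
    then show ?thesis
      using y by (simp add: log_plus_def max_def algebra_simps)
  qed (auto simp: log_plus_def)
qed

lemma borel_measurable_log_plus [measurable]: "log_plus \<in> borel_measurable borel"
  unfolding log_plus_def[abs_def] by measurable

lemma poly_entropy_bounded:
  fixes q :: "real poly"
  shows "\<exists>C. \<forall>x\<in>{-1..1}. \<bar>(poly q x)\<^sup>2 * ln ((poly q x)\<^sup>2)\<bar> \<le> C"
proof -
  have "continuous_on UNIV (\<lambda>x. 1 * (poly q x)\<^sup>2 * ln (1 * (poly q x)\<^sup>2))"
    by (rule continuous_on_compose2[OF continuous_on_entropy_fun[of 1], where f="poly q"]) (auto intro!: continuous_intros)
  then have "compact ((\<lambda>x. (poly q x)\<^sup>2 * ln ((poly q x)\<^sup>2)) ` {-1..1})"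
    by (intro compact_continuous_image) (auto intro: continuous_on_subset)
  then obtain C where "\<forall>y\<in>(\<lambda>x. (poly q x)\<^sup>2 * ln ((poly q x)\<^sup>2)) ` {-1..1}. norm y \<le> C"
    using compact_imp_bounded bounded_iff by metis
  then show ?thesis
    by (intro exI[of _ C]) auto
qed

lemma poly_log_plus_entropy_bounded:
  fixes q :: "real poly"
  shows "\<exists>C. \<forall>x\<in>{-1..1}. \<bar>(poly q x)\<^sup>2 * log_plus ((poly q x)\<^sup>2)\<bar> \<le> C"
proof -
  obtain C where C: "\<And>x. x \<in> {-1..1} \<Longrightarrow> \<bar>(poly q x)\<^sup>2 * ln ((poly q x)\<^sup>2)\<bar> \<le> C"
    using poly_entropy_bounded by blast
  have "\<bar>(poly q x)\<^sup>2 * log_plus ((poly q x)\<^sup>2)\<bar> \<le> \<bar>(poly q x)\<^sup>2 * ln ((poly q x)\<^sup>2)\<bar>" for x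
    unfolding abs_mult by (intro mult_left_mono) (auto simp: log_plus_def)
  then show ?thesis
    using C order_trans by blast
qed

context Szego_orthonormal
begin

text \<open>The error is split into an integral of \<open>X n\<close>, shown to vanish by dominated
  convergence along subsequences, and two integrals of the explicit comparison function
  \<open>G n\<close>, computed by equidistribution.\<close>

theorem entropy_asymptotics:
  assumes M: "M > sqrt 2"
  shows "(\<lambda>n. - (\<integral>t. (poly (p n) (cos t))\<^sup>2 * ln ((poly (p n) (cos t))\<^sup>2) * v t \<partial>arc_measure)
      - ((\<integral>t. ln (v t) \<partial>arc_measure) + ln 2 - 1
         - (\<integral>t. indicator {t. M \<le> \<bar>poly (p n) (cos t) * sqrt (v t)\<bar>} t *
              ((poly (p n) (cos t))\<^sup>2 * log_plus ((poly (p n) (cos t))\<^sup>2) * v t) \<partial>arc_measure))) \<longlonglongrightarrow> 0"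
proof -
  obtain u where [measurable]: "u \<in> borel_measurable borel" and u1: "\<And>t. norm (u t) = 1"
    and L2: "(\<lambda>n. \<integral>t. (poly (p n) (cos t) * sqrt (v t) - sqrt 2 * Re (cis (real n * t) * u t))\<^sup>2 \<partial>arc_measure) \<longlonglongrightarrow> 0"
    using L2_asymptotics by blast
  define Z where "Z n t = Re (cis (real n * t) * u t)" for n :: nat and t
  have [measurable]: "Z n \<in> borel_measurable borel" for n
    unfolding Z_def[abs_def] by measurable
  have Z1: "\<bar>Z n t\<bar> \<le> 1" for n t
    using abs_Re_le_cmod[of "cis (real n * t) * u t"] by (simp add: Z_def norm_mult u1 del: times_complex.sel)
  define P where "P n t = (poly (p n) (cos t))\<^sup>2" for n t
  define F where "F n t = poly (p n) (cos t) * sqrt (v t)" for n t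
  define G where "G n t = sqrt 2 * Z n t" for n t
  have [measurable]: "P n \<in> borel_measurable borel" "F n \<in> borel_measurable borel" "G n \<in> borel_measurable borel" for n
    unfolding P_def[abs_def] F_def[abs_def] G_def[abs_def] by measurable
  define \<phi> where "\<phi> x = x\<^sup>2 * ln (x\<^sup>2)" for x :: real
  have \<phi>: "continuous_on UNIV \<phi>"
    using continuous_on_entropy_fun[of 1] by (simp add: \<phi>_def[abs_def])
  have [measurable]: "\<phi> \<in> borel_measurable borel"
    by (intro borel_measurable_continuous_onI \<phi>)
  have M0: "M > 0"
    using M real_sqrt_ge_zero[of 2] by linarith
  have G_le: "\<bar>G n t\<bar> \<le> sqrt 2" for n t
    using Z1[of n t] by (simp add: G_def abs_mult mult_left_le)
  have G_sq: "(G n t)\<^sup>2 = 2 * (Z n t)\<^sup>2" for n t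
    by (simp add: G_def power_mult_distrib)
  have F_sq: "(F n t)\<^sup>2 = P n t * v t" for n t
    using v_nonneg[of t] by (simp add: F_def P_def power_mult_distrib)
  have P0: "P n t \<ge> 0" for n t
    by (simp add: P_def)
  define A where "A n = {t. M \<le> \<bar>F n t\<bar>}" for n
  have [measurable]: "A n \<in> sets borel" for n
    unfolding A_def by measurable
  obtain K where K: "\<And>x. \<bar>x\<bar> \<le> M \<Longrightarrow> \<bar>\<phi> x\<bar> \<le> K"
  proof -
    have "compact (\<phi> ` {- M..M})"
      by (intro compact_continuous_image continuous_on_subset[OF \<phi>]) auto
    then obtain K where "\<forall>y\<in>\<phi> ` {- M..M}. norm y \<le> K"
      using compact_imp_bounded bounded_iff by metis
    then show ?thesis
      by (intro that[of K]) (auto simp: abs_le_iff)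
  qed
  have G_M: "\<bar>G n t\<bar> \<le> M" for n t
    using G_le[of n t] M by linarith
  have sq_M: "x\<^sup>2 \<le> M\<^sup>2" if "\<bar>x\<bar> \<le> M" for x
    using that M0 by (metis abs_le_square_iff abs_of_pos)

  define X1 where "X1 n t = P n t * ln (P n t) * v t" for n t
  define X2 where "X2 n t = indicator (A n) t * (P n t * log_plus (P n t) * v t)" for n t
  \<comment> \<open>Where \<open>A n\<close> is left, adding the two \<open>G n\<close> terms makes
    \<open>X n\<close> a difference between expressions in \<open>F n\<close> and the same
    expressions in \<open>G n\<close>.\<close>
  define X where "X n t = - X1 n t + X2 n t + \<phi> (G n t) - ln (v t) * (G n t)\<^sup>2" for n t
  have i1: "integrable arc_measure (X1 n)" for n
  proof -
    obtain C where "\<And>x. x \<in> {-1..1} \<Longrightarrow> \<bar>(poly (p n) x)\<^sup>2 * ln ((poly (p n) x)\<^sup>2)\<bar> \<le> C"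
      using poly_entropy_bounded by blast
    then have "\<bar>P n t * ln (P n t)\<bar> \<le> C" for t
      by (simp add: P_def)
    then have "integrable arc_measure (\<lambda>t. v t * (P n t * ln (P n t)))"
      by (intro integrable_bounded_mult[where C=C] v_int) auto
    then show ?thesis
      by (simp add: X1_def[abs_def] mult_ac)
  qed
  have i2: "integrable arc_measure (X2 n)" for n
  proof -
    obtain C where "\<And>x. x \<in> {-1..1} \<Longrightarrow> \<bar>(poly (p n) x)\<^sup>2 * log_plus ((poly (p n) x)\<^sup>2)\<bar> \<le> C"
      using poly_log_plus_entropy_bounded by blast
    then have C: "\<bar>P n t * log_plus (P n t)\<bar> \<le> C" for t
      by (simp add: P_def)
    have "integrable arc_measure (\<lambda>t. v t * (indicator (A n) t * (P n t * log_plus (P n t))))"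
    proof (intro integrable_bounded_mult[where C=C] v_int)
      show "norm (indicator (A n) t * (P n t * log_plus (P n t))) \<le> C" for t
        using C[of t] abs_ge_zero[of "P n t * log_plus (P n t)"] by (auto simp: indicator_def)
    qed auto
    then show ?thesis
      by (simp add: X2_def[abs_def] mult_ac)
  qed
  have i3: "integrable arc_measure (\<lambda>t. \<phi> (G n t))" for n
    using K[OF G_M] by (intro integrable_arc_measure_bounded[where C=K]) auto
  have i4: "integrable arc_measure (\<lambda>t. ln (v t) * (G n t)\<^sup>2)" for n
    using sq_M[OF G_M] by (intro integrable_bounded_mult[where C="M\<^sup>2"] ln_v_int) auto

  \<comment> \<open>This is \<open>ln P = ln (F^2) - ln v\<close> multiplied by \<open>F^2\<close>.
    At a zero of \<open>P\<close> every term containing \<open>P\<close> or \<open>F\<close>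
    vanishes.\<close>
  have off_A: "X n t = (\<phi> (G n t) - \<phi> (F n t)) + ln (v t) * ((F n t)\<^sup>2 - (G n t)\<^sup>2)" if "t \<notin> A n" "v t > 0" for n t
  proof -
    have "X1 n t = \<phi> (F n t) - ln (v t) * (F n t)\<^sup>2"
    proof (cases "P n t = 0")
      case False
      then have "ln ((F n t)\<^sup>2) = ln (P n t) + ln (v t)"
        unfolding F_sq using P0[of n t] that by (intro ln_mult_pos) auto
      then show ?thesis
        unfolding X1_def \<phi>_def by (simp add: F_sq algebra_simps)
    qed (simp add: X1_def \<phi>_def F_sq)
    then show ?thesis
      using that by (simp add: X_def X2_def algebra_simps)
  qed
  \<comment> \<open>\<open>v\<close> controls the excess of \<open>log_plus\<close> over
    \<open>ln\<close> on \<open>A n\<close>; the doubled terms cover one contribution from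
    \<open>F n\<close> off \<open>A n\<close> and one from \<open>G n\<close>.\<close>
  define W where "W t = v t + 2 * K + 2 * M\<^sup>2 * \<bar>ln (v t)\<bar>" for t
  have Wi: "integrable arc_measure W"
    unfolding W_def using v_int ln_v_int by auto
  have dom: "\<bar>X n t\<bar> \<le> W t" if "v t > 0" for n t
  proof -
    have K0: "0 \<le> K"
      using K[OF G_M, of n t] by linarith
    have G2: "\<bar>\<phi> (G n t)\<bar> \<le> K" "\<bar>ln (v t) * (G n t)\<^sup>2\<bar> \<le> M\<^sup>2 * \<bar>ln (v t)\<bar>"
      using K[OF G_M] mult_left_mono[OF sq_M[OF G_M], of "\<bar>ln (v t)\<bar>"] by (auto simp: abs_mult mult.commute)
    have nn: "0 \<le> M\<^sup>2 * \<bar>ln (v t)\<bar>"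
      by simp
    show ?thesis
    proof (cases "t \<in> A n")
      case True
      have "- X1 n t + X2 n t = (P n t * (log_plus (P n t) - ln (P n t))) * v t"
        using True by (simp add: X1_def X2_def algebra_simps)
      moreover have "0 \<le> (P n t * (log_plus (P n t) - ln (P n t))) * v t"
        "(P n t * (log_plus (P n t) - ln (P n t))) * v t \<le> 1 * v t"
        by (intro mult_nonneg_nonneg mult_right_mono log_plus_excess_bounds P0 v_nonneg)+
      ultimately show ?thesis
        using G2 nn K0 unfolding X_def W_def by (simp add: abs_le_iff)
    next
      case False
      then have "\<bar>F n t\<bar> \<le> M"
        by (simp add: A_def)
      then have "\<bar>\<phi> (F n t)\<bar> \<le> K" "\<bar>ln (v t) * (F n t)\<^sup>2\<bar> \<le> M\<^sup>2 * \<bar>ln (v t)\<bar>"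
        using K mult_left_mono[OF sq_M, of "F n t" "\<bar>ln (v t)\<bar>"] by (auto simp: abs_mult mult.commute)
      with G2 that show ?thesis
        unfolding off_A[OF False that] W_def by (simp add: abs_le_iff algebra_simps)
    qed
  qed
  have pointwise: "(\<lambda>k. X (s k) t) \<longlonglongrightarrow> 0"
    if v: "v t > 0" and lim: "(\<lambda>k. F (s k) t - G (s k) t) \<longlonglongrightarrow> 0" for s :: "nat \<Rightarrow> nat" and t
  proof -
    \<comment> \<open>Here \<open>M > sqrt 2\<close> enters: \<open>|G|\<close> is at most
      \<open>sqrt 2\<close>, so a point where \<open>F - G\<close> tends to 0 eventually leaves the
      sets \<open>A (s k)\<close>.\<close>
    have "\<forall>\<^sub>F k in sequentially. \<bar>F (s k) t - G (s k) t\<bar> < M - sqrt 2"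
      using order_tendstoD(2)[OF tendsto_rabs[OF lim], of "M - sqrt 2"] M by simp
    then have ev: "\<forall>\<^sub>F k in sequentially. X (s k) t
        = - (\<phi> (F (s k) t) - \<phi> (G (s k) t)) + ln (v t) * ((F (s k) t)\<^sup>2 - (G (s k) t)\<^sup>2)"
    proof eventually_elim
      case (elim k)
      then have "t \<notin> A (s k)"
        using G_le[of "s k" t] by (auto simp: A_def)
      from off_A[OF this v] show ?case
        by simp
    qed
    have "(\<lambda>k. - (\<phi> (F (s k) t) - \<phi> (G (s k) t)) + ln (v t) * ((F (s k) t)\<^sup>2 - (G (s k) t)\<^sup>2)) \<longlonglongrightarrow> - 0 + ln (v t) * 0"
      by (intro tendsto_intros continuous_compose_diff_tendsto_0[OF \<phi> G_le lim]
          continuous_compose_diff_tendsto_0[where \<phi>="\<lambda>x. x\<^sup>2", OF _ G_le lim] continuous_intros)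
    then show ?thesis
      using tendsto_cong[OF ev] by simp
  qed
  have FGi: "integrable arc_measure (\<lambda>t. (F n t - G n t)\<^sup>2)" for n
  proof (rule Bochner_Integration.integrable_bound[where f="\<lambda>t. 2 * (P n t * v t) + 2 * M\<^sup>2"])
    have "integrable arc_measure (\<lambda>t. P n t * v t)"
      using integrable_poly_cos_weight[of "p n" "p n"] by (simp add: P_def power2_eq_square)
    then show "integrable arc_measure (\<lambda>t. 2 * (P n t * v t) + 2 * M\<^sup>2)"
      by simp
    have "(F n t - G n t)\<^sup>2 \<le> 2 * (P n t * v t) + 2 * M\<^sup>2" for t
    proof -
      have "(F n t - G n t)\<^sup>2 \<le> 2 * (F n t)\<^sup>2 + 2 * (G n t)\<^sup>2"
        using zero_le_power2[of "F n t + G n t"] by (simp add: power2_sum power2_diff)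
      then show ?thesis
        using sq_M[OF G_M, of n t] by (simp add: F_sq)
    qed
    then show "AE t in arc_measure. norm ((F n t - G n t)\<^sup>2) \<le> norm (2 * (P n t * v t) + 2 * M\<^sup>2)"
      using P0 v_nonneg by (intro AE_I2) simp
  qed auto
  have FG: "(\<lambda>n. \<integral>t. (F n t - G n t)\<^sup>2 \<partial>arc_measure) \<longlonglongrightarrow> 0"
    using L2 by (simp only: F_def G_def Z_def)
  have X_lim: "(\<lambda>n. \<integral>t. X n t \<partial>arc_measure) \<longlonglongrightarrow> 0"
  proof (rule tendsto_0_subseqI)
    fix s :: "nat \<Rightarrow> nat"
    assume s: "strict_mono s"
    have "\<exists>r. strict_mono r \<and> (AE t in arc_measure. (\<lambda>n. (F (s (r n)) t - G (s (r n)) t)\<^sup>2) \<longlonglongrightarrow> 0)"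
      using LIMSEQ_subseq_LIMSEQ[OF FG s] by (intro tendsto_L1_AE_subseq FGi) (simp add: o_def)
    then obtain r where r: "strict_mono r" and
      ae: "AE t in arc_measure. (\<lambda>n. (F (s (r n)) t - G (s (r n)) t)\<^sup>2) \<longlonglongrightarrow> 0"
      by blast
    have "(\<lambda>n. \<integral>t. X (s (r n)) t \<partial>arc_measure) \<longlonglongrightarrow> (\<integral>t. 0 \<partial>arc_measure)"
    proof (rule integral_dominated_convergence[where w=W])
      show "AE t in arc_measure. (\<lambda>n. X (s (r n)) t) \<longlonglongrightarrow> 0"
        using ae v_pos
      proof eventually_elim
        case (elim t)
        then have "(\<lambda>n. F (s (r n)) t - G (s (r n)) t) \<longlonglongrightarrow> 0"
          by (simp add: power_tendsto_0_iff)
        from pointwise[OF elim(2) this] show ?case .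
      qed
      show "AE t in arc_measure. norm (X (s (r n)) t) \<le> W t" for n
        using v_pos by eventually_elim (use dom in auto)
      show "X (s (r n)) \<in> borel_measurable arc_measure" for n
        unfolding X_def[abs_def] X1_def X2_def by measurable
    qed (use Wi in auto)
    then show "\<exists>r. strict_mono (r :: nat \<Rightarrow> nat) \<and> (\<lambda>n. \<integral>t. X (s (r n)) t \<partial>arc_measure) \<longlonglongrightarrow> 0"
      using r by (intro exI[of _ r]) simp
  qed
  have lim3: "(\<lambda>n. \<integral>t. \<phi> (G n t) \<partial>arc_measure) \<longlonglongrightarrow> 1 - ln 2"
  proof -
    have "(\<lambda>n. \<integral>t. 1 * (2 * (Re (cis (real n * t) * u t))\<^sup>2 * ln (2 * (Re (cis (real n * t) * u t))\<^sup>2)) \<partial>arc_measure)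
        \<longlonglongrightarrow> (\<integral>t. 1 \<partial>arc_measure) * (\<integral>t. 2 * (cos t)\<^sup>2 * ln (2 * (cos t)\<^sup>2) \<partial>arc_measure)"
      by (rule unimodular_powers_equidistributed[where \<phi>="\<lambda>x. 2 * x\<^sup>2 * ln (2 * x\<^sup>2)"])
         (auto simp: u1 intro!: continuous_on_entropy_fun)
    moreover have "(\<integral>t. 1 \<partial>arc_measure) = (1::real)"
      by simp
    ultimately show ?thesis
      unfolding \<phi>_def G_sq Z_def by (simp only: mult_1 integral_entropy_cos)
  qed
  \<comment> \<open>Equidistribution with weight \<open>ln v\<close>: in the limit
    \<open>(G n)^2\<close> decouples and contributes its mean 1.\<close>
  have lim4: "(\<lambda>n. \<integral>t. ln (v t) * (G n t)\<^sup>2 \<partial>arc_measure) \<longlonglongrightarrow> (\<integral>t. ln (v t) \<partial>arc_measure)"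
  proof -
    have "(\<lambda>n. \<integral>t. ln (v t) * (2 * (Re (cis (real n * t) * u t))\<^sup>2) \<partial>arc_measure)
        \<longlonglongrightarrow> (\<integral>t. ln (v t) \<partial>arc_measure) * (\<integral>t. 2 * (cos t)\<^sup>2 \<partial>arc_measure)"
      by (rule unimodular_powers_equidistributed[where \<phi>="\<lambda>x. 2 * x\<^sup>2"])
         (auto simp: u1 intro!: continuous_intros ln_v_int)
    then show ?thesis
      unfolding G_sq Z_def by (simp only: mult_1_right integral_double_cos_sq)
  qed
  have "(\<lambda>n. (\<integral>t. X n t \<partial>arc_measure) - (\<integral>t. \<phi> (G n t) \<partial>arc_measure) + (\<integral>t. ln (v t) * (G n t)\<^sup>2 \<partial>arc_measure)
      - ((\<integral>t. ln (v t) \<partial>arc_measure) + ln 2 - 1)) \<longlonglongrightarrow> 0 - (1 - ln 2) + (\<integral>t. ln (v t) \<partial>arc_measure)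
      - ((\<integral>t. ln (v t) \<partial>arc_measure) + ln 2 - 1)"
    by (intro tendsto_intros X_lim lim3 lim4)
  moreover have "(\<integral>t. X n t \<partial>arc_measure) = - (\<integral>t. X1 n t \<partial>arc_measure) + (\<integral>t. X2 n t \<partial>arc_measure)
      + (\<integral>t. \<phi> (G n t) \<partial>arc_measure) - (\<integral>t. ln (v t) * (G n t)\<^sup>2 \<partial>arc_measure)" for n
    unfolding X_def using i1[of n] i2[of n] i3[of n] i4[of n] by simp
  ultimately have "(\<lambda>n. - (\<integral>t. X1 n t \<partial>arc_measure)
      - ((\<integral>t. ln (v t) \<partial>arc_measure) + ln 2 - 1 - (\<integral>t. X2 n t \<partial>arc_measure))) \<longlonglongrightarrow> 0"
    by (simp add: algebra_simps)
  then show ?thesis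
    by (simp only: X1_def X2_def P_def A_def F_def)
qed

end

section \<open>Transfer to the interval\<close>

lemma AE_arc_measure_sin_pos: "AE t in arc_measure. sin t > 0"
proof -
  have "AE t in lborel. t \<noteq> (0::real)" "AE t in lborel. t \<noteq> pi"
    by (rule AE_lborel_singleton)+
  then show ?thesis
    unfolding AE_arc_measure_iff by eventually_elim (auto intro!: sin_gt_zero)
qed

text \<open>Substituting \<open>x = cos t\<close> in the integral of the indicator of a null set
  \<open>N\<close> gives zero. The Jacobian is positive almost everywhere, so the preimage of
  \<open>N\<close> is null.\<close>

lemma AE_arc_measure_cos:
  assumes "AE x in lborel. x \<in> {-1..1} \<longrightarrow> Q x"
  shows "AE t in arc_measure. Q (cos t)"
proof -
  obtain N where N: "N \<in> null_sets lborel" "{x \<in> space lborel. \<not> (x \<in> {-1..1} \<longrightarrow> Q x)} \<subseteq> N"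
    using assms by (auto elim!: AE_E simp: null_sets_def)
  have [measurable]: "N \<in> sets borel"
    using N by (auto simp: null_sets_def)
  have ae0: "AE x in lborel. indicator {-1..1} x *\<^sub>R indicator N x = (0::real)"
    using AE_not_in[OF N(1)] by eventually_elim simp
  have int: "set_integrable lborel {-1..1} (indicator N :: real \<Rightarrow> real)"
    unfolding set_integrable_def using ae0 by (subst integrable_cong_AE[where g="\<lambda>_. 0"]) auto
  have "(LINT x:{-1..1}|lborel. indicator N x :: real) = 0"
    unfolding set_lebesgue_integral_def using ae0 by (subst integral_cong_AE[where g="\<lambda>_. 0"]) auto
  then have "(\<integral>t. indicator N (cos t) * (pi * \<bar>sin t\<bar>) \<partial>arc_measure) = (0::real)"
    using integral_cos_substitution(2)[OF int] by simp
  then have "AE t in arc_measure. indicator N (cos t) * (pi * \<bar>sin t\<bar>) = (0::real)"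
    using integral_cos_substitution(1)[OF int] by (subst (asm) integral_nonneg_eq_0_iff_AE) auto
  with AE_arc_measure_sin_pos show ?thesis
  proof eventually_elim
    case (elim t)
    then have "cos t \<notin> N"
      by (auto simp: indicator_def split: if_splits)
    then show ?case
      using subsetD[OF N(2), of "cos t"] by auto
  qed
qed

lemma w_zero_cos: "w_zero w (cos t) = w (cos t) * (pi * \<bar>sin t\<bar>)"
proof -
  have "1 - (cos t)\<^sup>2 = (sin t)\<^sup>2"
    by (simp add: sin_squared_eq)
  then show ?thesis
    by (simp add: w_zero_def)
qed

text \<open>What remains is the change of variables \<open>x = cos t\<close>, which turns
  \<open>w x dx\<close> into \<open>v t\<close> times the arc measure.\<close>

theorem theorem1:
  fixes w :: "real \<Rightarrow> real" and p :: "nat \<Rightarrow> real poly" and M :: real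
  assumes w_int: "set_integrable lborel {-1..1} w"
    and w_nonneg: "AE x in lborel. x \<in> {-1..1} \<longrightarrow> w x \<ge> 0"
    and w_norm: "(LINT x:{-1..1}|lborel. w x) = 1"
    and szego_pos: "AE x in lborel. x \<in> {-1..1} \<longrightarrow> w_zero w x > 0"
    and szego: "set_integrable lborel {-1..1} (\<lambda>x. ln (w_zero w x) * cheb_rho x)"
    and onp: "orthonormal_polys w p"
    and M: "M > sqrt 2"
  shows "(\<lambda>n. entropy_E w (p n)
            - (mutual_entropy_S w + ln 2 - 1
               - (LINT x:Delta_set w (p n) M|lborel.
                    (poly (p n) x)\<^sup>2 * log_plus ((poly (p n) x)\<^sup>2) * w x)))
         \<longlonglongrightarrow> 0"
proof -
  \<comment> \<open>\<open>w\<close> is measurable on \<open>[-1, 1]\<close> only.\<close>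
  define w' where "w' x = indicator {-1..1} x *\<^sub>R w x" for x
  have [measurable]: "w' \<in> borel_measurable borel"
    using borel_measurable_integrable[OF w_int[unfolded set_integrable_def]] by (simp add: w'_def[abs_def])
  have w'_cos: "w' (cos t) = w (cos t)" for t
    by (simp add: w'_def)
  \<comment> \<open>The absolute value only serves to make \<open>v\<close> nonnegative everywhere rather than almost everywhere.\<close>
  define v where "v t = \<bar>w_zero w (cos t)\<bar>" for t
  have v_ae: "AE t in arc_measure. w (cos t) * (pi * \<bar>sin t\<bar>) = v t"
    using AE_arc_measure_cos[OF szego_pos] by eventually_elim (simp add: v_def w_zero_cos)
  have [measurable]: "v \<in> borel_measurable borel"
    unfolding v_def[abs_def] w_zero_cos w'_cos[symmetric] by measurable
  \<comment> \<open>One transfer rule for bounded Borel multipliers \<open>c\<close> handles the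
    integrability of \<open>v\<close>, orthonormality, the entropy and the integral over
    \<open>Delta_set\<close>.\<close>
  have conv: "integrable arc_measure (\<lambda>t. c (cos t) * v t)"
      "(LINT x:{-1..1}|lborel. c x * w x) = (\<integral>t. c (cos t) * v t \<partial>arc_measure)"
    if [measurable]: "c \<in> borel_measurable borel" and C: "\<exists>C. \<forall>x\<in>{-1..1}. \<bar>c x\<bar> \<le> C" for c :: "real \<Rightarrow> real"
  proof -
    obtain C where C: "\<And>x. x \<in> {-1..1} \<Longrightarrow> \<bar>c x\<bar> \<le> C"
      using C by blast
    have "\<bar>c 0\<bar> \<le> C"
      by (rule C) simp
    then have "0 \<le> C" by linarith
    have "integrable lborel (\<lambda>x. (indicator {-1..1} x *\<^sub>R w x) * (indicator {-1..1} x * c x))"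
      using C \<open>0 \<le> C\<close> w_int unfolding set_integrable_def
      by (intro integrable_bounded_mult[where C=C]) (auto simp: indicator_def)
    then have ci: "set_integrable lborel {-1..1} (\<lambda>x. c x * w x)"
      unfolding set_integrable_def
      by (rule Bochner_Integration.integrable_cong[OF refl, THEN iffD1, rotated]) (auto simp: indicator_def)
    have ae: "AE t in arc_measure. c (cos t) * w (cos t) * (pi * \<bar>sin t\<bar>) = c (cos t) * v t"
      using v_ae by eventually_elim simp
    have m: "(\<lambda>t. c (cos t) * w (cos t) * (pi * \<bar>sin t\<bar>)) \<in> borel_measurable arc_measure"
      unfolding w'_cos[symmetric] by measurable
    show "integrable arc_measure (\<lambda>t. c (cos t) * v t)"
      using integral_cos_substitution(1)[OF ci] by (rule integrable_cong_AE_imp) (use ae in auto)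
    show "(LINT x:{-1..1}|lborel. c x * w x) = (\<integral>t. c (cos t) * v t \<partial>arc_measure)"
      unfolding integral_cos_substitution(2)[OF ci] by (rule integral_cong_AE) (use ae m in auto)
  qed
  have ln_ae: "AE t in arc_measure. ln (w_zero w (cos t)) * cheb_rho (cos t) * (pi * \<bar>sin t\<bar>) = ln (v t)"
    using AE_arc_measure_cos[OF szego_pos] AE_arc_measure_sin_pos
  proof eventually_elim
    case (elim t)
    have "1 - (cos t)\<^sup>2 = (sin t)\<^sup>2"
      by (simp add: sin_squared_eq)
    \<comment> \<open>The arcsine density cancels the Jacobian exactly.\<close>
    then have "cheb_rho (cos t) * (pi * \<bar>sin t\<bar>) = 1"
      using elim(2) by (simp add: cheb_rho_def)
    then show ?case
      using elim(1) by (simp add: v_def mult.assoc)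
  qed
  have ln_v_int: "integrable arc_measure (\<lambda>t. ln (v t))"
    using integral_cos_substitution(1)[OF szego] by (rule integrable_cong_AE_imp) (use ln_ae in auto)
  have S: "mutual_entropy_S w = (\<integral>t. ln (v t) \<partial>arc_measure)"
    unfolding mutual_entropy_S_def integral_cos_substitution(2)[OF szego]
    by (rule integral_cong_AE[OF borel_measurable_integrable[OF integral_cos_substitution(1)[OF szego]] _ ln_ae]) measurable
  interpret Szego_orthonormal v p
  proof
    show "integrable arc_measure v"
      using conv(1)[of "\<lambda>_. 1"] by auto
    show "AE t in arc_measure. v t > 0"
      using AE_arc_measure_cos[OF szego_pos] by eventually_elim (simp add: v_def)
    show "degree (p n) = n" for n
      using onp by (simp add: orthonormal_polys_def)
    show "coeff (p n) n > 0" for n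
      using onp unfolding orthonormal_polys_def by metis
    show "(\<integral>t. poly (p n) (cos t) * poly (p m) (cos t) * v t \<partial>arc_measure) = (if m = n then 1 else 0)" for n m
    proof -
      have "compact (poly (p n * p m) ` {-1..1})"
        by (intro compact_continuous_image continuous_intros) auto
      then obtain C where "\<forall>y\<in>poly (p n * p m) ` {-1..1}. norm y \<le> C"
        using compact_imp_bounded bounded_iff by metis
      then have "\<exists>C. \<forall>x\<in>{-1..1}. \<bar>poly (p n) x * poly (p m) x\<bar> \<le> C"
        by (intro exI[of _ C]) auto
      then show ?thesis
        using conv(2)[of "\<lambda>x. poly (p n) x * poly (p m) x"] onp by (simp add: orthonormal_polys_def)
    qed
  qed (simp_all add: v_def ln_v_int[unfolded v_def])
  have E: "entropy_E w (p n) = - (\<integral>t. (poly (p n) (cos t))\<^sup>2 * ln ((poly (p n) (cos t))\<^sup>2) * v t \<partial>arc_measure)" for n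
    unfolding entropy_E_def using conv(2)[OF _ poly_entropy_bounded[of "p n"]] by simp
  have D: "(LINT x:Delta_set w (p n) M|lborel. (poly (p n) x)\<^sup>2 * log_plus ((poly (p n) x)\<^sup>2) * w x)
      = (\<integral>t. indicator {t. M \<le> \<bar>poly (p n) (cos t) * sqrt (v t)\<bar>} t *
              ((poly (p n) (cos t))\<^sup>2 * log_plus ((poly (p n) (cos t))\<^sup>2) * v t) \<partial>arc_measure)" (is "?L = ?R") for n
  proof -
    define D where "D = Delta_set w (p n) M"
    \<comment> \<open>The restriction to \<open>Delta_set\<close> is moved into the multiplier, so
      that \<open>conv\<close> applies; \<open>D\<close> is Borel because \<open>w'\<close> may
      replace \<open>w\<close> on \<open>[-1, 1]\<close>.\<close>
    define c where "c x = indicator D x * ((poly (p n) x)\<^sup>2 * log_plus ((poly (p n) x)\<^sup>2))" for x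
    have "D = {x \<in> {-1..1}. \<bar>poly (p n) x * sqrt (pi * sqrt (1 - x\<^sup>2) * w' x)\<bar> \<ge> M}"
      by (auto simp: D_def Delta_set_def w_zero_def w'_def)
    also have "\<dots> \<in> sets borel"
      by measurable
    finally have [measurable]: "D \<in> sets borel" .
    have [measurable]: "c \<in> borel_measurable borel"
      unfolding c_def[abs_def] by measurable
    obtain C where C: "\<And>x. x \<in> {-1..1} \<Longrightarrow> \<bar>(poly (p n) x)\<^sup>2 * log_plus ((poly (p n) x)\<^sup>2)\<bar> \<le> C"
      using poly_log_plus_entropy_bounded by blast
    have "\<bar>c x\<bar> \<le> C" if "x \<in> {-1..1}" for x
      using C[OF that] abs_ge_zero[of "(poly (p n) x)\<^sup>2 * log_plus ((poly (p n) x)\<^sup>2)"]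
      by (auto simp: c_def indicator_def)
    then have Cc: "\<exists>C. \<forall>x\<in>{-1..1}. \<bar>c x\<bar> \<le> C"
      by blast
    have "?L = (LINT x:{-1..1}|lborel. c x * w x)"
      unfolding set_lebesgue_integral_def D_def[symmetric]
      by (intro Bochner_Integration.integral_cong refl) (auto simp: c_def D_def Delta_set_def indicator_def)
    also have "\<dots> = (\<integral>t. c (cos t) * v t \<partial>arc_measure)"
      by (intro conv Cc) measurable
    also have "\<dots> = ?R"
    proof (rule integral_cong_AE)
      show "AE t in arc_measure. c (cos t) * v t = indicator {t. M \<le> \<bar>poly (p n) (cos t) * sqrt (v t)\<bar>} t *
              ((poly (p n) (cos t))\<^sup>2 * log_plus ((poly (p n) (cos t))\<^sup>2) * v t)"
        using AE_arc_measure_cos[OF szego_pos]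
        by eventually_elim (auto simp: c_def D_def Delta_set_def v_def indicator_def)
    qed measurable
    finally show ?thesis .
  qed
  show ?thesis
    unfolding E S D by (rule entropy_asymptotics[OF M])
qed

end
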